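(* Let $\mathcal{L}_1$ and $\mathcal{L}_2$ be two non-constant $L$-functions in the extended Selberg class $\mathcal{S}^{\#}$, each of positive degree and each with first Dirichlet coefficient $a(1)=1$. Let $t\ge 1$ be an integer and let $S=\{\alpha_1,\alpha_2,\ldots,\alpha_t\}\subset\mathbb{C}$ be a set of $t$ distinct complex numbers. If $\mathcal{L}_1$ and $\mathcal{L}_2$ share the set $S$ counting multiplicities, then $\mathcal{L}_1=\mathcal{L}_2$. (The two functions are not assumed to satisfy the same functional equation.)
   Context: The extended Selberg class $\mathcal{S}^{\#}$ consists of the not identically vanishing Dirichlet series $\mathcal{L}(s)=\sum_{n=1}^{\infty}a(n)n^{-s}$ such that: (i) the series converges absolutely for $\Re(s)>1$; (ii) (analytic continuation) there is an integer $k\ge 0$ such that $(s-1)^k\mathcal{L}(s)$ extends to an entire function of finite order; (iii) (functional equation) there are an integer $K\ge 0$, reals $Q>0$, $\lambda_j>0$, complex numbers $\nu_j$ with $\Re(\nu_j)\ge 0$ ($1\le j\le K$) and $\omega\in\mathbb{C}$ with $|\omega|=1$ such that $\Lambda(s)=\omega\,\overline{\Lambda(1-\overline{s})}$, where $\Lambda(s)=\mathcal{L}(s)Q^s\prod_{j=1}^{K}\Gamma(\lambda_j s+\nu_j)$. The degree of $\mathcal{L}$ is $d_{\mathcal{L}}=2\sum_{j=1}^{K}\lambda_j$ (so $d_{\mathcal{L}}=0$ iff $K=0$); it depends only on $\mathcal{L}$. "$L$-function" means an element of $\mathcal{S}^{\#}$, regarded as a meromorphic function on $\mathbb{C}$ (with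 at most a pole at $s=1$). Two meromorphic functions $f,g$ on $\mathbb{C}$ share a finite set $S\subset\mathbb{C}$ counting multiplicities (CM) if the functions $\prod_{\alpha\in S}(f-\alpha)$ and $\prod_{\alpha\in S}(g-\alpha)$ have the same zeros with the same multiplicities. *)

theory Defs
  imports "HOL-Complex_Analysis.Complex_Analysis" "HOL-Library.Extended_Nat"
begin

text \<open>
  An \<open>L\<close>-function is a meromorphic function on the whole plane. It is represented by a function
  that is \<open>nicely_meromorphic_on UNIV\<close>: it takes its limit value wherever it is regular and
  the value 0 at a pole. With this normalisation, equality of meromorphic functions is equality
  of HOL functions.
\<close>

definition has_dirichlet_series :: "(complex \<Rightarrow> complex) \<Rightarrow> (nat \<Rightarrow> complex) \<Rightarrow> bool" where
  "has_dirichlet_series L a \<longleftrightarrow>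
     (\<forall>s. Re s > 1 \<longrightarrow>
        (\<lambda>n. norm (a n * of_nat n powr (-s))) summable_on {1..} \<and>
        ((\<lambda>n. a n * of_nat n powr (-s)) has_sum L s) {1..})"

definition finite_order :: "(complex \<Rightarrow> complex) \<Rightarrow> bool" where
  "finite_order f \<longleftrightarrow> (\<exists>\<rho>::real. \<forall>\<^sub>F s in at_infinity. norm (f s) \<le> exp (norm s powr \<rho>))"

text \<open>
  HOL gives \<open>Gamma\<close> the value 0 at its poles, so the defining product has wrong values at points
  where a pole of one factor meets a zero of another. \<open>remove_sings\<close> turns it
  into the meromorphic function that is meant (again with value 0 at the poles).
\<close>

definition completed_L ::
  "(complex \<Rightarrow> complex) \<Rightarrow> real \<Rightarrow> nat \<Rightarrow> (nat \<Rightarrow> real) \<Rightarrow> (nat \<Rightarrow> complex) \<Rightarrow> complex \<Rightarrow> complex" where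
  "completed_L L Q K lam \<nu> =
     remove_sings (\<lambda>s. L s * of_real Q powr s * (\<Prod>j=1..K. Gamma (of_real (lam j) * s + \<nu> j)))"

definition functional_equation ::
  "(complex \<Rightarrow> complex) \<Rightarrow> real \<Rightarrow> nat \<Rightarrow> (nat \<Rightarrow> real) \<Rightarrow> (nat \<Rightarrow> complex) \<Rightarrow> complex \<Rightarrow> bool" where
  "functional_equation L Q K lam \<nu> \<omega> \<longleftrightarrow>
     Q > 0 \<and> (\<forall>j\<in>{1..K}. lam j > 0 \<and> Re (\<nu> j) \<ge> 0) \<and> norm \<omega> = 1 \<and>
     (\<forall>s. completed_L L Q K lam \<nu> s = \<omega> * cnj (completed_L L Q K lam \<nu> (1 - cnj s)))"

definition extended_selberg_class :: "(complex \<Rightarrow> complex) set" where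
  "extended_selberg_class = {L.
     L nicely_meromorphic_on UNIV \<and>
     (\<exists>s. L s \<noteq> 0) \<and>
     (\<exists>a. has_dirichlet_series L a) \<and>
     (\<exists>k::nat. \<exists>g. g holomorphic_on UNIV \<and> finite_order g \<and>
        (\<forall>s. s \<noteq> 1 \<longrightarrow> g s = (s - 1) ^ k * L s)) \<and>
     (\<exists>Q K lam \<nu> \<omega>. functional_equation L Q K lam \<nu> \<omega>)}"

text \<open>
  The functional equation of \<open>L\<close> is not unique, but all functional equations of a given \<open>L\<close> in the
  class yield the same number, so it does not matter which one the choice operator selects.
\<close>

definition selberg_degree :: "(complex \<Rightarrow> complex) \<Rightarrow> real" where
  "selberg_degree L =
     (SOME d. \<exists>Q K lam \<nu> \<omega>. functional_equation L Q K lam \<nu> \<omega> \<and> d = 2 * (\<Sum>j=1..K. lam j))"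

text \<open>
  The multiplicity of \<open>z\<close> as a zero of a meromorphic function: 0 at non-zeros and at poles (where
  \<open>zorder\<close> is negative), and \<open>\<infinity>\<close> if the function vanishes identically near \<open>z\<close>, where
  \<open>zorder\<close> is unspecified. Values at isolated points, such as the value 0 at a pole, have no effect.
\<close>

definition zero_multiplicity :: "(complex \<Rightarrow> complex) \<Rightarrow> complex \<Rightarrow> enat" where
  "zero_multiplicity f z =
     (if \<forall>\<^sub>F w in at z. f w = 0 then \<infinity> else enat (nat (zorder f z)))"

definition share_set_CM :: "(complex \<Rightarrow> complex) \<Rightarrow> (complex \<Rightarrow> complex) \<Rightarrow> complex set \<Rightarrow> bool" where
  "share_set_CM f g S \<longleftrightarrow>
     (\<forall>z. zero_multiplicity (\<lambda>s. \<Prod>\<alpha>\<in>S. f s - \<alpha>) z = zero_multiplicity (\<lambda>s. \<Prod>\<alpha>\<in>S. g s - \<alpha>) z)"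

end

theory Submission
  imports Defs "HOL-Real_Asymp.Real_Asymp"
begin

text \<open>
  Let \<open>P\<close> be the monic polynomial with root set \<open>S\<close>. Sharing \<open>S\<close> makes \<open>P(L1) / P(L2)\<close> free of zeros and
  poles except at \<open>s = 1\<close>, so up to a power of \<open>s - 1\<close> it is the exponential of a polynomial; the
  leading terms of the Dirichlet series as \<open>Re s \<rightarrow> \<infinity>\<close> leave only \<open>P(L1) = C * exp (b * s) * P(L2)\<close>.

  Now look far to the left. Along rays \<open>1 - cnj z\<close> with \<open>z = (\<epsilon> + \<i>) * r\<close>, the functional equation makes
  the \<open>L\<close>-functions grow superexponentially, so that \<open>P(L) = L ^ t\<close> up to a negligible factor. Comparing
  both sides shows that \<open>exp (b * s)\<close> times a quotient of Gamma factors is \<open>1\<close> up to an exponentially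
  small error. The second logarithmic derivative of that quotient is a combination of trigamma functions
  \<open>Polygamma 1 (l * z + \<mu>)\<close>. Taking differences with all the steps \<open>1 / l\<close> turns it into a rational function,
  which decays exponentially and hence vanishes; undoing the differences one at a time, each step
  leaves a periodic function that tends to 0, so the combination itself vanishes and the quotient of Gamma factors
  is identically \<open>1\<close>. What remains is \<open>(L1 / L2) ^ t = 1 + O(exp (- d * Im z))\<close> with \<open>d\<close> independent
  of \<open>\<epsilon>\<close>. If the Dirichlet series first differed at \<open>m\<close>, then \<open>L1 - L2\<close> would have the size of
  \<open>m powr (- \<epsilon> * Im z)\<close> along the ray, a contradiction for small \<open>\<epsilon>\<close>.
\<close>

subsection \<open>Quotients of entire functions of finite order\<close>

text \<open>As the functional equations may differ, the Gamma factors do not cancel in advance, and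
  this shapes the argument: both sides are compared twice, at two different rates. The rays are
  slanted because both coordinates of \<open>z\<close> have to grow: with \<open>Re z\<close> the
  L-functions tend to 1 and the logarithms of Gamma are holomorphic, with \<open>Im z\<close> the
  sine from the reflection formula becomes an exponential up to a relative error of size
  \<open>exp (- 2 * pi * l * Im z)\<close>. In the first comparison the error of
  \<open>L2 / L1\<close>, at most of order \<open>2 powr (- Re z)\<close>, is part of the total
  error, so the rate shrinks with \<open>\<epsilon>\<close>; but any positive rate is enough for
  rigidity to turn the approximate identity into an exact one. In the second comparison the quotient
  of the L-functions is the unknown, and only the errors of the sines and of the lower terms of
  \<open>P\<close> remain. The former fix \<open>d\<close>, twice pi times the smallest
  \<open>l\<close> of both functional equations; the latter decay faster than any exponential, which
  is where positive degree enters. Hence \<open>\<epsilon>\<close> may be chosen after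
  \<open>d\<close> and \<open>m\<close>.\<close>

lemma Borel_Caratheodory_half:
  assumes holf: "f holomorphic_on ball 0 R" and R: "R > 0"
    and Re_less: "\<And>z. norm z < R \<Longrightarrow> Re (f z) < A" and z: "norm z \<le> R / 2"
  shows "norm (f z - f 0) \<le> 2 * (A - Re (f 0))"
proof -
  define B where "B = A - Re (f 0)"
  define k where "k = (\<lambda>w. f (of_real R * w) - f 0)"
  \<comment> \<open>The Moebius map \<open>k / (2 * B - k)\<close> sends the half plane
    \<open>Re k < B\<close> into the unit disc and fixes 0, so Schwarz's lemma gives modulus at most
    1/2 at radius \<open>R / 2\<close>; solving for \<open>k\<close> gives the bound
    \<open>2 * B\<close>.\<close>
  define g where "g = (\<lambda>w. k w / (of_real (2 * B) - k w))"
  have B: "B > 0" unfolding B_def using Re_less[of 0] R by simp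
  have in_ball: "norm (of_real R * w) < R" if "norm w < 1" for w :: complex
    using R that by (simp add: norm_mult)
  have k_less: "norm (k w) < norm (of_real (2 * B) - k w)" if "norm w < 1" for w
  proof -
    have "Re (k w) < B" using Re_less[OF in_ball[OF that]] by (simp add: k_def B_def)
    then have "B * Re (k w) < B * B" using B by simp
    then have "(norm (k w))^2 < (norm (of_real (2 * B) - k w))^2"
      unfolding cmod_power2 by (simp add: power2_eq_square algebra_simps)
    then show ?thesis by (rule power_less_imp_less_base) simp
  qed
  have nz: "of_real (2 * B) - k w \<noteq> 0" if "norm w < 1" for w
    using k_less[OF that] norm_ge_zero[of "k w"] by (metis norm_zero not_less)
  have holk: "k holomorphic_on ball 0 1"
    unfolding k_def
    by (intro holomorphic_intros holomorphic_on_compose_gen[OF _ holf, unfolded o_def])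
       (use in_ball in auto)
  have "g holomorphic_on ball 0 1"
    unfolding g_def using nz by (intro holomorphic_intros holk) auto
  moreover have "g 0 = 0" by (simp add: g_def k_def)
  moreover have "norm (g w) < 1" if "norm w < 1" for w
    using k_less[OF that] nz[OF that] by (simp add: g_def norm_divide)
  ultimately have g_le: "norm (g w) \<le> norm w" if "norm w < 1" for w
    using Schwarz_Lemma(1)[of g w] that by auto
  define w where "w = z / of_real R"
  have w: "norm w \<le> 1/2" "norm w < 1" using z R by (auto simp: w_def norm_divide divide_simps)
  have kw: "k w = f z - f 0" using R by (simp add: k_def w_def)
  have "norm (k w) = norm (g w) * norm (of_real (2 * B) - k w)"
    using nz[OF w(2)] by (simp add: g_def flip: norm_mult)
  also have "\<dots> \<le> 1/2 * (2 * B + norm (k w))"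
  proof (intro mult_mono)
    show "norm (g w) \<le> 1/2" using g_le[OF w(2)] w(1) by linarith
    show "norm (of_real (2 * B) - k w) \<le> 2 * B + norm (k w)"
      using norm_triangle_ineq4[of "of_real (2 * B)" "k w"] B by (simp add: norm_mult)
  qed (use B in auto)
  finally show ?thesis unfolding kw B_def by simp
qed

lemma entire_factor_zero:
  fixes f :: "complex \<Rightarrow> complex"
  assumes holf: "f holomorphic_on UNIV" and nz: "f b \<noteq> 0"
  obtains g n where "g holomorphic_on UNIV" "g a \<noteq> 0" "\<And>w. f w = (w - a) ^ n * g w"
proof -
  have "\<exists>w\<in>UNIV. f w \<noteq> 0" using nz by auto
  from zorder_exist_zero[OF holf open_UNIV connected_UNIV UNIV_I[of a] this]
  obtain r where r: "r > 0" "zor_poly f a holomorphic_on cball a r"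
    "\<And>w. w \<in> cball a r \<Longrightarrow> f w = zor_poly f a w * (w - a) ^ nat (zorder f a) \<and> zor_poly f a w \<noteq> 0"
    by blast
  define n where "n = nat (zorder f a)"
  define g where "g = (\<lambda>w. if w = a then zor_poly f a a else f w / (w - a) ^ n)"
  have g_eq: "g w = zor_poly f a w" if "w \<in> cball a r" for w
    using r(3)[OF that] by (auto simp: g_def n_def)
  have "g holomorphic_on ball a r \<union> (UNIV - {a})"
  proof (rule holomorphic_on_Un)
    have "zor_poly f a holomorphic_on ball a r"
      using r(2) by (rule holomorphic_on_subset) auto
    then show "g holomorphic_on ball a r"
      by (rule holomorphic_transform) (use g_eq in auto)
    have "(\<lambda>w. f w / (w - a) ^ n) holomorphic_on UNIV - {a}"
      by (intro holomorphic_intros holomorphic_on_subset[OF holf]) auto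
    then show "g holomorphic_on UNIV - {a}"
      by (rule holomorphic_transform) (auto simp: g_def)
  qed (auto intro: open_delete)
  also have "ball a r \<union> (UNIV - {a}) = UNIV" using r(1) by auto
  finally have "g holomorphic_on UNIV" .
  moreover have "g a \<noteq> 0" using g_eq[of a] r(3)[of a] r(1) by auto
  moreover have "f w = (w - a) ^ n * g w" for w
    using r(3)[of a] r(1) by (cases "w = a") (auto simp: g_def n_def)
  ultimately show ?thesis using that by blast
qed

text \<open>Induction runs over a finite superset \<open>Z\<close> of the zeros, because dividing by
  the full power at one zero removes that point from \<open>Z\<close>. Normalising the factors as
  \<open>1 - w / a\<close> keeps \<open>p 0 = 1\<close>, and outside the disc of radius
  \<open>2 * R\<close> it gives \<open>norm (w / a) \<ge> 2\<close>, hence modulus at least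
  1.\<close>

lemma entire_factor_out_zeros_aux:
  fixes f :: "complex \<Rightarrow> complex"
  assumes "finite Z" "f holomorphic_on UNIV" "f 0 \<noteq> 0" "{z \<in> cball 0 R. f z = 0} \<subseteq> Z"
  shows "\<exists>p g. p holomorphic_on UNIV \<and> g holomorphic_on UNIV \<and> p 0 = 1 \<and> (\<forall>w. f w = p w * g w)
          \<and> (\<forall>w. norm w \<ge> 2 * R \<longrightarrow> norm (p w) \<ge> 1) \<and> (\<forall>w\<in>cball 0 R. g w \<noteq> 0)"
  using assms
proof (induction Z arbitrary: f rule: finite_induct)
  case empty
  then show ?case by (intro exI[of _ "\<lambda>_. 1"] exI[of _ f]) auto
next
  case (insert a Z)
  show ?case
  proof (cases "a \<in> cball 0 R \<and> f a = 0")
    case False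
    then show ?thesis using insert.IH[of f] insert.prems by blast
  next
    case True
    then have a0: "a \<noteq> 0" using insert.prems by auto
    obtain g n where g: "g holomorphic_on UNIV" "g a \<noteq> 0" "\<And>w. f w = (w - a) ^ n * g w"
      using entire_factor_zero[OF insert.prems(1,2)] by metis
    define g' where "g' = (\<lambda>w. (- a) ^ n * g w)"
    have g': "g' holomorphic_on UNIV" "g' a \<noteq> 0"
      using g a0 by (auto simp: g'_def intro!: holomorphic_intros)
    have fg': "f w = (1 - w / a) ^ n * g' w" for w
    proof -
      have "w - a = (1 - w / a) * (- a)" using a0 by (simp add: field_simps)
      then show ?thesis unfolding g(3) g'_def by (simp only: power_mult_distrib mult.assoc)
    qed
    have "g' 0 \<noteq> 0" using insert.prems(2) fg'[of 0] by auto
    moreover have "{z \<in> cball 0 R. g' z = 0} \<subseteq> Z"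
    proof safe
      fix z assume z: "z \<in> cball 0 R" "g' z = 0"
      then have "f z = 0" using fg' by simp
      then have "z \<in> insert a Z" using insert.prems(3) z by auto
      then show "z \<in> Z" using z g'(2) by auto
    qed
    ultimately obtain p k where pk: "p holomorphic_on UNIV" "k holomorphic_on UNIV" "p 0 = 1"
      "\<forall>w. g' w = p w * k w" "\<forall>w. norm w \<ge> 2 * R \<longrightarrow> norm (p w) \<ge> 1" "\<forall>w\<in>cball 0 R. k w \<noteq> 0"
      using insert.IH[of g'] g'(1) by blast
    show ?thesis
    proof (rule exI[of _ "\<lambda>w. (1 - w / a) ^ n * p w"], rule exI[of _ k], intro conjI)
      show "(\<lambda>w. (1 - w / a) ^ n * p w) holomorphic_on UNIV"
        using a0 by (intro holomorphic_intros pk) auto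
      show "\<forall>w. f w = (1 - w / a) ^ n * p w * k w" using fg' pk(4) by simp
      show "\<forall>w. 2 * R \<le> norm w \<longrightarrow> 1 \<le> norm ((1 - w / a) ^ n * p w)"
      proof (intro allI impI)
        fix w :: complex
        assume w: "2 * R \<le> norm w"
        have "2 * norm a \<le> norm w" using True w by auto
        then have "2 \<le> norm (w / a)" using a0 by (simp add: norm_divide field_simps)
        then have "1 \<le> norm (1 - w / a)" using norm_triangle_ineq3[of 1 "w/a"] by simp
        then have "1 \<le> norm (1 - w / a) ^ n" by simp
        moreover have "1 \<le> norm (p w)" using pk(5) w by auto
        ultimately show "1 \<le> norm ((1 - w / a) ^ n * p w)"
          using mult_mono[of 1 "norm (1 - w / a) ^ n" 1 "norm (p w)"] by (simp add: norm_mult norm_power)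
      qed
    qed (use pk in auto)
  qed
qed

lemma entire_factor_out_zeros:
  fixes f :: "complex \<Rightarrow> complex"
  assumes "f holomorphic_on UNIV" "f 0 \<noteq> 0"
  obtains p g where "p holomorphic_on UNIV" "g holomorphic_on UNIV" "p 0 = 1"
    "\<And>w. f w = p w * g w" "\<And>w. norm w \<ge> 2 * R \<Longrightarrow> norm (p w) \<ge> 1" "\<And>w. norm w \<le> R \<Longrightarrow> g w \<noteq> 0"
proof -
  have "finite {z \<in> cball 0 R. f z = 0}"
  proof -
    have "\<not> f constant_on UNIV \<or> (\<forall>z. f z \<noteq> 0)"
      using assms(2) unfolding constant_on_def by force
    then show ?thesis
      using holomorphic_compact_finite_zeros[OF assms(1) open_UNIV connected_UNIV, of "cball 0 R"] by auto
  qed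
  from entire_factor_out_zeros_aux[OF this assms order_refl] obtain p g where
    "p holomorphic_on UNIV" "g holomorphic_on UNIV" "p 0 = 1" "\<forall>w. f w = p w * g w"
    "\<forall>w. norm w \<ge> 2 * R \<longrightarrow> norm (p w) \<ge> 1" "\<forall>w\<in>cball 0 R. g w \<noteq> 0"
    by blast
  then show ?thesis using that[of p g] by simp
qed

text \<open>Finite order in a form that holds at every point and with a natural exponent, so that
  products, differences and translations need no eventual bounds or real powers.\<close>

definition exp_poly_bounded :: "(complex \<Rightarrow> complex) \<Rightarrow> bool" where
  "exp_poly_bounded f \<longleftrightarrow> (\<exists>C N. C \<ge> 0 \<and> (\<forall>s. norm (f s) \<le> exp (C * (1 + norm s) ^ N)))"

lemma norm_le_on_disc_if_norm_le_on_circle: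
  fixes f :: "complex \<Rightarrow> complex"
  assumes "f holomorphic_on UNIV" "\<And>w. norm w = R \<Longrightarrow> norm (f w) \<le> B" "norm w \<le> R" "R > 0"
  shows "norm (f w) \<le> B"
proof (rule maximum_modulus_frontier[of f "cball 0 R"])
  show "f holomorphic_on interior (cball 0 R)" using assms(1) holomorphic_on_subset by blast
  show "continuous_on (closure (cball 0 R)) f"
    using assms(1) holomorphic_on_imp_continuous_on holomorphic_on_subset by blast
qed (use assms in auto)

text \<open>
  On a disc the zeros of \<open>F2\<close> are divided out of both functions; this increases neither of them beyond
  its maximum on a larger circle, where every factor \<open>1 - w / a\<close> has modulus at least 1.
\<close>

lemma exp_quotient_growth:
  assumes F1: "F1 holomorphic_on UNIV" "exp_poly_bounded F1"
    and F2: "F2 holomorphic_on UNIV" "exp_poly_bounded F2" "F2 0 \<noteq> 0"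
    and h: "h holomorphic_on UNIV" and eq: "\<And>z. F1 z = F2 z * exp (h z)"
  obtains C N where "\<And>z. norm (h z) \<le> C * (1 + norm z) ^ N"
proof -
  obtain C1 N1 where b1: "C1 \<ge> 0" "\<And>s. norm (F1 s) \<le> exp (C1 * (1 + norm s) ^ N1)"
    using F1(2) unfolding exp_poly_bounded_def by blast
  obtain C2 N2 where b2: "C2 \<ge> 0" "\<And>s. norm (F2 s) \<le> exp (C2 * (1 + norm s) ^ N2)"
    using F2(2) unfolding exp_poly_bounded_def by blast
  define l where "l = ln (norm (F2 0))"
  \<comment> \<open>The modulus of \<open>g * exp h\<close> is at most \<open>exp a1\<close>, and
    Borel-Caratheodory bounds the real part of a logarithm of \<open>g\<close> from below;
    \<open>D R\<close> is the resulting upper bound for \<open>Re h\<close>.\<close>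
  define D where "D R = C1 * (1 + 2 * R) ^ N1 - l + 2 * (C2 * (1 + 2 * R) ^ N2 + 1 - l)" for R
  have main: "norm (h z - h 0) \<le> 2 * (D (4 * (1 + norm z)) + 1 - Re (h 0))" for z
  proof -
    \<comment> \<open>The factor 4 pays for two uses of the Borel-Caratheodory inequality, each of
      which halves the radius: for \<open>lg\<close> from \<open>R\<close> to \<open>R / 2\<close>,
      for \<open>h\<close> from \<open>R / 2\<close> to \<open>R / 4\<close>, which still reaches
      \<open>z\<close>.\<close>
    define R where "R = 4 * (1 + norm z)"
    have R: "R > 0" "norm z \<le> R / 4" unfolding R_def using norm_ge_zero[of z]
      by (auto simp: field_simps add_pos_nonneg)
    define a1 where "a1 = C1 * (1 + 2 * R) ^ N1"
    define a2 where "a2 = C2 * (1 + 2 * R) ^ N2"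
    obtain p g where pg: "p holomorphic_on UNIV" "g holomorphic_on UNIV" "p 0 = 1"
      "\<And>w. F2 w = p w * g w" "\<And>w. norm w \<ge> 2 * R \<Longrightarrow> norm (p w) \<ge> 1" "\<And>w. norm w \<le> R \<Longrightarrow> g w \<noteq> 0"
      using entire_factor_out_zeros[OF F2(1,3), of R] by metis
    have g_le: "norm (g w) \<le> exp a2" if "norm w \<le> 2 * R" for w
    proof (rule norm_le_on_disc_if_norm_le_on_circle[OF pg(2) _ that])
      fix w :: complex assume w: "norm w = 2 * R"
      have "norm (g w) \<le> norm (p w) * norm (g w)"
        using mult_right_mono[OF pg(5)[of w], of "norm (g w)"] w by simp
      also have "\<dots> = norm (F2 w)" by (simp add: pg(4) norm_mult)
      also have "\<dots> \<le> exp a2" using b2(2)[of w] w by (simp add: a2_def)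
      finally show "norm (g w) \<le> exp a2" .
    qed (use R in auto)
    have gh_le: "norm (g w * exp (h w)) \<le> exp a1" if "norm w \<le> 2 * R" for w
    proof (rule norm_le_on_disc_if_norm_le_on_circle[OF _ _ that])
      show "(\<lambda>w. g w * exp (h w)) holomorphic_on UNIV" by (intro holomorphic_intros pg h)
      fix w :: complex assume w: "norm w = 2 * R"
      have "norm (g w * exp (h w)) \<le> norm (p w) * norm (g w * exp (h w))"
        using mult_right_mono[OF pg(5)[of w], of "norm (g w * exp (h w))"] w by simp
      also have "\<dots> = norm (F1 w)" by (simp add: eq pg(4) norm_mult)
      also have "\<dots> \<le> exp a1" using b1(2)[of w] w by (simp add: a1_def)
      finally show "norm (g w * exp (h w)) \<le> exp a1" .
    qed (use R in auto)
    have "\<exists>lg. lg holomorphic_on ball 0 R \<and> (\<forall>w\<in>ball 0 R. g w = exp (lg w))"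
    proof -
      have "simply_connected (ball (0::complex) R)"
        by (simp add: convex_imp_simply_connected)
      moreover have "g holomorphic_on ball 0 R" using pg(2) holomorphic_on_subset by blast
      moreover have "\<forall>w\<in>ball 0 R. g w \<noteq> 0" using pg(6) by auto
      ultimately show ?thesis
        using simply_connected_eq_holomorphic_log[OF open_ball, of 0 R] by metis
    qed
    then obtain lg where lg: "lg holomorphic_on ball 0 R" "\<And>w. norm w < R \<Longrightarrow> g w = exp (lg w)"
      by auto
    have lg0: "Re (lg 0) = l"
    proof -
      have "F2 0 = exp (lg 0)" using pg(3,4) lg(2)[of 0] R by simp
      then show ?thesis by (simp add: l_def)
    qed
    have lg_lower: "Re (lg w) \<ge> l - 2 * (a2 + 1 - l)" if "norm w \<le> R / 2" for w
    proof -
      have "Re (lg w) < a2 + 1" if "norm w < R" for w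
        using g_le[of w] lg(2)[OF that] that R by simp
      then have "norm (lg w - lg 0) \<le> 2 * (a2 + 1 - Re (lg 0))"
        by (intro Borel_Caratheodory_half[OF lg(1) R(1) _ that])
      then show ?thesis using abs_Re_le_cmod[of "lg w - lg 0"] by (simp add: lg0 abs_le_iff)
    qed
    have "Re (h w) < D R + 1" if "norm w < R / 2" for w
    proof -
      have "norm (exp (lg w + h w)) \<le> exp a1"
        using gh_le[of w] lg(2)[of w] that R by (simp add: exp_add)
      then have "Re (lg w) + Re (h w) \<le> a1" by simp
      then show ?thesis using lg_lower[of w] that by (simp add: D_def a1_def a2_def)
    qed
    moreover have "h holomorphic_on ball 0 (R / 2)" using h holomorphic_on_subset by blast
    ultimately have "norm (h z - h 0) \<le> 2 * (D R + 1 - Re (h 0))"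
      by (intro Borel_Caratheodory_half[of h "R/2"]) (use R in auto)
    then show ?thesis by (simp add: R_def)
  qed
  define N where "N = max N1 N2"
  \<comment> \<open>The functions are bounded on circles of radius \<open>2 * R = 8 * x\<close> with
    \<open>x = 1 + norm z\<close>, and \<open>1 + 8 * x \<le> 9 * x\<close>: hence the powers of
    9.\<close>
  define C where "C = norm (h 0) + 2 * (C1 * 9 ^ N + \<bar>l\<bar> + 2 * (C2 * 9 ^ N + 1 + \<bar>l\<bar>) + 1 + \<bar>Re (h 0)\<bar>)"
  have "norm (h z) \<le> C * (1 + norm z) ^ N" for z
  proof -
    define x where "x = 1 + norm z"
    have x: "x \<ge> 1" by (simp add: x_def)
    have pw: "(1 + 2 * (4 * x)) ^ M \<le> 9 ^ N * x ^ N" if "M \<le> N" for M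
    proof -
      have "(1 + 2 * (4 * x)) ^ M \<le> (9 * x) ^ M" using x by (intro power_mono) auto
      also have "\<dots> \<le> (9 * x) ^ N" using x that by (intro power_increasing) auto
      finally show ?thesis by (simp add: power_mult_distrib)
    qed
    have xN: "1 \<le> x ^ N" using x by simp
    have sc: "c \<le> c * x ^ N" if "c \<ge> 0" for c using mult_left_mono[OF xN that] by simp
    have "D (4 * x) \<le> C1 * (9 ^ N * x ^ N) + \<bar>l\<bar> + 2 * (C2 * (9 ^ N * x ^ N) + 1 + \<bar>l\<bar>)"
      unfolding D_def using mult_left_mono[OF pw[of N1] b1(1)] mult_left_mono[OF pw[of N2] b2(1)]
      by (simp add: N_def)
    then have "norm (h z) \<le> norm (h 0) + 2 * (C1 * (9 ^ N * x ^ N) + \<bar>l\<bar> + 2 * (C2 * (9 ^ N * x ^ N) + 1 + \<bar>l\<bar>) + 1 + \<bar>Re (h 0)\<bar>)"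
      using main[of z] norm_triangle_sub[of "h z" "h 0"] by (simp add: x_def)
    also have "\<dots> \<le> C * x ^ N"
      using sc[of "norm (h 0)"] sc[of "\<bar>l\<bar>"] sc[of 1] sc[of "\<bar>Re (h 0)\<bar>"]
      by (simp add: C_def algebra_simps)
    finally show ?thesis by (simp add: x_def)
  qed
  then show ?thesis using that by blast
qed

section \<open>Calculus of growth bounds\<close>

lemma exp_poly_bounded_mono:
  fixes s :: complex
  assumes "0 \<le> C" "C \<le> C'" "N \<le> N'"
  shows "C * (1 + norm s) ^ N \<le> C' * (1 + norm s) ^ N'"
  using assms by (intro mult_mono power_increasing) auto

lemma exp_poly_boundedE:
  assumes "exp_poly_bounded f" "exp_poly_bounded g"
  obtains C N where "C \<ge> 0" "\<And>s. norm (f s) \<le> exp (C * (1 + norm s) ^ N)"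
    "\<And>s. norm (g s) \<le> exp (C * (1 + norm s) ^ N)"
proof -
  obtain C1 N1 where 1: "C1 \<ge> 0" "\<And>s. norm (f s) \<le> exp (C1 * (1 + norm s) ^ N1)"
    using assms(1) unfolding exp_poly_bounded_def by blast
  obtain C2 N2 where 2: "C2 \<ge> 0" "\<And>s. norm (g s) \<le> exp (C2 * (1 + norm s) ^ N2)"
    using assms(2) unfolding exp_poly_bounded_def by blast
  show ?thesis
  proof (rule that[of "max C1 C2" "max N1 N2"])
    fix s
    show "norm (f s) \<le> exp (max C1 C2 * (1 + norm s) ^ max N1 N2)"
      by (rule order_trans[OF 1(2)]) (use 1(1) in \<open>auto intro: exp_poly_bounded_mono\<close>)
    show "norm (g s) \<le> exp (max C1 C2 * (1 + norm s) ^ max N1 N2)"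
      by (rule order_trans[OF 2(2)]) (use 2(1) in \<open>auto intro: exp_poly_bounded_mono\<close>)
  qed (use 1 in auto)
qed

lemma exp_poly_bounded_mult:
  assumes "exp_poly_bounded f" "exp_poly_bounded g"
  shows "exp_poly_bounded (\<lambda>s. f s * g s)"
proof -
  obtain C N where CN: "C \<ge> 0" "\<And>s. norm (f s) \<le> exp (C * (1 + norm s) ^ N)"
    "\<And>s. norm (g s) \<le> exp (C * (1 + norm s) ^ N)"
    using exp_poly_boundedE[OF assms] by blast
  have "norm (f s * g s) \<le> exp ((2 * C) * (1 + norm s) ^ N)" for s
    using mult_mono[OF CN(2)[of s] CN(3)[of s]]
    by (simp add: norm_mult exp_add[symmetric] mult.assoc)
  then show ?thesis unfolding exp_poly_bounded_def using CN(1)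
    by (intro exI[of _ "2 * C"] exI[of _ N]) auto
qed

lemma exp_poly_bounded_diff:
  assumes "exp_poly_bounded f" "exp_poly_bounded g"
  shows "exp_poly_bounded (\<lambda>s. f s - g s)"
proof -
  obtain C N where CN: "C \<ge> 0" "\<And>s. norm (f s) \<le> exp (C * (1 + norm s) ^ N)"
    "\<And>s. norm (g s) \<le> exp (C * (1 + norm s) ^ N)"
    using exp_poly_boundedE[OF assms] by blast
  have "norm (f s - g s) \<le> exp ((C + 1) * (1 + norm s) ^ N)" for s
  proof -
    have "norm (f s - g s) \<le> 2 * exp (C * (1 + norm s) ^ N)"
      using norm_triangle_ineq4[of "f s" "g s"] CN(2)[of s] CN(3)[of s] by linarith
    also have "2 \<le> exp (1::real)" using exp_ge_add_one_self[of "1::real"] by simp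
    also have "\<dots> \<le> exp ((1 + norm s) ^ N)" by simp
    finally show ?thesis by (simp add: algebra_simps exp_add)
  qed
  then show ?thesis unfolding exp_poly_bounded_def using CN(1)
    by (intro exI[of _ "C + 1"] exI[of _ N]) auto
qed

lemma exp_poly_bounded_const: "exp_poly_bounded (\<lambda>_. c)"
proof -
  have "norm c \<le> exp (norm c)" using exp_ge_add_one_self[of "norm c"] by linarith
  then show ?thesis unfolding exp_poly_bounded_def
    by (intro exI[of _ "norm c"] exI[of _ 0]) auto
qed

lemma exp_poly_bounded_ident: "exp_poly_bounded (\<lambda>s. s)"
proof -
  have "norm s \<le> exp (1 * (1 + norm s) ^ 1)" for s :: complex
    using exp_ge_add_one_self[of "1 + norm s"] by simp
  then show ?thesis unfolding exp_poly_bounded_def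
    by (intro exI[of _ 1] exI[of _ 1]) auto
qed

lemma exp_poly_bounded_power: "exp_poly_bounded f \<Longrightarrow> exp_poly_bounded (\<lambda>s. f s ^ n)"
  by (induction n) (simp_all add: exp_poly_bounded_const exp_poly_bounded_mult)

lemma exp_poly_bounded_prod:
  "(\<And>x. x \<in> I \<Longrightarrow> exp_poly_bounded (f x)) \<Longrightarrow> exp_poly_bounded (\<lambda>s. \<Prod>x\<in>I. f x s)"
  by (induction I rule: infinite_finite_induct)
     (simp_all add: exp_poly_bounded_const exp_poly_bounded_mult)

lemma exp_poly_bounded_translate:
  assumes "exp_poly_bounded f"
  shows "exp_poly_bounded (\<lambda>s. f (s + b))"
proof -
  obtain C N where CN: "C \<ge> 0" "\<And>s. norm (f s) \<le> exp (C * (1 + norm s) ^ N)"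
    using assms unfolding exp_poly_bounded_def by blast
  have "norm (f (s + b)) \<le> exp ((C * (1 + norm b) ^ N) * (1 + norm s) ^ N)" for s
  proof -
    have "0 \<le> norm b * norm s" by simp
    then have "1 + norm (s + b) \<le> (1 + norm b) * (1 + norm s)"
      using norm_triangle_ineq[of s b] unfolding distrib_left distrib_right mult_1_left mult_1_right
      by linarith
    then have "(1 + norm (s + b)) ^ N \<le> (1 + norm b) ^ N * (1 + norm s) ^ N"
      by (subst power_mult_distrib[symmetric], intro power_mono) auto
    then have "C * (1 + norm (s + b)) ^ N \<le> (C * (1 + norm b) ^ N) * (1 + norm s) ^ N"
      using CN(1) by (simp add: mult_left_mono mult.assoc)
    then show ?thesis using CN(2)[of "s + b"] by (meson exp_le_cancel_iff order_trans)
  qed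
  then show ?thesis unfolding exp_poly_bounded_def using CN(1)
    by (intro exI[of _ "C * (1 + norm b) ^ N"] exI[of _ N]) auto
qed

lemma finite_order_imp_exp_poly_bounded:
  assumes "finite_order g" and hol: "g holomorphic_on UNIV"
  shows "exp_poly_bounded g"
proof -
  obtain \<rho> b0 where b0: "\<And>s. norm s \<ge> b0 \<Longrightarrow> norm (g s) \<le> exp (norm s powr \<rho>)"
    using assms(1) unfolding finite_order_def eventually_at_infinity by blast
  define b where "b = max b0 1"
  define N where "N = nat \<lceil>\<rho>\<rceil>"
  have "compact (g ` cball 0 b)"
    using hol by (intro compact_continuous_image holomorphic_on_imp_continuous_on)
      (auto intro: holomorphic_on_subset)
  then obtain B where B: "\<And>s. norm s \<le> b \<Longrightarrow> norm (g s) \<le> B"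
    by (force dest: compact_imp_bounded simp: bounded_iff)
  define C where "C = 1 + \<bar>B\<bar>"
  have "norm (g s) \<le> exp (C * (1 + norm s) ^ N)" for s
  proof (cases "norm s \<ge> b")
    case True
    have "norm s powr \<rho> \<le> norm s powr N" using True of_nat_ceiling[of \<rho>]
      by (intro powr_mono) (auto simp: N_def b_def)
    also have "\<dots> \<le> (1 + norm s) powr N" by (intro powr_mono2) auto
    also have "\<dots> = (1 + norm s) ^ N" by (subst powr_realpow) (auto simp: add_pos_nonneg)
    also have "\<dots> \<le> C * (1 + norm s) ^ N" 
      using mult_right_mono[of 1 C "(1 + norm s) ^ N"] by (simp add: C_def)
    finally show ?thesis using b0[of s] True unfolding b_def by (meson max.boundedE exp_le_cancel_iff order_trans)
  next
    case False
    have "norm (g s) \<le> \<bar>B\<bar>" using B[of s] False by linarith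
    also have "\<dots> \<le> exp C" using exp_ge_add_one_self[of C] by (simp add: C_def)
    also have "\<dots> \<le> exp (C * (1 + norm s) ^ N)" 
      using mult_left_mono[OF one_le_power[of "1 + norm s" N], of C] by (simp add: C_def)
    finally show ?thesis .
  qed
  then show ?thesis unfolding exp_poly_bounded_def by (intro exI[of _ C] exI[of _ N]) (auto simp: C_def)
qed

subsection \<open>Dirichlet series in the right half plane\<close>

lemma norm_of_nat_powr:
  assumes "n \<ge> 1"
  shows "norm (of_nat n powr s :: complex) = real n powr Re s"
proof -
  have "norm (of_nat n powr s :: complex) = exp (Re s * ln (Re (of_nat n)))"
    using assms by (intro norm_powr_real) auto
  then show ?thesis using assms by (simp add: powr_def)
qed

lemma has_sum_diff:
  fixes f g :: "'a \<Rightarrow> complex"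
  assumes "(f has_sum a) A" "(g has_sum b) A"
  shows "((\<lambda>x. f x - g x) has_sum (a - b)) A"
  using has_sum_add[OF assms(1) has_sum_uminusI[OF assms(2)]] by simp

lemma tendsto_powr_base_less_1:
  fixes x :: real
  assumes "0 < x" "x < 1"
  shows "((\<lambda>y. x powr y) \<longlongrightarrow> 0) at_top"
proof -
  have "filterlim (\<lambda>y. ln x * y) at_bot at_top"
    using assms by (intro filterlim_tendsto_neg_mult_at_bot[OF tendsto_const] filterlim_ident) auto
  from filterlim_compose[OF exp_at_bot this] show ?thesis
    using assms by (simp add: powr_def mult.commute)
qed

text \<open>For \<open>n > m\<close> the quotient \<open>(m / n) powr Re s\<close> splits into
  \<open>(m / n) powr 2\<close>, which absolute convergence at \<open>s = 2\<close> makes summable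
  against \<open>a n\<close>, and a power with exponent \<open>Re s - 2\<close>, which is largest
  for \<open>n = m + 1\<close>. So the ratio of the first two possible terms governs the error,
  uniformly in \<open>Im s\<close>.\<close>

lemma dirichlet_series_leading_term:
  assumes D: "has_dirichlet_series D a" and m: "m \<ge> 1" and a0: "\<And>n. 1 \<le> n \<Longrightarrow> n < m \<Longrightarrow> a n = 0"
  obtains M where
    "\<And>s. Re s \<ge> 2 \<Longrightarrow> norm (D s * of_nat m powr s - a m) \<le> M * (real m / (real m + 1)) powr Re s"
proof -
  define \<theta> where "\<theta> = real m / (real m + 1)"
  have \<theta>: "\<theta> > 0" "\<theta> < 1" using m by (auto simp: \<theta>_def field_simps)
  define g where "g n = norm (a n) * real n powr (-2)" for n
  have "g summable_on {1..}"
  proof -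
    have "(\<lambda>n. norm (a n * of_nat n powr (-2))) summable_on {1..}"
      using D[unfolded has_dirichlet_series_def, rule_format, of 2] by simp
    then show ?thesis
      by (rule summable_on_cong[THEN iffD1, rotated]) (simp add: g_def norm_mult norm_of_nat_powr)
  qed
  then have g: "(g has_sum infsum g {1..}) {1..}" by simp
  define M where "M = real m powr 2 * \<theta> powr (-2) * infsum g {1..}"
  have "norm (D s * of_nat m powr s - a m) \<le> M * \<theta> powr Re s" if s: "Re s \<ge> 2" for s
  proof -
    define f where "f n = a n * of_nat n powr (-s) * of_nat m powr s" for n
    have "(f has_sum (D s * of_nat m powr s)) {1..}"
      unfolding f_def using D[unfolded has_dirichlet_series_def, rule_format, of s] s
      by (intro has_sum_cmult_left) auto
    moreover have "((\<lambda>n. if n = m then a m else 0) has_sum a m) {1..}"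
      by (rule has_sum_finite_neutralI[of "{m}"]) (use m in auto)
    ultimately have "((\<lambda>n. f n - (if n = m then a m else 0)) has_sum (D s * of_nat m powr s - a m)) {1..}"
      by (rule has_sum_diff)
    moreover have "((\<lambda>n. real m powr 2 * \<theta> powr (Re s - 2) * g n) has_sum
        (real m powr 2 * \<theta> powr (Re s - 2) * infsum g {1..})) {1..}"
      by (intro has_sum_cmult_right g)
    moreover have "norm (f n - (if n = m then a m else 0)) \<le> real m powr 2 * \<theta> powr (Re s - 2) * g n"
      if n: "n \<in> {1..}" for n
    proof -
      consider "n < m" | "n = m" | "n > m" by linarith
      then show ?thesis
      proof cases
        case 1
        then show ?thesis using a0[of n] n by (simp add: f_def g_def)
      next
        case 2
        have "of_nat m powr s \<noteq> (0 :: complex)" using m by auto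
        then have "f n = a m" using 2 by (simp add: f_def powr_minus)
        then show ?thesis using 2 by (simp add: g_def)
      next
        case 3
        have nm: "real m / real n \<le> \<theta>" 
        proof -
          have "real m * (real m + 1) \<le> real m * real n" using 3 by (intro mult_left_mono) auto
          then show ?thesis using 3 m by (simp add: \<theta>_def field_simps)
        qed
        have "norm (f n) = norm (a n) * (real n powr (- Re s) * real m powr Re s)"
          using n m by (simp add: f_def norm_mult norm_of_nat_powr)
        also have "real n powr (- Re s) * real m powr Re s = (real m / real n) powr Re s"
          using n m by (simp add: powr_divide powr_minus field_simps)
        also have "\<dots> = (real m / real n) powr 2 * (real m / real n) powr (Re s - 2)"
          by (subst powr_add [symmetric]) simp
        also have "\<dots> \<le> (real m / real n) powr 2 * \<theta> powr (Re s - 2)"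
          using nm s by (intro mult_left_mono powr_mono2) auto
        also have "(real m / real n) powr 2 = real m powr 2 * real n powr (-2)"
          using n m by (simp add: powr_divide powr_minus field_simps del: powr_numeral)
        finally have "norm (f n) \<le> norm (a n) * (real m powr 2 * real n powr (-2) * \<theta> powr (Re s - 2))"
          by (simp add: mult_left_mono)
        then show ?thesis using 3 by (simp add: g_def mult_ac)
      qed
    qed
    ultimately have "norm (D s * of_nat m powr s - a m) \<le> real m powr 2 * \<theta> powr (Re s - 2) * infsum g {1..}"
      by (rule norm_infsum_le)
    also have "\<theta> powr (Re s - 2) = \<theta> powr (-2) * \<theta> powr Re s"
      by (subst powr_add [symmetric]) simp
    also have "real m powr 2 * (\<theta> powr (-2) * \<theta> powr Re s) * infsum g {1..} = M * \<theta> powr Re s"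
      by (simp only: M_def mult_ac)
    finally show ?thesis .
  qed
  then show ?thesis using that unfolding \<theta>_def by blast
qed

lemma dirichlet_series_zero:
  assumes "has_dirichlet_series D a" "\<And>n. n \<ge> 1 \<Longrightarrow> a n = 0" "Re s > 1"
  shows "D s = 0"
proof -
  have "((\<lambda>n. a n * of_nat n powr (-s)) has_sum D s) {1..}"
    using assms by (simp add: has_dirichlet_series_def)
  moreover have "((\<lambda>n. a n * of_nat n powr (-s)) has_sum 0) {1..}"
    by (rule has_sum_0) (use assms in auto)
  ultimately show ?thesis by (rule has_sum_unique)
qed

lemma dirichlet_series_diff:
  assumes "has_dirichlet_series D a" "has_dirichlet_series E b"
  shows "has_dirichlet_series (\<lambda>s. D s - E s) (\<lambda>n. a n - b n)"
  unfolding has_dirichlet_series_def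
proof (intro allI impI conjI)
  fix s :: complex assume s: "Re s > 1"
  note D = assms(1)[unfolded has_dirichlet_series_def, rule_format, OF s]
  note E = assms(2)[unfolded has_dirichlet_series_def, rule_format, OF s]
  have eq: "(a n - b n) * of_nat n powr (-s) = a n * of_nat n powr (-s) - b n * of_nat n powr (-s)" for n
    by (simp add: algebra_simps)
  show "((\<lambda>n. (a n - b n) * of_nat n powr (-s)) has_sum (D s - E s)) {1..}"
    unfolding eq using D E by (intro has_sum_diff) auto
  show "(\<lambda>n. norm ((a n - b n) * of_nat n powr (-s))) summable_on {1..}"
  proof (rule summable_on_comparison_test)
    show "(\<lambda>n. norm (a n * of_nat n powr (-s)) + norm (b n * of_nat n powr (-s))) summable_on {1..}"
      using D E by (intro summable_on_add) auto
  qed (auto simp: eq norm_triangle_ineq4)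
qed

lemma dirichlet_series_const: "has_dirichlet_series (\<lambda>_. c) (\<lambda>n. if n = 1 then c else 0)"
proof -
  have *: "((\<lambda>n::nat. (if n = 1 then c else 0) * of_nat n powr (-s)) has_sum c) {1..}" for s
    by (rule has_sum_finite_neutralI[of "{1}"]) auto
  have "((\<lambda>n::nat. norm ((if n = 1 then c else 0) * of_nat n powr (-s))) has_sum norm c) {1..}" for s
    by (rule has_sum_finite_neutralI[of "{1}"]) auto
  with * show ?thesis unfolding has_dirichlet_series_def summable_on_def by blast
qed

lemma dirichlet_series_limit:
  assumes "has_dirichlet_series D a" "m \<ge> 1" "\<And>n. 1 \<le> n \<Longrightarrow> n < m \<Longrightarrow> a n = 0"
  shows "((\<lambda>s. D s * of_nat m powr s) \<longlongrightarrow> a m) (filtercomap Re at_top)"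
proof -
  obtain M where M: "\<And>s. Re s \<ge> 2 \<Longrightarrow> norm (D s * of_nat m powr s - a m) \<le> M * (real m / (real m + 1)) powr Re s"
    using dirichlet_series_leading_term[OF assms] by blast
  have "((\<lambda>x. M * (real m / (real m + 1)) powr x) \<longlongrightarrow> M * 0) at_top"
    using assms(2) by (intro tendsto_intros tendsto_powr_base_less_1) auto
  then have "((\<lambda>x. M * (real m / (real m + 1)) powr x) \<longlongrightarrow> 0) at_top" by simp
  then have lim: "((\<lambda>s. M * (real m / (real m + 1)) powr Re s) \<longlongrightarrow> 0) (filtercomap Re at_top)"
    by (rule filterlim_compose[OF _ filterlim_filtercomap])
  have "eventually (\<lambda>s. Re s \<ge> 2) (filtercomap Re at_top)"
    by (auto simp: eventually_filtercomap intro!: exI[of _ "\<lambda>x. x \<ge> 2"] eventually_ge_at_top)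
  then have "eventually (\<lambda>s. norm (D s * of_nat m powr s - a m) \<le> M * (real m / (real m + 1)) powr Re s)
      (filtercomap Re at_top)"
    by eventually_elim (rule M)
  then have "((\<lambda>s. D s * of_nat m powr s - a m) \<longlongrightarrow> 0) (filtercomap Re at_top)"
    by (rule Lim_null_comparison[OF _ lim])
  then show ?thesis by (simp add: LIM_zero_iff)
qed

text \<open>There is no restriction on \<open>Im s\<close>: limits hold uniformly in the vertical
  direction, so they can be used on discs around real points for Cauchy's inequality and along
  slanted rays.\<close>

abbreviation right_end :: "complex filter" where "right_end \<equiv> filtercomap Re at_top"

lemma eventually_right_end: "eventually P right_end \<longleftrightarrow> (\<exists>x0. \<forall>s. Re s \<ge> x0 \<longrightarrow> P s)"
  by (simp add: eventually_filtercomap_at_top_linorder)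

lemma filterlim_of_real_right_end: "filterlim complex_of_real right_end at_top"
  by (simp add: filterlim_filtercomap_iff o_def filterlim_ident)

lemma poly_of_real_tendsto_imp_degree_0:
  fixes p :: "complex poly"
  assumes "((\<lambda>x. poly p (of_real x)) \<longlongrightarrow> c) at_top"
  shows "degree p = 0"
proof (rule ccontr)
  assume "degree p \<noteq> 0"
  then have "filterlim (poly p) at_infinity at_infinity"
    by (intro filterlim_poly_at_infinity) auto
  moreover have "filterlim complex_of_real at_infinity at_top"
    unfolding filterlim_at_infinity_conv_norm_at_top norm_of_real
    by (rule filterlim_abs_real)
  ultimately have "filterlim (\<lambda>x. poly p (of_real x)) at_infinity at_top"
    by (rule filterlim_compose)
  from not_tendsto_and_filterlim_at_infinity[OF _ assms this] show False by simp
qed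

lemma polynomial_growth_imp_poly:
  assumes "H holomorphic_on UNIV" "\<And>z. norm (H z) \<le> C * (1 + norm z) ^ N"
  obtains p where "H = poly p"
proof -
  have "norm (H z) \<le> (C * 2 ^ N) * norm z ^ N" if "1 \<le> norm z" for z
  proof -
    have C: "C \<ge> 0" using order_trans[OF norm_ge_zero assms(2)[of 0]] by simp
    have "(1 + norm z) ^ N \<le> (2 * norm z) ^ N" using that by (intro power_mono) auto
    then have "C * (1 + norm z) ^ N \<le> C * (2 ^ N * norm z ^ N)"
      using C by (intro mult_left_mono) (auto simp: power_mult_distrib)
    then show ?thesis using assms(2)[of z] by (simp add: mult.assoc)
  qed
  from Liouville_polynomial[OF assms(1) this]
  have "H z = poly (\<Sum>k\<le>N. monom ((deriv ^^ k) H 0 / fact k) k) z" for z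
    by (simp add: poly_sum poly_monom)
  then show ?thesis using that by blast
qed

text \<open>
  The logarithmic derivative of the expression is \<open>H' + B / (s - 1) - A / (s - 1)\<close>; by Cauchy's
  inequality it tends to 0, which forces the polynomial \<open>H'\<close> to vanish.
\<close>

lemma exp_polynomial_limit_imp_constant:
  assumes H: "H holomorphic_on UNIV" "\<And>z. norm (H z) \<le> C * (1 + norm z) ^ N"
    and lim: "((\<lambda>s. (s - 1) ^ B * exp (H s) / (s - 1) ^ A) \<longlongrightarrow> c) right_end" and c: "c \<noteq> 0"
  shows "A = B \<and> (\<exists>K. \<forall>s. H s = K)"
proof -
  obtain p where p: "H = poly p" using polynomial_growth_imp_poly[OF H] by blast
  define Z where "Z = (\<lambda>s. (s - 1) ^ B * exp (H s) / (s - 1) ^ A)"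
  define Z' where "Z' = (\<lambda>s. Z s * (of_nat B / (s - 1) + poly (pderiv p) s - of_nat A / (s - 1)))"
  have derZ: "(Z has_field_derivative Z' s) (at s)" if "s \<noteq> 1" for s
  proof -
    have pw: "of_nat n * (s - 1) ^ (n - 1) = (s - 1) ^ n * (of_nat n / (s - 1))" for n
      using that by (cases n) auto
    have "(Z has_field_derivative
      ((of_nat B * (s - 1) ^ (B - 1) * exp (H s) + (s - 1) ^ B * (exp (H s) * poly (pderiv p) s)) * (s - 1) ^ A
        - (s - 1) ^ B * exp (H s) * (of_nat A * (s - 1) ^ (A - 1))) / ((s - 1) ^ A * (s - 1) ^ A)) (at s)"
      unfolding Z_def p using that by (auto intro!: derivative_eq_intros simp: field_simps)
    also have "((of_nat B * (s - 1) ^ (B - 1) * exp (H s) + (s - 1) ^ B * (exp (H s) * poly (pderiv p) s)) * (s - 1) ^ A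
        - (s - 1) ^ B * exp (H s) * (of_nat A * (s - 1) ^ (A - 1))) / ((s - 1) ^ A * (s - 1) ^ A) = Z' s"
    proof -
      have nz: "(s - 1) ^ A \<noteq> 0" using that by simp
      define u v E where "u = (s - 1) ^ A" and "v = (s - 1) ^ B" and "E = exp (H s)"
      have "u \<noteq> 0" using nz by (simp add: u_def)
      then show ?thesis unfolding Z'_def Z_def pw unfolding u_def[symmetric] v_def[symmetric] E_def[symmetric]
        by (simp add: divide_simps) (simp add: algebra_simps)
    qed
    finally show ?thesis .
  qed
  have lim': "(Z \<longlongrightarrow> c) right_end" using lim by (simp add: Z_def)
  have limZ: "((\<lambda>x. Z (of_real x)) \<longlongrightarrow> c) at_top"
    by (rule filterlim_compose[OF lim' filterlim_of_real_right_end])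
  have limZ': "((\<lambda>x. Z' (of_real x)) \<longlongrightarrow> 0) at_top"
  proof (rule tendstoI)
    fix e :: real assume e: "e > 0"
    obtain x0 where x0: "\<And>s. Re s \<ge> x0 \<Longrightarrow> dist (Z s) c < e / 2"
      using tendstoD[OF lim', of "e / 2"] e unfolding eventually_right_end by auto
    have "dist (Z' (of_real x)) 0 < e" if x: "x \<ge> max x0 2 + 1" for x
    proof -
      have Re: "Re s \<ge> max x0 2" if "s \<in> cball (complex_of_real x) 1" for s
        using that x abs_Re_le_cmod[of "of_real x - s"] by (auto simp: dist_norm abs_le_iff)
      have ne: "s \<noteq> 1" if "s \<in> cball (complex_of_real x) 1" for s using Re[OF that] by auto
      have "Z holomorphic_on cball (of_real x) 1"
        using derZ ne unfolding holomorphic_on_def field_differentiable_def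
        by (meson has_field_derivative_at_within)
      then have "norm ((deriv ^^ 1) Z (of_real x)) \<le> fact 1 * (e / 2) / 1 ^ 1"
      proof (intro Cauchy_higher_deriv_bound)
        show "Z w \<in> ball c (e / 2)" if "w \<in> ball (of_real x) 1" for w
          using x0[of w] Re[of w] that by (auto simp: dist_commute)
      qed (auto intro: holomorphic_on_imp_continuous_on holomorphic_on_subset)
      moreover have "deriv Z (of_real x) = Z' (of_real x)"
        using derZ[of "of_real x"] ne[of "of_real x"] by (simp add: DERIV_imp_deriv)
      ultimately show ?thesis using e by simp
    qed
    then show "\<forall>\<^sub>F x in at_top. dist (Z' (of_real x)) 0 < e"
      unfolding eventually_at_top_linorder by blast
  qed
  have sub1: "filterlim (\<lambda>x::real. x - 1) at_top at_top" by real_asymp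
  have inv: "((\<lambda>x. a / (complex_of_real x - 1)) \<longlongrightarrow> 0) at_top" for a
  proof -
    have "filterlim (\<lambda>x. complex_of_real x - 1) at_infinity at_top"
      using filterlim_compose[OF filterlim_of_real_at_infinity sub1] by simp
    then show ?thesis by (intro tendsto_divide_0[OF tendsto_const])
  qed
  have "((\<lambda>x. Z' (of_real x) / Z (of_real x) - of_nat B / (of_real x - 1) + of_nat A / (of_real x - 1))
      \<longlongrightarrow> 0 / c - 0 + 0) at_top"
    by (intro tendsto_intros limZ limZ' inv c)
  moreover have "eventually (\<lambda>x. Z' (of_real x) / Z (of_real x) - of_nat B / (of_real x - 1)
      + of_nat A / (of_real x - 1) = poly (pderiv p) (of_real x)) at_top"
    using tendsto_imp_eventually_ne[OF limZ c] by eventually_elim (simp add: Z'_def)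
  ultimately have "((\<lambda>x. poly (pderiv p) (of_real x)) \<longlongrightarrow> 0 / c - 0 + 0) at_top"
    by (rule Lim_transform_eventually)
  then have lim_pd: "((\<lambda>x. poly (pderiv p) (of_real x)) \<longlongrightarrow> 0) at_top" by simp
  then have "degree (pderiv p) = 0" by (rule poly_of_real_tendsto_imp_degree_0)
  then obtain d where d: "pderiv p = [:d:]" by (metis degree_eq_zeroE)
  then have "d = 0" using lim_pd by (simp add: tendsto_const_iff)
  then have "pderiv p = 0" using d by simp
  then obtain K where "p = [:K:]" by (metis degree_eq_zeroE pderiv_eq_0_iff)
  then have K: "H s = K" for s by (simp add: p)
  \<comment> \<open>With \<open>H\<close> constant only a power of \<open>x - 1\<close> with
    exponent \<open>B - A\<close> is left, and it has a finite non-zero limit only for exponent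
    0.\<close>
  have "A = B"
  proof (rule ccontr)
    assume "A \<noteq> B"
    have limn: "((\<lambda>x. norm (complex_of_real x - 1) ^ B * norm (exp K) / norm (complex_of_real x - 1) ^ A) \<longlongrightarrow> norm c) at_top"
      using tendsto_norm[OF limZ] by (simp add: Z_def K norm_mult norm_divide norm_power)
    have "eventually (\<lambda>x. norm (complex_of_real x - 1) = x - 1) at_top"
      using eventually_ge_at_top[of 1] by eventually_elim (metis abs_of_nonneg diff_ge_0_iff_ge norm_of_real of_real_1 of_real_diff)
    then have limx: "((\<lambda>x. (x - 1) ^ B * norm (exp K) / (x - 1) ^ A) \<longlongrightarrow> norm c) at_top"
      by (rule Lim_transform_eventually[OF limn, OF eventually_mono]) simp
    have inv0: "((\<lambda>x::real. (1 / (x - 1)) ^ n) \<longlongrightarrow> 0) at_top" if "n > 0" for n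
    proof -
      have "((\<lambda>x::real. 1 / (x - 1)) \<longlongrightarrow> 0) at_top" by real_asymp
      then show ?thesis using that by (rule tendsto_null_power)
    qed
    consider "B < A" | "A < B" using \<open>A \<noteq> B\<close> by linarith
    then show False
    proof cases
      case 1
      have "((\<lambda>x. norm (exp K) * (1 / (x - 1)) ^ (A - B)) \<longlongrightarrow> norm (exp K) * 0) at_top"
        using inv0[of "A - B"] 1 by (intro tendsto_intros) auto
      moreover have "eventually (\<lambda>x. norm (exp K) * (1 / (x - 1)) ^ (A - B) =
          (x - 1) ^ B * norm (exp K) / (x - 1) ^ A) at_top"
        using eventually_gt_at_top[of 1]
      proof eventually_elim
        case (elim x)
        have "(x - 1) ^ A = (x - 1) ^ (A - B) * (x - 1) ^ B" using 1 by (simp flip: power_add)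
        then show ?case using elim by (simp add: power_divide)
      qed
      ultimately have "((\<lambda>x. (x - 1) ^ B * norm (exp K) / (x - 1) ^ A) \<longlongrightarrow> norm (exp K) * 0) at_top"
        by (rule Lim_transform_eventually)
      from tendsto_unique[OF _ limx this] show False using c by simp
    next
      case 2
      have "((\<lambda>x. ((x - 1) ^ B * norm (exp K) / (x - 1) ^ A) * (1 / (x - 1)) ^ (B - A))
          \<longlongrightarrow> norm c * 0) at_top"
        using inv0[of "B - A"] 2 by (intro tendsto_intros limx) auto
      moreover have "eventually (\<lambda>x. ((x - 1) ^ B * norm (exp K) / (x - 1) ^ A) * (1 / (x - 1)) ^ (B - A)
          = norm (exp K)) at_top"
        using eventually_gt_at_top[of 1]
      proof eventually_elim
        case (elim x)
        have "(x - 1) ^ B = (x - 1) ^ (B - A) * (x - 1) ^ A" using 2 by (simp flip: power_add)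
        then show ?case using elim by (simp add: power_divide)
      qed
      ultimately have "((\<lambda>_. norm (exp K)) \<longlongrightarrow> norm c * 0) (at_top :: real filter)"
        by (rule Lim_transform_eventually)
      then show False by (simp add: tendsto_const_iff)
    qed
  qed
  with K show ?thesis by blast
qed

subsection \<open>Functions in the Selberg class sharing a set\<close>

lemma selberg_class_entireE:
  assumes "L \<in> extended_selberg_class"
  obtains k g where "g holomorphic_on UNIV" "exp_poly_bounded g" "\<And>s. s \<noteq> 1 \<Longrightarrow> g s = (s - 1) ^ k * L s"
  using assms finite_order_imp_exp_poly_bounded unfolding extended_selberg_class_def by blast

lemma selberg_class_holomorphic:
  assumes "L \<in> extended_selberg_class"
  shows "L holomorphic_on -{1}"
proof -
  obtain k g where g: "g holomorphic_on UNIV" "\<And>s. s \<noteq> 1 \<Longrightarrow> g s = (s - 1) ^ k * L s"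
    using selberg_class_entireE[OF assms] by metis
  have "(\<lambda>s. g s / (s - 1) ^ k) holomorphic_on -{1}"
    by (intro holomorphic_intros holomorphic_on_subset[OF g(1)]) auto
  then show ?thesis by (rule holomorphic_transform) (auto simp: g(2))
qed

text \<open>If only the first coefficient survived, \<open>L\<close> would be constant on the half
  plane of convergence, and the identity theorem would spread this to the whole plane.\<close>

lemma selberg_class_nonconstant_coeff:
  assumes L: "L \<in> extended_selberg_class" "\<not> L constant_on UNIV" "has_dirichlet_series L a"
  obtains n where "n \<ge> 2" "a n \<noteq> 0"
proof (rule ccontr)
  assume "\<not> thesis"
  with that have a: "a n = 0" if "n \<ge> 2" for n using that by blast
  have "L s - a 1 = 0" if "Re s > 1" for s
  proof (rule dirichlet_series_zero[OF dirichlet_series_diff[OF L(3) dirichlet_series_const[of "a 1"]] _ that])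
    fix n :: nat assume "n \<ge> 1"
    then show "a n - (if n = 1 then a 1 else 0) = 0" using a[of n] by (cases "n = 1") auto
  qed
  then have "L constant_on {s. Re s > 1}" by (auto simp: constant_on_def)
  then have "L constant_on UNIV"
  proof (rule constant_on_extend_nicely_meromorphic_on[rotated])
    show "L nicely_meromorphic_on UNIV" using L(1) by (simp add: extended_selberg_class_def)
    show "{s. Re s > 1} \<noteq> {}" by (auto intro!: exI[of _ 2])
  qed (auto simp: open_halfspace_Re_gt)
  with L(2) show False by simp
qed

text \<open>If 1 is not in \<open>S\<close>, every factor tends to
  \<open>1 - \<alpha> \<noteq> 0\<close> and \<open>m = 1\<close> works. Otherwise the factor
  \<open>L - 1\<close> vanishes at the right end; its leading term comes from the first non-zero
  coefficient beyond the constant one, which exists because \<open>L\<close> is not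
  constant.\<close>

lemma selberg_class_prod_limit:
  assumes L: "L \<in> extended_selberg_class" "\<not> L constant_on UNIV" "has_dirichlet_series L a" "a 1 = 1"
    and S: "finite S"
  obtains m c where "m \<ge> 1" "c \<noteq> 0" "((\<lambda>s. (\<Prod>\<alpha>\<in>S. L s - \<alpha>) * of_nat m powr s) \<longlongrightarrow> c) right_end"
proof -
  have pos: "eventually (\<lambda>s. Re s > 1) right_end"
    unfolding eventually_right_end by (intro exI[of _ 2]) auto
  have lim1: "(L \<longlongrightarrow> 1) right_end"
    using dirichlet_series_limit[OF L(3), of 1] L(4) by simp
  show ?thesis
  proof (cases "1 \<in> S")
    case False
    have "((\<lambda>s. (\<Prod>\<alpha>\<in>S. L s - \<alpha>) * of_nat 1 powr s) \<longlongrightarrow> (\<Prod>\<alpha>\<in>S. 1 - \<alpha>)) right_end"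
      by (auto intro!: tendsto_intros lim1)
    moreover have "(\<Prod>\<alpha>\<in>S. 1 - \<alpha>) \<noteq> 0" using S False by auto
    ultimately show ?thesis using that[of 1] by blast
  next
    case True
    define b where "b n = a n - (if n = 1 then 1 else 0)" for n :: nat
    have D: "has_dirichlet_series (\<lambda>s. L s - 1) b"
      unfolding b_def by (rule dirichlet_series_diff[OF L(3) dirichlet_series_const])
    define m where "m = (LEAST n. n \<ge> 2 \<and> a n \<noteq> 0)"
    have m: "m \<ge> 2" "a m \<noteq> 0"
      using selberg_class_nonconstant_coeff[OF L(1-3)] LeastI_ex[of "\<lambda>n. n \<ge> 2 \<and> a n \<noteq> 0"]
      by (auto simp: m_def)
    have b0: "b n = 0" if "1 \<le> n" "n < m" for n
      using not_less_Least[of n "\<lambda>n. n \<ge> 2 \<and> a n \<noteq> 0"] that L(4)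
      by (cases "n = 1") (auto simp: b_def m_def)
    have "((\<lambda>s. (L s - 1) * of_nat m powr s) \<longlongrightarrow> b m) right_end"
      using dirichlet_series_limit[OF D _ b0] m by simp
    then have "((\<lambda>s. (\<Prod>\<alpha>\<in>S-{1}. L s - \<alpha>) * ((L s - 1) * of_nat m powr s))
        \<longlongrightarrow> (\<Prod>\<alpha>\<in>S-{1}. 1 - \<alpha>) * b m) right_end"
      by (intro tendsto_intros lim1)
    moreover have "(\<Prod>\<alpha>\<in>S-{1}. L s - \<alpha>) * ((L s - 1) * of_nat m powr s)
        = (\<Prod>\<alpha>\<in>S. L s - \<alpha>) * of_nat m powr s" for s
      by (simp add: prod.remove[OF S True] mult_ac)
    ultimately have "((\<lambda>s. (\<Prod>\<alpha>\<in>S. L s - \<alpha>) * of_nat m powr s)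
        \<longlongrightarrow> (\<Prod>\<alpha>\<in>S-{1}. 1 - \<alpha>) * b m) right_end"
      by simp
    moreover have "(\<Prod>\<alpha>\<in>S-{1}. 1 - \<alpha>) * b m \<noteq> 0" using S m by (auto simp: b_def)
    moreover have "m \<ge> 1" using m by simp
    ultimately show ?thesis using that by blast
  qed
qed

text \<open>Used with powers of \<open>s - 1\<close> as \<open>u\<close> and \<open>v\<close>, at
  points \<open>z \<noteq> 1\<close>, where they have order 0.\<close>

lemma zorder_eq_if_unit_multiples:
  assumes u: "u analytic_on {z}" "u z \<noteq> 0" and v: "v analytic_on {z}" "v z \<noteq> 0"
    and f: "f analytic_on {z}" "\<exists>\<^sub>F w in at z. f w \<noteq> 0"
    and g: "g analytic_on {z}" "\<exists>\<^sub>F w in at z. g w \<noteq> 0"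
    and eq: "\<forall>\<^sub>F w in at z. u w * f w = v w * g w"
  shows "zorder f z = zorder g z"
proof -
  have freq: "\<exists>\<^sub>F w in at z. h w \<noteq> 0" if "h analytic_on {z}" "h z \<noteq> 0" for h
    using analytic_at_imp_isCont[OF that(1)] that(2)
    by (intro eventually_frequently) (auto simp: isCont_def tendsto_imp_eventually_ne)
  have "zorder f z = zorder (\<lambda>w. u w * f w) z"
    using zorder_mult[OF _ freq[OF u] _ f(2)] u f by (simp add: zorder_eq_0I analytic_on_imp_meromorphic_on)
  also have "\<dots> = zorder (\<lambda>w. v w * g w) z" by (rule zorder_cong[OF eq refl])
  also have "\<dots> = zorder g z"
    using zorder_mult[OF _ freq[OF v] _ g(2)] v g by (simp add: zorder_eq_0I analytic_on_imp_meromorphic_on)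
  finally show ?thesis .
qed

text \<open>The pole at 1 is the obstacle: \<open>zero_multiplicity\<close> counts a pole of any
  order as 0, so sharing \<open>S\<close> does not fix the order of the product at 1. Therefore
  growth and zeros are carried by two functions: \<open>F\<close> clears the pole and inherits the
  growth bound, \<open>G\<close> also drops any zero at 1, so that all its zeros lie away from 1,
  where they are those of the product.\<close>

lemma selberg_class_prod_factorization:
  assumes L: "L \<in> extended_selberg_class" "\<not> L constant_on UNIV" "has_dirichlet_series L a" "a 1 = 1"
    and S: "finite S"
  obtains F G m n where "F holomorphic_on UNIV" "exp_poly_bounded F"
    "\<And>s. s \<noteq> 1 \<Longrightarrow> F s = (s - 1) ^ m * (\<Prod>\<alpha>\<in>S. L s - \<alpha>)"
    "G holomorphic_on UNIV" "G 1 \<noteq> 0" "\<And>s. F s = (s - 1) ^ n * G s"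
    "\<And>z. z \<noteq> 1 \<Longrightarrow> zero_multiplicity (\<lambda>s. \<Prod>\<alpha>\<in>S. L s - \<alpha>) z = enat (nat (zorder G z))"
    "\<And>z. \<exists>\<^sub>F w in at z. G w \<noteq> 0"
proof -
  define P where "P s = (\<Prod>\<alpha>\<in>S. L s - \<alpha>)" for s
  obtain k g where g: "g holomorphic_on UNIV" "exp_poly_bounded g"
    "\<And>s. s \<noteq> 1 \<Longrightarrow> g s = (s - 1) ^ k * L s"
    using selberg_class_entireE[OF L(1)] by metis
  define F where "F s = (\<Prod>\<alpha>\<in>S. g s - \<alpha> * (s - 1) ^ k)" for s
  have F: "F holomorphic_on UNIV" unfolding F_def by (intro holomorphic_intros g)
  have Fb: "exp_poly_bounded F" unfolding F_def
    by (intro exp_poly_bounded_prod exp_poly_bounded_diff exp_poly_bounded_mult exp_poly_bounded_power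
        exp_poly_bounded_const exp_poly_bounded_ident g)
  have FP: "F s = (s - 1) ^ (k * card S) * P s" if "s \<noteq> 1" for s
  proof -
    have "F s = (\<Prod>\<alpha>\<in>S. (s - 1) ^ k * (L s - \<alpha>))"
      unfolding F_def using g(3)[OF that] by (simp add: algebra_simps)
    then show ?thesis by (simp add: P_def prod.distrib power_mult)
  qed
  obtain m c where mc: "m \<ge> 1" "c \<noteq> 0" "((\<lambda>s. P s * of_nat m powr s) \<longlongrightarrow> c) right_end"
    using selberg_class_prod_limit[OF L S] unfolding P_def by metis
  obtain x0 where x0: "\<And>s. Re s \<ge> x0 \<Longrightarrow> P s * of_nat m powr s \<noteq> 0"
    using tendsto_imp_eventually_ne[OF mc(3,2)] unfolding eventually_right_end by blast
  define z0 where "z0 = complex_of_real (max x0 2)"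
  have "P z0 \<noteq> 0" using x0[of z0] by (auto simp: z0_def)
  moreover have z01: "z0 \<noteq> 1" by (auto simp: z0_def complex_eq_iff)
  ultimately have Fz0: "F z0 \<noteq> 0" using FP[of z0] by simp
  obtain G n where G: "G holomorphic_on UNIV" "G 1 \<noteq> 0" "\<And>w. F w = (w - 1) ^ n * G w"
    using entire_factor_zero[OF F Fz0] by metis
  have Gnz: "\<exists>\<^sub>F w in at z. G w \<noteq> 0" for z
  proof -
    have "\<forall>\<^sub>F w in at z. G w \<noteq> 0 \<and> w \<in> UNIV"
      by (rule non_zero_neighbour_alt[OF G(1), of _ 1]) (use G in auto)
    then show ?thesis by (intro eventually_frequently) (auto elim: eventually_mono)
  qed
  have "zero_multiplicity P z = enat (nat (zorder G z))" if z: "z \<noteq> 1" for z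
  proof -
    have ne1: "\<forall>\<^sub>F w in at z. w \<noteq> 1"
      using z by (intro tendsto_imp_eventually_ne[OF tendsto_ident_at])
    have eq: "\<forall>\<^sub>F w in at z. (w - 1) ^ (k * card S) * P w = (w - 1) ^ n * G w"
      using ne1 by eventually_elim (metis FP G(3))
    have Gz: "\<forall>\<^sub>F w in at z. G w \<noteq> 0 \<and> w \<in> UNIV"
      by (rule non_zero_neighbour_alt[OF G(1), of _ 1]) (use G in auto)
    have Pz: "\<forall>\<^sub>F w in at z. P w \<noteq> 0"
      using eq ne1 Gz by eventually_elim auto
    then have Pf: "\<exists>\<^sub>F w in at z. P w \<noteq> 0" by (intro eventually_frequently) auto
    have "P holomorphic_on -{1}"
      unfolding P_def by (intro holomorphic_intros selberg_class_holomorphic L)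
    then have Pa: "P analytic_on {z}" using z by (auto simp: analytic_at)
    have "zorder P z = zorder G z"
    proof (rule zorder_eq_if_unit_multiples[OF _ _ _ _ Pa Pf _ Gnz eq])
      show "G analytic_on {z}" using G(1) analytic_on_open[of UNIV G] analytic_on_subset by blast
    qed (use z in \<open>auto intro!: analytic_intros\<close>)
    moreover have "\<not> (\<forall>\<^sub>F w in at z. P w = 0)" using Pf by (simp add: frequently_def)
    ultimately show ?thesis by (simp add: zero_multiplicity_def)
  qed
  then have zm: "zero_multiplicity (\<lambda>s. \<Prod>\<alpha>\<in>S. L s - \<alpha>) z = enat (nat (zorder G z))" if "z \<noteq> 1" for z
    using that unfolding P_def[abs_def] by blast
  show ?thesis
    by (rule that[OF F Fb FP[unfolded P_def] G zm Gnz])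
qed

lemma share_set_CM_imp_exponential_quotient:
  assumes L1: "L1 \<in> extended_selberg_class" "\<not> L1 constant_on UNIV" "has_dirichlet_series L1 a1" "a1 1 = 1"
    and L2: "L2 \<in> extended_selberg_class" "\<not> L2 constant_on UNIV" "has_dirichlet_series L2 a2" "a2 1 = 1"
    and S: "finite S" "share_set_CM L1 L2 S"
  obtains C b where "C \<noteq> 0"
    "\<And>s. s \<noteq> 1 \<Longrightarrow> (\<Prod>\<alpha>\<in>S. L1 s - \<alpha>) = C * exp (of_real b * s) * (\<Prod>\<alpha>\<in>S. L2 s - \<alpha>)"
proof -
  define P1 where "P1 s = (\<Prod>\<alpha>\<in>S. L1 s - \<alpha>)" for s
  define P2 where "P2 s = (\<Prod>\<alpha>\<in>S. L2 s - \<alpha>)" for s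
  obtain F1 G1 m1 n1 where F1: "F1 holomorphic_on UNIV" "exp_poly_bounded F1"
    "\<And>s. s \<noteq> 1 \<Longrightarrow> F1 s = (s - 1) ^ m1 * P1 s"
    and G1: "G1 holomorphic_on UNIV" "G1 1 \<noteq> 0" "\<And>s. F1 s = (s - 1) ^ n1 * G1 s"
    "\<And>z. z \<noteq> 1 \<Longrightarrow> zero_multiplicity P1 z = enat (nat (zorder G1 z))"
    "\<And>z. \<exists>\<^sub>F w in at z. G1 w \<noteq> 0"
    by (rule selberg_class_prod_factorization[OF L1 S(1), folded P1_def]) blast
  obtain F2 G2 m2 n2 where F2: "F2 holomorphic_on UNIV" "exp_poly_bounded F2"
    "\<And>s. s \<noteq> 1 \<Longrightarrow> F2 s = (s - 1) ^ m2 * P2 s"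
    and G2: "G2 holomorphic_on UNIV" "G2 1 \<noteq> 0" "\<And>s. F2 s = (s - 1) ^ n2 * G2 s"
    "\<And>z. z \<noteq> 1 \<Longrightarrow> zero_multiplicity P2 z = enat (nat (zorder G2 z))"
    "\<And>z. \<exists>\<^sub>F w in at z. G2 w \<noteq> 0"
    by (rule selberg_class_prod_factorization[OF L2 S(1), folded P2_def]) blast
  have an: "G1 analytic_on {z}" "G2 analytic_on {z}" for z
    using G1(1) G2(1) analytic_on_open[of UNIV] analytic_on_subset by blast+
  have zord: "zorder G1 z = zorder G2 z" for z
  proof (cases "z = 1")
    case True
    then show ?thesis using zorder_eq_0I[OF an(1) G1(2)] zorder_eq_0I[OF an(2) G2(2)] by simp
  next
    case False
    have "zero_multiplicity P1 z = zero_multiplicity P2 z"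
      using S(2) by (simp add: share_set_CM_def P1_def[abs_def] P2_def[abs_def])
    then have "nat (zorder G1 z) = nat (zorder G2 z)" using False G1(4) G2(4) by simp
    then show ?thesis
      using zorder_ge_0[OF an(1)[of z] G1(5)] zorder_ge_0[OF an(2)[of z] G2(5)]
      by (simp only: eq_nat_nat_iff)
  qed
  have "G2 z = 0 \<longleftrightarrow> G1 z = 0" for z
    using zorder_pos_iff'[OF an(1) G1(5), of z] zorder_pos_iff'[OF an(2) G2(5), of z] zord[of z] by simp
  then obtain e where e: "e holomorphic_on UNIV" "\<And>z. e z \<noteq> 0" "\<And>z. G1 z = e z * G2 z"
    using holomorphic_zorder_factorization[OF G1(1) open_UNIV connected_UNIV G2(1)] zord by (metis UNIV_I)
  have "simply_connected (UNIV :: complex set)" by (simp add: convex_imp_simply_connected)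
  then obtain h where h: "h holomorphic_on UNIV" "\<And>z. e z = exp (h z)"
    using simply_connected_eq_holomorphic_log[OF open_UNIV] e by (metis UNIV_I)
  define A where "A = n2 + m1"
  define B where "B = n1 + m2"
  define E1 where "E1 s = (s - 1) ^ n2 * F1 s" for s
  define E2 where "E2 s = (s - 1) ^ n1 * F2 s" for s
  have eqE: "E1 s = E2 s * exp (h s)" for s
    by (simp add: E1_def E2_def G1(3) G2(3) e(3) h(2))
  have eqP: "(s - 1) ^ A * P1 s = (s - 1) ^ B * P2 s * exp (h s)" if "s \<noteq> 1" for s
    using eqE[of s] that by (simp add: E1_def E2_def F1(3) F2(3) A_def B_def power_add mult_ac)
  have Eb: "E1 holomorphic_on UNIV" "E2 holomorphic_on UNIV" "exp_poly_bounded E1" "exp_poly_bounded E2"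
    unfolding E1_def E2_def
    by (intro holomorphic_intros F1 F2 exp_poly_bounded_mult exp_poly_bounded_power exp_poly_bounded_diff
        exp_poly_bounded_ident exp_poly_bounded_const)+
  obtain M1 c1 where M1: "M1 \<ge> 1" "c1 \<noteq> 0" "((\<lambda>s. P1 s * of_nat M1 powr s) \<longlongrightarrow> c1) right_end"
    by (rule selberg_class_prod_limit[OF L1 S(1), folded P1_def]) blast
  obtain M2 c2 where M2: "M2 \<ge> 1" "c2 \<noteq> 0" "((\<lambda>s. P2 s * of_nat M2 powr s) \<longlongrightarrow> c2) right_end"
    by (rule selberg_class_prod_limit[OF L2 S(1), folded P2_def]) blast
  obtain x0 where x0: "\<And>s. Re s \<ge> x0 \<Longrightarrow> P2 s * of_nat M2 powr s \<noteq> 0"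
    using tendsto_imp_eventually_ne[OF M2(3,2)] unfolding eventually_right_end by blast
  \<comment> \<open>\<open>exp_quotient_growth\<close> asks for a non-zero value at the origin,
    which \<open>E2\<close> need not have; everything is translated by \<open>z0\<close>, chosen far
    enough to the right for \<open>P2\<close> not to vanish.\<close>
  define z0 where "z0 = complex_of_real (max x0 2)"
  have z0: "z0 \<noteq> 1" "P2 z0 \<noteq> 0" using x0[of z0] by (auto simp: z0_def complex_eq_iff)
  then have E20: "E2 (0 + z0) \<noteq> 0" by (simp add: E2_def F2(3))
  have "(\<lambda>s. f (s + z0)) holomorphic_on UNIV" if "f holomorphic_on UNIV" for f
    using holomorphic_on_compose_gen[OF _ that, of "\<lambda>s. s + z0" UNIV, unfolded o_def]
    by (simp add: holomorphic_on_add)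
  note hol = this
  obtain C N where CN: "\<And>z. norm (h (z + z0)) \<le> C * (1 + norm z) ^ N"
    using exp_quotient_growth[OF hol[OF Eb(1)] exp_poly_bounded_translate[OF Eb(3)]
      hol[OF Eb(2)] exp_poly_bounded_translate[OF Eb(4)] E20 hol[OF h(1)] eqE] by blast
  \<comment> \<open>The leading terms give \<open>P1 / P2\<close> the size of
    \<open>(M2 / M1) powr s\<close>; adding \<open>b * s\<close> to \<open>h\<close> compensates for
    it, so that the exponential of \<open>H\<close> has a limit up to powers of
    \<open>s - 1\<close>. Undoing this yields the exponent \<open>-b\<close> in the result.\<close>
  define b where "b = ln (real M1) - ln (real M2)"
  define H where "H s = h s + of_real b * s" for s
  have H: "H holomorphic_on UNIV" unfolding H_def by (intro holomorphic_intros h)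
  have C0: "C \<ge> 0" using order_trans[OF norm_ge_zero CN[of 0]] by simp
  define D where "D = C * (1 + norm z0) ^ N + \<bar>b\<bar>"
  \<comment> \<open>The exponent \<open>N + 1\<close> leaves room for the linear term when
    \<open>N = 0\<close>.\<close>
  have Hb: "norm (H z) \<le> D * (1 + norm z) ^ (N + 1)" for z
  proof -
    have "0 \<le> norm z0 * norm z" by simp
    then have "1 + norm (z - z0) \<le> (1 + norm z0) * (1 + norm z)"
      using norm_triangle_ineq4[of z z0] unfolding distrib_left distrib_right mult_1_left mult_1_right
      by linarith
    then have "(1 + norm (z - z0)) ^ N \<le> (1 + norm z0) ^ N * (1 + norm z) ^ N"
      by (subst power_mult_distrib[symmetric], intro power_mono) auto
    also have "\<dots> \<le> (1 + norm z0) ^ N * (1 + norm z) ^ (N + 1)"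
      by (intro mult_left_mono power_increasing) auto
    finally have "C * (1 + norm (z - z0)) ^ N \<le> C * (1 + norm z0) ^ N * (1 + norm z) ^ (N + 1)"
      using C0 by (simp add: mult_left_mono mult.assoc)
    moreover have "norm (of_real b * z) \<le> \<bar>b\<bar> * (1 + norm z) ^ (N + 1)"
    proof -
      have "norm z \<le> (1 + norm z) ^ 1" by simp
      also have "\<dots> \<le> (1 + norm z) ^ (N + 1)" by (intro power_increasing) auto
      finally show ?thesis by (simp add: norm_mult mult_left_mono)
    qed
    ultimately show ?thesis
      using CN[of "z - z0"] norm_triangle_ineq[of "h z" "of_real b * z"]
      by (simp add: H_def D_def distrib_right)
  qed
  have powr_nat: "of_nat M powr s = exp (of_real (ln (real M)) * s)" if "M \<ge> 1" for M :: nat and s :: complex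
    using that Ln_of_real[of "real M"] by (simp add: powr_def mult.commute)
  have "((\<lambda>s. (P1 s * of_nat M1 powr s) / (P2 s * of_nat M2 powr s)) \<longlongrightarrow> c1 / c2) right_end"
    by (intro tendsto_intros M1 M2)
  moreover have "\<forall>\<^sub>F s in right_end. (P1 s * of_nat M1 powr s) / (P2 s * of_nat M2 powr s)
      = (s - 1) ^ B * exp (H s) / (s - 1) ^ A"
  proof -
    have "\<forall>\<^sub>F s in right_end. Re s \<ge> max x0 2" unfolding eventually_right_end by blast
    then show ?thesis
    proof eventually_elim
      case (elim s)
      then have s: "s \<noteq> 1" "P2 s * of_nat M2 powr s \<noteq> 0" using x0[of s] by auto
      have e: "exp (H s) * of_nat M2 powr s = exp (h s) * of_nat M1 powr s"
        unfolding powr_nat[OF M1(1)] powr_nat[OF M2(1)] exp_add[symmetric] H_def b_def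
        by (simp add: algebra_simps)
      have "(P1 s * of_nat M1 powr s) * (s - 1) ^ A = ((s - 1) ^ B * exp (H s)) * (P2 s * of_nat M2 powr s)"
      proof -
        have "(P1 s * of_nat M1 powr s) * (s - 1) ^ A = ((s - 1) ^ A * P1 s) * of_nat M1 powr s"
          by (simp only: mult_ac)
        also have "\<dots> = (s - 1) ^ B * P2 s * (exp (h s) * of_nat M1 powr s)"
          unfolding eqP[OF s(1)] by (simp only: mult_ac)
        also have "\<dots> = (s - 1) ^ B * P2 s * (exp (H s) * of_nat M2 powr s)"
          by (simp only: e)
        finally show ?thesis by (simp only: mult_ac)
      qed
      then show ?case using s by (simp add: frac_eq_eq)
    qed
  qed
  ultimately have "((\<lambda>s. (s - 1) ^ B * exp (H s) / (s - 1) ^ A) \<longlongrightarrow> c1 / c2) right_end"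
    by (rule Lim_transform_eventually)
  then have "A = B \<and> (\<exists>K. \<forall>s. H s = K)"
    by (rule exp_polynomial_limit_imp_constant[OF H Hb]) (use M1 M2 in auto)
  then obtain K where AB: "A = B" and K: "\<And>s. H s = K" by blast
  show ?thesis
  proof (rule that[of "exp K" "-b"])
    fix s :: complex assume s: "s \<noteq> 1"
    have "h s = K - of_real b * s" using K[of s] by (simp add: H_def algebra_simps)
    then have "P1 s = P2 s * exp (K - of_real b * s)"
      using eqP[OF s] s AB by simp
    then show "(\<Prod>\<alpha>\<in>S. L1 s - \<alpha>) = exp K * exp (of_real (- b) * s) * (\<Prod>\<alpha>\<in>S. L2 s - \<alpha>)"
      by (simp add: P1_def P2_def exp_diff exp_minus field_simps)
  qed auto
qed

subsection \<open>Rigidity of products of Gamma functions\<close>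

text \<open>Strips of arbitrary width around the ray \<open>Re s = \<epsilon> * Im s\<close>, not
  the ray alone: an eventual property may start at a height that depends on the width
  \<open>\<rho>\<close>, and so survives bounded shifts of the argument. That is what differences
  and Cauchy's inequality on discs of fixed radius require, while for \<open>\<epsilon> > 0\<close>
  both \<open>Re s\<close> and \<open>Im s\<close> still tend to infinity, at comparable
  rates.\<close>

definition ray_filter :: "real \<Rightarrow> complex filter" where
  "ray_filter \<epsilon> = (SUP \<rho>. inf (filtercomap Im at_top) (principal {s. \<bar>Re s - \<epsilon> * Im s\<bar> \<le> \<rho>}))"

lemma eventually_ray_filter:
  "eventually P (ray_filter \<epsilon>) \<longleftrightarrow> (\<forall>\<rho>. \<exists>Y. \<forall>s. Im s \<ge> Y \<longrightarrow> \<bar>Re s - \<epsilon> * Im s\<bar> \<le> \<rho> \<longrightarrow> P s)"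
  by (simp add: ray_filter_def eventually_Sup eventually_inf_principal eventually_filtercomap_at_top_linorder)

lemma filterlim_Im_ray_filter: "filterlim Im at_top (ray_filter \<epsilon>)"
  unfolding filterlim_at_top eventually_ray_filter by blast

lemma filterlim_Re_ray_filter:
  assumes "\<epsilon> > 0"
  shows "filterlim Re at_top (ray_filter \<epsilon>)"
  unfolding filterlim_at_top eventually_ray_filter
proof (intro allI)
  fix Z \<rho> :: real
  have "Z \<le> Re s" if s: "(Z + \<rho>) / \<epsilon> \<le> Im s" "\<bar>Re s - \<epsilon> * Im s\<bar> \<le> \<rho>" for s
  proof -
    have "Z + \<rho> \<le> \<epsilon> * Im s" using s(1) assms by (simp add: field_simps)
    then show ?thesis using s(2) by linarith
  qed
  then show "\<exists>Y. \<forall>s. Y \<le> Im s \<longrightarrow> \<bar>Re s - \<epsilon> * Im s\<bar> \<le> \<rho> \<longrightarrow> Z \<le> Re s" by blast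
qed

lemma eventually_Re_gt_ray_filter:
  assumes "\<epsilon> > 0"
  shows "eventually (\<lambda>s. Re s > R) (ray_filter \<epsilon>)"
  using filterlim_Re_ray_filter[OF assms] by (simp add: filterlim_at_top_dense)

lemma eventually_Im_gt_ray_filter: "eventually (\<lambda>s. Im s > R) (ray_filter \<epsilon>)"
  using filterlim_Im_ray_filter by (simp add: filterlim_at_top_dense)

text \<open>A move by at most \<open>r\<close> changes \<open>Re s - \<epsilon> * Im s\<close> by at
  most \<open>r + \<bar>\<epsilon>\<bar> * r\<close>, so the disc stays in a wider strip, and the
  filter allows all widths.\<close>

lemma eventually_cball_ray_filter:
  assumes "eventually P (ray_filter \<epsilon>)"
  shows "eventually (\<lambda>s. \<forall>w\<in>cball s r. P w) (ray_filter \<epsilon>)"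
  unfolding eventually_ray_filter
proof
  fix \<rho>
  obtain Y where Y: "\<And>s. Im s \<ge> Y \<Longrightarrow> \<bar>Re s - \<epsilon> * Im s\<bar> \<le> \<rho> + r + \<bar>\<epsilon>\<bar> * r \<Longrightarrow> P s"
    using assms unfolding eventually_ray_filter by blast
  have "P w" if s: "Im s \<ge> Y + r" "\<bar>Re s - \<epsilon> * Im s\<bar> \<le> \<rho>" and w: "w \<in> cball s r" for s w
  proof (rule Y)
    have "\<bar>Re w - Re s\<bar> \<le> r" "\<bar>Im w - Im s\<bar> \<le> r"
      using w abs_Re_le_cmod[of "w - s"] abs_Im_le_cmod[of "w - s"]
      by (auto simp: dist_norm norm_minus_commute)
    moreover from this have "\<bar>\<epsilon> * (Im w - Im s)\<bar> \<le> \<bar>\<epsilon>\<bar> * r"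
      by (simp add: abs_mult mult_left_mono)
    ultimately show "Im w \<ge> Y" "\<bar>Re w - \<epsilon> * Im w\<bar> \<le> \<rho> + r + \<bar>\<epsilon>\<bar> * r"
      using s by (auto simp: algebra_simps)
  qed
  then show "\<exists>Y. \<forall>s. Y \<le> Im s \<longrightarrow> \<bar>Re s - \<epsilon> * Im s\<bar> \<le> \<rho> \<longrightarrow> (\<forall>w\<in>cball s r. P w)" by blast
qed

lemma filterlim_ray: "filterlim (\<lambda>r. Complex \<epsilon> 1 * of_real r) (ray_filter \<epsilon>) at_top"
  unfolding filterlim_iff eventually_ray_filter
proof (intro allI impI)
  fix P :: "complex \<Rightarrow> bool"
  assume "\<forall>\<rho>. \<exists>Y. \<forall>s. Y \<le> Im s \<longrightarrow> \<bar>Re s - \<epsilon> * Im s\<bar> \<le> \<rho> \<longrightarrow> P s"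
  then obtain Y where "\<And>s. Y \<le> Im s \<Longrightarrow> \<bar>Re s - \<epsilon> * Im s\<bar> \<le> 0 \<Longrightarrow> P s" by blast
  then have "P (Complex \<epsilon> 1 * of_real r)" if "r \<ge> Y" for r using that by simp
  then show "\<forall>\<^sub>F x in at_top. P (Complex \<epsilon> 1 * complex_of_real x)"
    unfolding eventually_at_top_linorder by blast
qed

lemma ray_filter_neq_bot: "ray_filter \<epsilon> \<noteq> bot"
proof
  assume "ray_filter \<epsilon> = bot"
  then have "eventually (\<lambda>_. False) (ray_filter \<epsilon>)" by simp
  from eventually_compose_filterlim[OF this filterlim_ray] show False by simp
qed

section \<open>Exponential decay in the imaginary direction\<close>

abbreviation exp_decay :: "real \<Rightarrow> complex \<Rightarrow> complex" where
  "exp_decay c \<equiv> (\<lambda>s. of_real (exp (- (c * Im s))))"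

lemma bigo_exp_decay_cball:
  assumes "f \<in> O[ray_filter \<epsilon>](exp_decay c)" "r \<ge> 0"
  obtains K where "K > 0"
    "eventually (\<lambda>s. \<forall>w\<in>cball s r. norm (f w) \<le> K * exp (- (c * Im s))) (ray_filter \<epsilon>)"
proof -
  obtain K where K: "K > 0" "eventually (\<lambda>s. norm (f s) \<le> K * exp (- (c * Im s))) (ray_filter \<epsilon>)"
    using landau_o.bigE[OF assms(1)] by (auto simp: norm_of_real)
  show ?thesis
  proof (rule that[of "K * exp (\<bar>c\<bar> * r)"])
    show "\<forall>\<^sub>F s in ray_filter \<epsilon>. \<forall>w\<in>cball s r. norm (f w) \<le> K * exp (\<bar>c\<bar> * r) * exp (- (c * Im s))"
      using eventually_cball_ray_filter[OF K(2), of r]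
    proof eventually_elim
      case (elim s)
      show ?case
      proof
        fix w assume w: "w \<in> cball s r"
        have "\<bar>Im w - Im s\<bar> \<le> r"
          using w abs_Im_le_cmod[of "w - s"] by (auto simp: dist_norm norm_minus_commute)
        then have "\<bar>c * (Im w - Im s)\<bar> \<le> \<bar>c\<bar> * r" by (simp add: abs_mult mult_left_mono)
        then have "exp (- (c * Im w)) \<le> exp (\<bar>c\<bar> * r + - (c * Im s))" by (simp add: algebra_simps)
        then have "exp (- (c * Im w)) \<le> exp (\<bar>c\<bar> * r) * exp (- (c * Im s))" by (simp only: exp_add)
        then have "K * exp (- (c * Im w)) \<le> K * (exp (\<bar>c\<bar> * r) * exp (- (c * Im s)))"
          using K(1) by (intro mult_left_mono) auto
        then show "norm (f w) \<le> K * exp (\<bar>c\<bar> * r) * exp (- (c * Im s))"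
          using elim w by (fastforce simp: mult.assoc)
      qed
    qed
  qed (use K in auto)
qed

lemma bigo_exp_decay_tendsto_0:
  assumes "f \<in> O[ray_filter \<epsilon>](exp_decay c)" "c > 0"
  shows "(f \<longlongrightarrow> 0) (ray_filter \<epsilon>)"
proof -
  obtain K where K: "K > 0" "eventually (\<lambda>s. norm (f s) \<le> K * exp (- (c * Im s))) (ray_filter \<epsilon>)"
    using landau_o.bigE[OF assms(1)] by (auto simp: norm_of_real)
  have "filterlim (\<lambda>s. - (c * Im s)) at_bot (ray_filter \<epsilon>)"
    using assms(2) filterlim_tendsto_pos_mult_at_top[OF tendsto_const _ filterlim_Im_ray_filter]
    by (simp add: filterlim_uminus_at_top)
  then have "((\<lambda>s. exp (- (c * Im s))) \<longlongrightarrow> 0) (ray_filter \<epsilon>)"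
    by (rule filterlim_compose[OF exp_at_bot])
  then have "((\<lambda>s. K * exp (- (c * Im s))) \<longlongrightarrow> 0) (ray_filter \<epsilon>)"
    by (rule tendsto_mult_right_zero)
  with K(2) show ?thesis by (rule Lim_null_comparison)
qed

lemma bigo_exp_decay_shift:
  assumes "f \<in> O[ray_filter \<epsilon>](exp_decay c)"
  shows "(\<lambda>s. f (s + b)) \<in> O[ray_filter \<epsilon>](exp_decay c)"
proof -
  obtain K where K: "K > 0"
    "eventually (\<lambda>s. \<forall>w\<in>cball s (norm b). norm (f w) \<le> K * exp (- (c * Im s))) (ray_filter \<epsilon>)"
    using bigo_exp_decay_cball[OF assms, of "norm b"] by auto
  from K(2) have "eventually (\<lambda>s. norm (f (s + b)) \<le> K * norm (exp_decay c s)) (ray_filter \<epsilon>)"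
    by eventually_elim (auto simp: dist_norm norm_of_real)
  then show ?thesis by (rule bigoI)
qed

text \<open>Cauchy's inequality on unit discs, over which \<open>exp_decay c\<close> varies only by
  a bounded factor.\<close>

lemma bigo_exp_decay_deriv:
  assumes f: "f \<in> O[ray_filter \<epsilon>](exp_decay c)" and "\<epsilon> > 0"
    and der: "\<And>z. Re z > R \<Longrightarrow> (f has_field_derivative f' z) (at z)"
  shows "f' \<in> O[ray_filter \<epsilon>](exp_decay c)"
proof -
  obtain K where K: "K > 0"
    "eventually (\<lambda>s. \<forall>w\<in>cball s 1. norm (f w) \<le> K * exp (- (c * Im s))) (ray_filter \<epsilon>)"
    using bigo_exp_decay_cball[OF f, of 1] by auto
  have "eventually (\<lambda>s. norm (f' s) \<le> K * norm (exp_decay c s)) (ray_filter \<epsilon>)"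
    using K(2) eventually_cball_ray_filter[OF eventually_Re_gt_ray_filter[OF \<open>\<epsilon> > 0\<close>, of R], of 1]
  proof eventually_elim
    case (elim s)
    have hol: "f holomorphic_on cball s 1"
      using der elim(2) unfolding holomorphic_on_def field_differentiable_def
      by (meson has_field_derivative_at_within)
    have "norm ((deriv ^^ 1) f s) \<le> fact 1 * (K * exp (- (c * Im s))) / 1 ^ 1"
      by (rule Cauchy_inequality)
         (use hol elim(1) in \<open>auto simp: dist_norm intro: holomorphic_on_imp_continuous_on holomorphic_on_subset\<close>)
    moreover have "deriv f s = f' s" using der[of s] elim(2) by (auto intro: DERIV_imp_deriv)
    ultimately show ?case by (simp add: norm_of_real)
  qed
  then show ?thesis by (rule bigoI)
qed

text \<open>The head of the list is differenced first, and after all steps a rational function on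
  some right half plane must remain. Differencing commutes with sums, scalar multiples and
  translations, so the class is closed under these. The equation is kept free of denominators, so
  that no exception for the zeros of \<open>q\<close> has to be carried along.\<close>

primrec difference_rational :: "real list \<Rightarrow> (complex \<Rightarrow> complex) \<Rightarrow> bool" where
  "difference_rational [] f \<longleftrightarrow> (\<exists>p q R. q \<noteq> 0 \<and> (\<forall>z. Re z > R \<longrightarrow> poly q z * f z = poly p z))"
| "difference_rational (h # hs) f \<longleftrightarrow> difference_rational hs (\<lambda>z. f (z + of_real h) - f z)"

lemma difference_rational_add:
  "difference_rational hs f \<Longrightarrow> difference_rational hs g \<Longrightarrow> difference_rational hs (\<lambda>z. f z + g z)"
proof (induction hs arbitrary: f g)
  case Nil
  from Nil(1) obtain p q R where 1: "q \<noteq> 0" "\<And>z. Re z > R \<Longrightarrow> poly q z * f z = poly p z" by auto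
  from Nil(2) obtain p' q' R' where 2: "q' \<noteq> 0" "\<And>z. Re z > R' \<Longrightarrow> poly q' z * g z = poly p' z" by auto
  have "poly (q * q') z * (f z + g z) = poly (p * q' + p' * q) z" if "Re z > max R R'" for z
    using 1(2)[of z] 2(2)[of z] that by (simp add: algebra_simps)
  moreover have "q * q' \<noteq> 0" using 1 2 by simp
  ultimately show ?case unfolding difference_rational.simps by blast
next
  case (Cons h hs)
  from Cons.IH[OF Cons.prems[unfolded difference_rational.simps]]
  show ?case by (simp add: algebra_simps)
qed

lemma difference_rational_cmult:
  "difference_rational hs f \<Longrightarrow> difference_rational hs (\<lambda>z. c * f z)"
proof (induction hs arbitrary: f)
  case Nil
  then obtain p q R where 1: "q \<noteq> 0" "\<And>z. Re z > R \<Longrightarrow> poly q z * f z = poly p z" by auto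
  then have "poly q z * (c * f z) = poly (smult c p) z" if "Re z > R" for z using that by (simp add: mult_ac)
  with 1(1) show ?case unfolding difference_rational.simps by blast
next
  case (Cons h hs)
  from Cons.IH[OF Cons.prems[unfolded difference_rational.simps]]
  show ?case by (simp add: algebra_simps)
qed

lemma difference_rational_shift:
  "difference_rational hs f \<Longrightarrow> difference_rational hs (\<lambda>z. f (z + b))"
proof (induction hs arbitrary: f)
  case Nil
  then obtain p q R where 1: "q \<noteq> 0" "\<And>z. Re z > R \<Longrightarrow> poly q z * f z = poly p z" by auto
  have "poly (pcompose q [:b, 1:]) z * f (z + b) = poly (pcompose p [:b, 1:]) z" if "Re z > R - Re b" for z
    using 1(2)[of "z + b"] that by (simp add: poly_pcompose add.commute)
  moreover have "pcompose q [:b, 1:] \<noteq> 0" using 1(1) by (simp add: pcompose_eq_0_iff)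
  ultimately show ?case unfolding difference_rational.simps by blast
next
  case (Cons h hs)
  from Cons.IH[OF Cons.prems[unfolded difference_rational.simps]]
  show ?case by (simp add: add_ac)
qed

lemma difference_rational_Cons:
  assumes "difference_rational hs f"
  shows "difference_rational (h # hs) f"
  using difference_rational_add[OF difference_rational_shift[OF assms, of "of_real h"]
      difference_rational_cmult[OF assms, of "-1"]]
  by simp

lemma difference_rational_Nil_imp: "difference_rational [] f \<Longrightarrow> difference_rational hs f"
  by (induction hs) (use difference_rational_Cons in \<open>auto simp del: difference_rational.simps\<close>)

text \<open>A trigamma term becomes rational under its own step alone, but a sum of such terms needs
  one common list of steps; differences taken before or after the decisive one do no harm.\<close>

lemma difference_rational_member:
  "difference_rational [h] f \<Longrightarrow> h \<in> set hs \<Longrightarrow> difference_rational hs f"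
proof (induction hs arbitrary: f)
  case (Cons k hs)
  show ?case
  proof (cases "h = k")
    case True
    then show ?thesis
      using Cons.prems(1) difference_rational_Nil_imp[of "\<lambda>z. f (z + of_real h) - f z" hs]
      by (simp only: difference_rational.simps(2))
  next
    case False
    then have "difference_rational hs f" using Cons by auto
    then show ?thesis by (rule difference_rational_Cons)
  qed
qed auto

lemma tendsto_poly_exp_decay_ray:
  fixes q :: "complex poly"
  assumes "c > 0"
  shows "((\<lambda>r. norm (poly q (a * of_real r)) * exp (- (c * r))) \<longlongrightarrow> 0) at_top"
proof -
  have mono: "((\<lambda>r. r ^ i * exp (- (c * r))) \<longlongrightarrow> 0) at_top" for i
  proof -
    have "((\<lambda>r. (c * r) ^ i / exp (c * r)) \<longlongrightarrow> 0) at_top"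
      by (rule filterlim_compose[OF tendsto_power_div_exp_0])
         (use assms in \<open>auto intro!: filterlim_tendsto_pos_mult_at_top[OF tendsto_const] filterlim_ident\<close>)
    then have "((\<lambda>r. (1 / c ^ i) * ((c * r) ^ i / exp (c * r))) \<longlongrightarrow> (1 / c ^ i) * 0) at_top"
      by (intro tendsto_intros)
    then show ?thesis using assms by (simp add: power_mult_distrib exp_minus field_simps)
  qed
  have "((\<lambda>r. \<Sum>i\<le>degree q. norm (coeff q i * a ^ i) * (r ^ i * exp (- (c * r))))
      \<longlongrightarrow> (\<Sum>i\<le>degree q. norm (coeff q i * a ^ i) * 0)) at_top"
    by (intro tendsto_intros mono)
  then have lim: "((\<lambda>r. \<Sum>i\<le>degree q. norm (coeff q i * a ^ i) * (r ^ i * exp (- (c * r)))) \<longlongrightarrow> 0) at_top"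
    by simp
  show ?thesis
  proof (rule tendsto_sandwich[OF _ _ tendsto_const lim])
    show "\<forall>\<^sub>F r in at_top. norm (poly q (a * of_real r)) * exp (- (c * r))
        \<le> (\<Sum>i\<le>degree q. norm (coeff q i * a ^ i) * (r ^ i * exp (- (c * r))))"
      using eventually_ge_at_top[of 0]
    proof eventually_elim
      case (elim r)
      have "norm (poly q (a * of_real r)) \<le> (\<Sum>i\<le>degree q. norm (coeff q i * (a * of_real r) ^ i))"
        unfolding poly_altdef by (rule norm_sum)
      also have "\<dots> = (\<Sum>i\<le>degree q. norm (coeff q i * a ^ i) * r ^ i)"
        using elim by (simp add: norm_mult norm_power power_mult_distrib mult.assoc)
      finally have "norm (poly q (a * of_real r)) * exp (- (c * r))
          \<le> (\<Sum>i\<le>degree q. norm (coeff q i * a ^ i) * r ^ i) * exp (- (c * r))"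
        by (intro mult_right_mono) auto
      then show ?case by (simp only: sum_distrib_right mult.assoc)
    qed
  qed (auto intro: always_eventually)
qed

lemma poly_tendsto_0_on_line_imp_0:
  fixes p :: "complex poly"
  assumes "((\<lambda>x. poly p (a * of_real x)) \<longlongrightarrow> 0) at_top" "a \<noteq> 0"
  shows "p = 0"
proof -
  have lim: "((\<lambda>x. poly (pcompose p [:0, a:]) (of_real x)) \<longlongrightarrow> 0) at_top"
    using assms(1) by (simp add: poly_pcompose mult.commute)
  then have "degree (pcompose p [:0, a:]) = 0" by (rule poly_of_real_tendsto_imp_degree_0)
  then have "degree p = 0" using assms(2) by (simp add: degree_pcompose)
  then obtain d where "p = [:d:]" by (metis degree_eq_zeroE)
  then show ?thesis using lim by (simp add: pcompose_const tendsto_const_iff)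
qed

text \<open>
  The step: the difference of \<open>f\<close> with step \<open>h\<close> vanishes by induction, so \<open>f\<close> is periodic, and
  the decay along horizontal lines gives \<open>f = 0\<close>. In the base case a rational function decays
  exponentially.
\<close>

lemma difference_rational_exp_decay_imp_0:
  assumes eps: "\<epsilon> > 0" and "difference_rational hs f" "\<forall>h\<in>set hs. h > 0" "f \<in> O[ray_filter \<epsilon>](exp_decay c)" "c > 0"
    and "\<And>z. ((\<lambda>x. f (z + of_real x)) \<longlongrightarrow> 0) at_top"
  shows "\<exists>R. \<forall>z. Re z > R \<longrightarrow> f z = 0"
  using assms(2-)
proof (induction hs arbitrary: f)
  case Nil
  from Nil(1) obtain p q R where pq: "q \<noteq> 0" "\<And>z. Re z > R \<Longrightarrow> poly q z * f z = poly p z" by auto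
  define a where "a = Complex \<epsilon> 1"
  obtain K where K: "K > 0" "eventually (\<lambda>s. norm (f s) \<le> K * exp (- (c * Im s))) (ray_filter \<epsilon>)"
    using landau_o.bigE[OF Nil(3)] by (auto simp: norm_of_real)
  have "p = 0"
  proof (rule poly_tendsto_0_on_line_imp_0)
    have ev: "\<forall>\<^sub>F s in ray_filter \<epsilon>. norm (poly p s) \<le> K * (norm (poly q s) * exp (- (c * Im s)))"
      using K(2) eventually_Re_gt_ray_filter[OF eps, of R]
    proof eventually_elim
      case (elim s)
      have "norm (poly p s) = norm (poly q s) * norm (f s)"
        using pq(2)[OF elim(2)] by (metis norm_mult)
      also have "\<dots> \<le> norm (poly q s) * (K * exp (- (c * Im s)))"
        using elim(1) by (intro mult_left_mono) auto
      finally show ?case by (simp add: mult_ac)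
    qed
    have "\<forall>\<^sub>F r in at_top. norm (poly p (a * of_real r))
        \<le> K * (norm (poly q (a * of_real r)) * exp (- (c * r)))"
      using eventually_compose_filterlim[OF ev filterlim_ray] by (simp add: a_def)
    moreover have "((\<lambda>r. K * (norm (poly q (a * of_real r)) * exp (- (c * r)))) \<longlongrightarrow> 0) at_top"
      by (intro tendsto_mult_right_zero tendsto_poly_exp_decay_ray Nil)
    ultimately show "((\<lambda>r. poly p (a * of_real r)) \<longlongrightarrow> 0) at_top"
      by (rule Lim_null_comparison)
  qed (simp add: a_def complex_eq_iff)
  \<comment> \<open>Beyond the real parts of all zeros of \<open>q\<close>, the equation
    \<open>poly q z * f z = 0\<close> forces \<open>f z = 0\<close>.\<close>
  define X where "X = Max (insert R (Re ` {z. poly q z = 0}))"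
  have fin: "finite {z. poly q z = 0}" using pq(1) by (rule poly_roots_finite)
  have "f z = 0" if "Re z > X" for z
  proof -
    have "R \<le> X" "poly q z = 0 \<Longrightarrow> Re z \<le> X" unfolding X_def using fin by (auto intro!: Max_ge)
    then show ?thesis using pq(2)[of z] \<open>p = 0\<close> that by auto
  qed
  then show ?case by blast
next
  case (Cons h hs)
  define g where "g z = f (z + of_real h) - f z" for z
  have "\<exists>R. \<forall>z. Re z > R \<longrightarrow> g z = 0"
  proof (rule Cons.IH)
    show "difference_rational hs g" using Cons.prems(1) by (simp add: g_def[abs_def])
    show "g \<in> O[ray_filter \<epsilon>](exp_decay c)"
      unfolding g_def using Cons.prems(3) by (intro sum_in_bigo bigo_exp_decay_shift)
    fix z
    have "((\<lambda>x. f ((z + of_real h) + of_real x) - f (z + of_real x)) \<longlongrightarrow> 0 - 0) at_top"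
      by (intro tendsto_intros Cons.prems(5))
    then show "((\<lambda>x. g (z + of_real x)) \<longlongrightarrow> 0) at_top" by (simp add: g_def add_ac)
  qed (use Cons.prems in auto)
  then obtain R where R: "\<And>z. Re z > R \<Longrightarrow> f (z + of_real h) = f z" by (auto simp: g_def)
  have h: "h > 0" using Cons.prems(2) by simp
  have "f z = 0" if z: "Re z > R" for z
  proof -
    have per: "f (z + of_real (h * of_nat n)) = f z" for n
    proof (induction n)
      case (Suc n)
      have "0 \<le> h * real n" using h by simp
      then have "R < Re (z + of_real (h * of_nat n))" using z by simp
      from R[OF this] Suc show ?case by (simp add: algebra_simps)
    qed simp
    have "filterlim (\<lambda>n. h * real n) at_top sequentially"
      using h by (intro filterlim_tendsto_pos_mult_at_top[OF tendsto_const] filterlim_real_sequentially) auto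
    from filterlim_compose[OF Cons.prems(5)[of z] this]
    have "(\<lambda>n::nat. f z) \<longlonglongrightarrow> 0" unfolding per .
    then show ?thesis by (simp add: tendsto_const_iff LIMSEQ_const_iff)
  qed
  then show ?case by blast
qed

section \<open>Trigamma functions and logarithms of Gamma products\<close>

lemma norm_trigamma_le:
  assumes "Re z > 1"
  shows "norm (Polygamma 1 z) \<le> 1 / (Re z - 1)"
proof -
  define x where "x = Re z"
  have x: "x > 1" using assms by (simp add: x_def)
  have z0: "z \<noteq> 0" using assms by auto
  have s1: "(\<lambda>k. inverse ((z + of_nat k) ^ 2)) sums Polygamma 1 z"
    using Polygamma_LIMSEQ[OF z0, of 1] by (simp add: numeral_2_eq_2)
  have "filterlim (\<lambda>n. x - 1 + real n) at_top sequentially"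
    by (intro filterlim_tendsto_add_at_top[OF tendsto_const] filterlim_real_sequentially)
  then have "(\<lambda>n. inverse (x - 1 + real n)) \<longlonglongrightarrow> 0"
    by (rule tendsto_inverse_0_at_top)
  from telescope_sums'[OF this]
  have s2: "(\<lambda>k. inverse (x - 1 + real k) - inverse (x - 1 + real (Suc k))) sums (1 / (x - 1))"
    by (simp add: inverse_eq_divide)
  \<comment> \<open>Each term is compared with a telescoping one: \<open>norm (z + k)\<close> is at
    least \<open>y + 1\<close> with \<open>y = x - 1 + k\<close>, and
    \<open>1 / (y * (y + 1)) = 1 / y - 1 / (y + 1)\<close>.\<close>
  have le: "norm (inverse ((z + of_nat k) ^ 2)) \<le> inverse (x - 1 + real k) - inverse (x - 1 + real (Suc k))" for k
  proof -
    define y where "y = x - 1 + real k"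
    have y: "y > 0" using x by (simp add: y_def)
    have "y + 1 \<le> norm (z + of_nat k)"
      using complex_Re_le_cmod[of "z + of_nat k"] by (simp add: y_def x_def)
    then have "y * (y + 1) \<le> norm (z + of_nat k) * norm (z + of_nat k)"
      using y by (intro mult_mono) auto
    then have "norm (inverse ((z + of_nat k) ^ 2)) \<le> inverse (y * (y + 1))"
      using y unfolding norm_inverse norm_power power2_eq_square norm_mult
      by (intro le_imp_inverse_le) auto
    also have "\<dots> = inverse y - inverse (y + 1)" using y by (simp add: field_simps)
    also have "y + 1 = x - 1 + real (Suc k)" by (simp add: y_def)
    finally show ?thesis by (simp add: y_def)
  qed
  have sn: "summable (\<lambda>k. norm (inverse ((z + of_nat k) ^ 2)))"
    by (rule summable_comparison_test'[OF sums_summable[OF s2], of 0]) (use le in simp)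
  have "norm (Polygamma 1 z) = norm (\<Sum>k. inverse ((z + of_nat k) ^ 2))"
    using s1 by (simp add: sums_iff)
  also have "\<dots> \<le> (\<Sum>k. norm (inverse ((z + of_nat k) ^ 2)))" by (rule summable_norm[OF sn])
  also have "\<dots> \<le> (\<Sum>k. inverse (x - 1 + real k) - inverse (x - 1 + real (Suc k)))"
    by (rule suminf_le[OF le sn sums_summable[OF s2]])
  also have "\<dots> = 1 / (x - 1)" using s2 by (simp add: sums_iff)
  finally show ?thesis by (simp add: x_def)
qed

lemma tendsto_trigamma_horizontal:
  fixes z \<mu> :: complex
  assumes "l > 0"
  shows "((\<lambda>x. Polygamma 1 (of_real l * (z + of_real x) + \<mu>)) \<longlongrightarrow> 0) at_top"
proof -
  define b where "b = Re (of_real l * z + \<mu>)"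
  have lx: "filterlim (\<lambda>x. (b - 1) + l * x) at_top at_top"
    using assms by (intro filterlim_tendsto_add_at_top[OF tendsto_const]
        filterlim_tendsto_pos_mult_at_top[OF tendsto_const] filterlim_ident) auto
  have lim: "((\<lambda>x. inverse ((b - 1) + l * x)) \<longlongrightarrow> 0) at_top"
    by (rule tendsto_inverse_0_at_top[OF lx])
  have "\<forall>\<^sub>F x in at_top. 0 < (b - 1) + l * x"
    using lx by (simp add: filterlim_at_top_dense)
  then have "\<forall>\<^sub>F x in at_top. norm (Polygamma 1 (of_real l * (z + of_real x) + \<mu>)) \<le> inverse ((b - 1) + l * x)"
  proof eventually_elim
    case (elim x)
    have "Re (of_real l * (z + of_real x) + \<mu>) = b + l * x" by (simp add: b_def algebra_simps)
    then have "1 < Re (of_real l * (z + of_real x) + \<mu>)"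
      "Re (of_real l * (z + of_real x) + \<mu>) - 1 = (b - 1) + l * x" using elim by simp_all
    with norm_trigamma_le[OF this(1)] show ?case by (simp only: inverse_eq_divide)
  qed
  then show ?thesis by (rule Lim_null_comparison[OF _ lim])
qed

text \<open>The step \<open>1 / l\<close> moves the argument \<open>u = l * z + \<mu>\<close> by 1,
  where the recurrence of the trigamma function gives the difference
  \<open>- 1 / u ^ 2\<close>.\<close>

lemma difference_rational_trigamma:
  fixes \<mu> :: complex
  assumes "l > 0"
  shows "difference_rational [1 / l] (\<lambda>z. Polygamma 1 (of_real l * z + \<mu>))"
proof -
  define q where "q = [:\<mu>, of_real l:]"
  have "poly (q ^ 2) z * (Polygamma 1 (of_real l * (z + of_real (1 / l)) + \<mu>) - Polygamma 1 (of_real l * z + \<mu>))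
      = poly [:-1:] z" if "Re z > - Re \<mu> / l" for z
  proof -
    have "Re (of_real l * z + \<mu>) > 0" using that assms by (simp add: field_simps)
    then have nz: "of_real l * z + \<mu> \<noteq> 0" by (metis less_irrefl zero_complex.simps(1))
    define u where "u = of_real l * z + \<mu>"
    have "of_real l * (z + of_real (1 / l)) + \<mu> = u + 1"
      using assms by (simp add: u_def distrib_left flip: of_real_mult)
    moreover have "poly (q ^ 2) z = u ^ 2" by (simp add: q_def u_def poly_power algebra_simps)
    moreover have "u ^ 2 * (Polygamma 1 (u + 1) - Polygamma 1 u) = -1"
      using Polygamma_plus1[of u 1] nz by (simp add: u_def numeral_2_eq_2)
    ultimately show ?thesis unfolding u_def[symmetric] by simp
  qed
  moreover have "q ^ 2 \<noteq> 0" using assms by (simp add: q_def)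
  ultimately show ?thesis unfolding difference_rational.simps by blast
qed

text \<open>A triple \<open>(c, l, \<mu>)\<close> stands for a Gamma factor with exponent
  \<open>c\<close>. Taking logarithms makes powers and quotients linear in the list and permits
  differentiating twice; \<open>A + B * z\<close> collects constants and exponential factors such as
  those from \<open>\<omega>\<close>, \<open>Q\<close> and the reflection formula.\<close>

definition log_Gamma_product ::
    "complex \<Rightarrow> complex \<Rightarrow> (complex \<times> real \<times> complex) list \<Rightarrow> complex \<Rightarrow> complex" where
  "log_Gamma_product A B xs z = A + B * z + (\<Sum>(c, l, \<mu>)\<leftarrow>xs. c * ln_Gamma (of_real l * z + \<mu>))"

lemma has_field_derivative_sum_list:
  assumes "\<And>x. x \<in> set xs \<Longrightarrow> (f x has_field_derivative f' x) (at z)"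
  shows "((\<lambda>w. \<Sum>x\<leftarrow>xs. f x w) has_field_derivative (\<Sum>x\<leftarrow>xs. f' x)) (at z)"
  using assms by (induction xs) (auto intro!: derivative_intros)

lemma Re_linear_pos_eventually:
  fixes xs :: "(complex \<times> real \<times> complex) list"
  assumes "\<forall>(c, l, \<mu>)\<in>set xs. l > 0"
  obtains R where "\<And>c l \<mu> z. (c, l, \<mu>) \<in> set xs \<Longrightarrow> Re z > R \<Longrightarrow> Re (complex_of_real l * z + \<mu>) > 0"
proof -
  define R where "R = Max (insert 0 ((\<lambda>(c, l, \<mu>). - Re \<mu> / l) ` set xs))"
  have "Re (complex_of_real l * z + \<mu>) > 0" if "(c, l, \<mu>) \<in> set xs" "Re z > R" for c l \<mu> z
  proof -
    have "- Re \<mu> / l \<le> R" unfolding R_def using that(1) by (intro Max_ge) (auto simp: image_iff)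
    then have "- Re \<mu> / l < Re z" using that by simp
    moreover have "l > 0" using assms that by auto
    ultimately show ?thesis by (simp add: field_simps)
  qed
  then show ?thesis using that by blast
qed

lemma not_nonpos_if_Re_pos: "Re z > 0 \<Longrightarrow> z \<notin> \<real>\<^sub>\<le>\<^sub>0 \<and> z \<notin> \<int>\<^sub>\<le>\<^sub>0"
  by (auto simp: complex_nonpos_Reals_iff elim!: nonpos_Ints_cases)

text \<open>
  Two applications of Cauchy's inequality carry the decay of \<open>exp v - 1\<close> over to the second derivative
  of \<open>v\<close>, which is a combination of trigamma functions and therefore vanishes. So \<open>v\<close> is linear.
\<close>

lemma log_Gamma_product_rigidity:
  assumes l: "\<forall>(c, l, \<mu>)\<in>set xs. l > 0" and "\<epsilon> > 0" "c0 > 0"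
    and decay: "(\<lambda>z. exp (log_Gamma_product A B xs z) - 1) \<in> O[ray_filter \<epsilon>](exp_decay c0)"
  obtains R where "\<And>z. Re z > R \<Longrightarrow> exp (log_Gamma_product A B xs z) = 1"
proof -
  obtain R where R: "\<And>c l \<mu> z. (c, l, \<mu>) \<in> set xs \<Longrightarrow> Re z > R \<Longrightarrow> Re (of_real l * z + \<mu>) > 0"
    using Re_linear_pos_eventually[OF l] by blast
  define v where "v = log_Gamma_product A B xs"
  define v1 :: "complex \<Rightarrow> complex" where "v1 z = B + (\<Sum>(c, l, \<mu>)\<leftarrow>xs. c * of_real l * Digamma (of_real l * z + \<mu>))" for z
  define v2 :: "complex \<Rightarrow> complex" where "v2 z = (\<Sum>(c, l, \<mu>)\<leftarrow>xs. c * of_real (l ^ 2) * Polygamma 1 (of_real l * z + \<mu>))" for z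
  have dv: "(v has_field_derivative v1 z) (at z)" if z: "Re z > R" for z
  proof -
    have "((\<lambda>w. \<Sum>x\<leftarrow>xs. case x of (c, l, \<mu>) \<Rightarrow> c * ln_Gamma (of_real l * w + \<mu>)) has_field_derivative
        (\<Sum>x\<leftarrow>xs. case x of (c, l, \<mu>) \<Rightarrow> c * of_real l * Digamma (of_real l * z + \<mu>))) (at z)"
    proof (rule has_field_derivative_sum_list)
      fix x assume x: "x \<in> set xs"
      obtain c l \<mu> where [simp]: "x = (c, l, \<mu>)" by (cases x)
      have "of_real l * z + \<mu> \<notin> \<real>\<^sub>\<le>\<^sub>0" using R[of c l \<mu> z] x z not_nonpos_if_Re_pos by auto
      then show "((\<lambda>w. case x of (c, l, \<mu>) \<Rightarrow> c * ln_Gamma (of_real l * w + \<mu>)) has_field_derivative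
          (case x of (c, l, \<mu>) \<Rightarrow> c * of_real l * Digamma (of_real l * z + \<mu>))) (at z)"
        by (auto intro!: derivative_eq_intros simp: mult_ac)
    qed
    then show ?thesis unfolding v_def log_Gamma_product_def[abs_def] v1_def
      by (auto intro!: derivative_eq_intros)
  qed
  have dv1: "(v1 has_field_derivative v2 z) (at z)" if z: "Re z > R" for z
  proof -
    have "((\<lambda>w. \<Sum>x\<leftarrow>xs. case x of (c, l, \<mu>) \<Rightarrow> c * of_real l * Digamma (of_real l * w + \<mu>)) has_field_derivative
        (\<Sum>x\<leftarrow>xs. case x of (c, l, \<mu>) \<Rightarrow> c * of_real (l ^ 2) * Polygamma 1 (of_real l * z + \<mu>))) (at z)"
    proof (rule has_field_derivative_sum_list)
      fix x assume x: "x \<in> set xs"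
      obtain c l \<mu> where [simp]: "x = (c, l, \<mu>)" by (cases x)
      have "of_real l * z + \<mu> \<notin> \<int>\<^sub>\<le>\<^sub>0" using R[of c l \<mu> z] x z not_nonpos_if_Re_pos by auto
      then show "((\<lambda>w. case x of (c, l, \<mu>) \<Rightarrow> c * of_real l * Digamma (of_real l * w + \<mu>)) has_field_derivative
          (case x of (c, l, \<mu>) \<Rightarrow> c * of_real (l ^ 2) * Polygamma 1 (of_real l * z + \<mu>))) (at z)"
        by (auto intro!: derivative_eq_intros simp: mult_ac power2_eq_square)
    qed
    then show ?thesis unfolding v1_def[abs_def] v2_def
      by (auto intro!: derivative_eq_intros)
  qed
  define T where "T z = exp (v z)" for z
  have T: "(\<lambda>z. T z - 1) \<in> O[ray_filter \<epsilon>](exp_decay c0)"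
    using decay by (simp add: T_def[abs_def] v_def)
  have Tlim: "(T \<longlongrightarrow> 1) (ray_filter \<epsilon>)"
    using bigo_exp_decay_tendsto_0[OF T \<open>c0 > 0\<close>] by (simp add: LIM_zero_iff)
  have "(\<lambda>z. T z * v1 z) \<in> O[ray_filter \<epsilon>](exp_decay c0)"
    by (rule bigo_exp_decay_deriv[OF T \<open>\<epsilon> > 0\<close>, of R])
       (auto simp: T_def[abs_def] intro!: derivative_eq_intros dv)
  \<comment> \<open>The derivative of \<open>T\<close> is \<open>T * v1\<close>; as \<open>T\<close>
    tends to 1, dividing by it keeps the decay and isolates \<open>v1\<close>.\<close>
  moreover have "(\<lambda>z. inverse (T z)) \<in> O[ray_filter \<epsilon>](\<lambda>_. 1)"
  proof (rule bigoI_tendsto)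
    have "((\<lambda>z. inverse (T z)) \<longlongrightarrow> inverse 1) (ray_filter \<epsilon>)" by (intro tendsto_inverse Tlim) auto
    then show "((\<lambda>z. inverse (T z) / 1) \<longlongrightarrow> 1) (ray_filter \<epsilon>)" by simp
  qed auto
  ultimately have "(\<lambda>z. (T z * v1 z) * inverse (T z)) \<in> O[ray_filter \<epsilon>](\<lambda>z. exp_decay c0 z * 1)"
    by (rule landau_o.big.mult)
  moreover have "T z * v1 z * inverse (T z) = v1 z" for z
    by (simp add: T_def flip: divide_inverse)
  ultimately have "v1 \<in> O[ray_filter \<epsilon>](exp_decay c0)" by simp
  then have v2: "v2 \<in> O[ray_filter \<epsilon>](exp_decay c0)"
    by (rule bigo_exp_decay_deriv[OF _ \<open>\<epsilon> > 0\<close> dv1])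
  define hs where "hs = map (\<lambda>(c, l, \<mu>). 1 / l) xs"
  have "difference_rational hs v2"
  proof -
    have *: "difference_rational hs (\<lambda>z. (\<Sum>(c, l, \<mu>)\<leftarrow>ys. c * of_real (l ^ 2) * Polygamma 1 (of_real l * z + \<mu>)))"
      if "set ys \<subseteq> set xs" for ys using that
    proof (induction ys)
      case Nil
      have "difference_rational [] (\<lambda>z. 0)" 
        unfolding difference_rational.simps by (rule exI[of _ 0], rule exI[of _ 1]) simp
      then show ?case by (simp add: difference_rational_Nil_imp)
    next
      case (Cons y ys)
      obtain c l \<mu> where y: "y = (c, l, \<mu>)" by (cases y)
      have "l > 0" "1 / l \<in> set hs" using Cons.prems \<open>\<forall>(c, l, \<mu>)\<in>set xs. l > 0\<close> y
        by (auto simp: hs_def image_iff intro!: bexI[of _ "(c, l, \<mu>)"])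
      then have "difference_rational hs (\<lambda>z. (c * of_real (l ^ 2)) * Polygamma 1 (of_real l * z + \<mu>))"
        by (intro difference_rational_cmult difference_rational_member[OF difference_rational_trigamma])
      from difference_rational_add[OF this] Cons show ?case by (simp add: y)
    qed
    then show ?thesis unfolding v2_def[abs_def] by blast
  qed
  moreover have "\<forall>h\<in>set hs. h > 0" using l by (auto simp: hs_def)
  moreover have "((\<lambda>x. v2 (z + of_real x)) \<longlongrightarrow> 0) at_top" for z
    unfolding v2_def using l
  proof (induction xs)
    case (Cons y ys)
    obtain c l \<mu> where y: "y = (c, l, \<mu>)" by (cases y)
    have "((\<lambda>x. c * of_real (l ^ 2) * Polygamma 1 (of_real l * (z + of_real x) + \<mu>)
        + (\<Sum>(c, l, \<mu>)\<leftarrow>ys. c * of_real (l ^ 2) * Polygamma 1 (of_real l * (z + of_real x) + \<mu>)))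
        \<longlongrightarrow> c * of_real (l ^ 2) * 0 + 0) at_top"
      using Cons y by (intro tendsto_intros tendsto_trigamma_horizontal) auto
    then show ?case by (simp add: y)
  qed simp
  ultimately obtain R' where R': "\<And>z. Re z > R' \<Longrightarrow> v2 z = 0"
    using difference_rational_exp_decay_imp_0[OF \<open>\<epsilon> > 0\<close> _ _ v2 \<open>c0 > 0\<close>] by blast
  define H where "H = {z. Re z > max R R'}"
  have H: "convex H"
    unfolding H_def by (rule convex_halfspace_Re_gt)
  have "\<exists>k. \<forall>z\<in>H. v1 z = k"
  proof (rule has_field_derivative_zero_constant[OF H])
    fix z assume "z \<in> H"
    then show "(v1 has_field_derivative 0) (at z within H)"
      using dv1[of z] R'[of z] by (auto simp: H_def intro: has_field_derivative_at_within)
  qed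
  then obtain k where k: "\<And>z. z \<in> H \<Longrightarrow> v1 z = k" by blast
  have "\<exists>m. \<forall>z\<in>H. v z - k * z = m"
  proof (rule has_field_derivative_zero_constant[OF H])
    fix z assume z: "z \<in> H"
    then have "(v has_field_derivative k) (at z within H)"
      using dv[of z] k[OF z] by (auto simp: H_def intro: has_field_derivative_at_within)
    from DERIV_diff[OF this DERIV_cmult_Id, of k]
    show "((\<lambda>z. v z - k * z) has_field_derivative 0) (at z within H)" by simp
  qed
  then obtain m where "\<forall>z\<in>H. v z - k * z = m" by blast
  then have m: "v z = k * z + m" if "z \<in> H" for z using that by (metis add.commute diff_add_cancel)
  have evH: "\<forall>\<^sub>F z in ray_filter \<epsilon>. z \<in> H"
    unfolding H_def mem_Collect_eq by (rule eventually_Re_gt_ray_filter[OF \<open>\<epsilon> > 0\<close>])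
  \<comment> \<open>A linear \<open>v\<close> with \<open>exp v\<close> tending to 1 has slope 0: a
    shift by \<open>b\<close> multiplies \<open>T\<close> by \<open>exp (k * b)\<close> without
    changing the limit, and \<open>b = 1 / k\<close> or \<open>b = - 1 / k\<close>, whichever lies
    in the closed right half plane, would give \<open>exp 1 = 1\<close> or
    \<open>exp (- 1) = 1\<close>.\<close>
  have "exp (k * b) = 1" if b: "Re b \<ge> 0" for b
  proof -
    have "((\<lambda>z. T (z + b)) \<longlongrightarrow> 1) (ray_filter \<epsilon>)"
      using bigo_exp_decay_tendsto_0[OF bigo_exp_decay_shift[OF T] \<open>c0 > 0\<close>] by (simp add: LIM_zero_iff)
    moreover have "\<forall>\<^sub>F z in ray_filter \<epsilon>. T (z + b) = T z * exp (k * b)"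
      using evH
    proof eventually_elim
      case (elim z)
      then have "z + b \<in> H" using b by (simp add: H_def)
      then show ?case using m elim by (simp add: T_def algebra_simps exp_add)
    qed
    ultimately have "((\<lambda>z. T z * exp (k * b)) \<longlongrightarrow> 1) (ray_filter \<epsilon>)"
      by (rule Lim_transform_eventually)
    moreover have "((\<lambda>z. T z * exp (k * b)) \<longlongrightarrow> 1 * exp (k * b)) (ray_filter \<epsilon>)"
      by (intro tendsto_intros Tlim)
    ultimately show ?thesis using tendsto_unique[OF ray_filter_neq_bot] by fastforce
  qed
  note exp_k = this
  have "k = 0"
  proof (rule ccontr)
    assume "k \<noteq> 0"
    have "exp (1 :: complex) = 1 \<or> exp (- 1 :: complex) = 1"
      using exp_k[of "1 / k"] exp_k[of "- (1 / k)"] \<open>k \<noteq> 0\<close> by (cases "Re (1 / k) \<ge> 0") auto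
    then show False by (auto simp: exp_eq_1)
  qed
  have "\<forall>\<^sub>F z in ray_filter \<epsilon>. T z = exp m"
    using evH by eventually_elim (simp add: T_def m \<open>k = 0\<close>)
  from tendsto_unique[OF ray_filter_neq_bot tendsto_const Lim_transform_eventually[OF Tlim this]]
  have "exp m = 1" .
  then have "exp (v z) = 1" if "z \<in> H" for z using m[OF that] \<open>k = 0\<close> by simp
  then show ?thesis using that unfolding H_def v_def by blast
qed

subsection \<open>Growth and the functional equation\<close>

lemma norm_Gamma_series:
  "norm (Gamma_series z n) = fact n * exp (Re z * ln (real n)) / (\<Prod>i\<le>n. norm (z + of_nat i))"
proof -
  have "{0..<n + 1} = {..n}" by auto
  then show ?thesis
    by (simp add: Gamma_series_def norm_divide norm_mult pochhammer_prod flip: prod_norm)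
qed

text \<open>
  By Euler's limit, the modulus of Gamma on a vertical line relative to its value on the real axis is a
  product of factors \<open>(x + k) / \<bar>x + k + \<i> y\<bar>\<close>, each of which increases with \<open>x\<close>.
\<close>

lemma norm_Gamma_mono:
  assumes im: "Im w = Im z" and re: "3 / 2 \<le> Re w" "Re w \<le> Re z"
  shows "norm (Gamma w) \<le> norm (Gamma z)"
proof -
  define x y where "x = complex_of_real (Re w)" and "y = complex_of_real (Re z)"
  have ser: "norm (Gamma_series w n) * norm (Gamma_series y n) \<le> norm (Gamma_series z n) * norm (Gamma_series x n)" for n
  proof -
    define c where "c = (fact n * exp (Re w * ln (real n))) * (fact n * exp (Re z * ln (real n)))"
    have c: "c \<ge> 0" by (simp add: c_def)
    have factor: "norm (z + of_nat i) * norm (x + of_nat i) \<le> norm (w + of_nat i) * norm (y + of_nat i)" for i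
    proof -
      define p q where "p = Re w + real i" and "q = Re z + real i"
      have pq: "0 < p" "p \<le> q" using re by (auto simp: p_def q_def)
      have "p\<^sup>2 \<le> q\<^sup>2" using pq by (intro power_mono) auto
      then have "(q\<^sup>2 + (Im z)\<^sup>2) * p\<^sup>2 \<le> (p\<^sup>2 + (Im z)\<^sup>2) * q\<^sup>2"
        using mult_right_mono[of "p\<^sup>2" "q\<^sup>2" "(Im z)\<^sup>2"] by (simp add: algebra_simps)
      then have "sqrt ((q\<^sup>2 + (Im z)\<^sup>2) * p\<^sup>2) \<le> sqrt ((p\<^sup>2 + (Im z)\<^sup>2) * q\<^sup>2)" by simp
      then show ?thesis using im by (simp add: cmod_def real_sqrt_mult x_def y_def p_def q_def)
    qed
    have pos: "0 < (\<Prod>i\<le>n. norm (v + of_nat i))" if "Re v > 0" for v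
    proof (intro prod_pos ballI)
      fix i
      have "Re (v + of_nat i) > 0" using that by simp
      then show "0 < norm (v + of_nat i)" by (metis less_irrefl zero_complex.simps(1) zero_less_norm_iff)
    qed
    have "(\<Prod>i\<le>n. norm (z + of_nat i)) * (\<Prod>i\<le>n. norm (x + of_nat i))
        \<le> (\<Prod>i\<le>n. norm (w + of_nat i)) * (\<Prod>i\<le>n. norm (y + of_nat i))"
      unfolding prod.distrib[symmetric] by (intro prod_mono conjI factor) auto
    then have "c / ((\<Prod>i\<le>n. norm (w + of_nat i)) * (\<Prod>i\<le>n. norm (y + of_nat i)))
        \<le> c / ((\<Prod>i\<le>n. norm (z + of_nat i)) * (\<Prod>i\<le>n. norm (x + of_nat i)))"
      using pos re c by (intro divide_left_mono mult_pos_pos) (auto simp: x_def y_def)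
    then show ?thesis using re by (simp add: norm_Gamma_series c_def x_def y_def mult_ac)
  qed
  have "norm (Gamma w) * norm (Gamma y) \<le> norm (Gamma z) * norm (Gamma x)"
    by (rule LIMSEQ_le[OF tendsto_mult[OF tendsto_norm[OF Gamma_series_LIMSEQ] tendsto_norm[OF Gamma_series_LIMSEQ]]
          tendsto_mult[OF tendsto_norm[OF Gamma_series_LIMSEQ] tendsto_norm[OF Gamma_series_LIMSEQ]]])
       (use ser in auto)
  moreover have "norm (Gamma x) \<le> norm (Gamma y)"
  proof -
    \<comment> \<open>The bound \<open>3 / 2\<close> lies to the right of the minimum of Gamma on
      the positive axis, so Gamma increases from there on.\<close>
    have "Gamma (Re w) \<le> Gamma (Re z)"
      using Gamma_real_strict_mono[of "Re w" "Re z"] re by (cases "Re w = Re z") auto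
    then show ?thesis using re by (simp add: x_def y_def Gamma_complex_of_real)
  qed
  moreover have "norm (Gamma x) > 0" using re by (simp add: x_def Gamma_complex_of_real)
  ultimately have "norm (Gamma w) * norm (Gamma x) \<le> norm (Gamma z) * norm (Gamma x)"
    by (meson mult_left_mono norm_ge_zero order_trans)
  with \<open>norm (Gamma x) > 0\<close> show ?thesis by simp
qed

lemma not_nonpos_Ints_if_Im: "Im z \<noteq> 0 \<Longrightarrow> z \<notin> \<int>\<^sub>\<le>\<^sub>0"
  by (auto elim!: nonpos_Ints_cases)

text \<open>Here \<open>b\<close> may lie far to the left. Integer steps are handled by the
  recurrence, each factor \<open>b + i\<close> having modulus at least \<open>Im a\<close>; the
  remaining fractional step does not lower the modulus, by \<open>norm_Gamma_mono\<close>. Rounding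
  \<open>D\<close> down costs the 1 in the exponent, and the same loss turns
  \<open>Re a \<ge> 5 / 2\<close> into the \<open>3 / 2\<close> which that lemma demands.\<close>

lemma norm_Gamma_quotient_ge:
  assumes im: "Im a = Im b" "Im a \<ge> 1" and re: "Re a = Re b + D" "D \<ge> 0" "Re a \<ge> 5 / 2"
  shows "norm (Gamma a) \<ge> Im a powr (D - 1) * norm (Gamma b)"
proof -
  define n where "n = nat \<lfloor>D\<rfloor>"
  have n: "real n \<le> D" "D \<le> real n + 1" using re(2) by (simp_all add: n_def)
  have bnz: "b \<notin> \<int>\<^sub>\<le>\<^sub>0" using im by (intro not_nonpos_Ints_if_Im) auto
  have "Im a powr (D - 1) \<le> Im a powr real n" using im n by (intro powr_mono) auto
  also have "\<dots> = (\<Prod>i<n. Im a)" using im by (simp add: powr_realpow)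
  also have "\<dots> \<le> (\<Prod>i<n. norm (b + of_nat i))"
    using im abs_Im_le_cmod[of "b + of_nat i" for i] by (intro prod_mono) (fastforce simp: abs_le_iff)
  also have "\<dots> = norm (pochhammer b n)" by (simp add: pochhammer_prod atLeast0LessThan prod_norm)
  finally have "Im a powr (D - 1) * norm (Gamma b) \<le> norm (pochhammer b n) * norm (Gamma b)"
    by (intro mult_right_mono) auto
  also have "\<dots> = norm (Gamma (b + of_nat n))"
    using pochhammer_Gamma[OF bnz, of n] bnz by (simp add: Gamma_eq_zero_iff norm_divide)
  also have "\<dots> \<le> norm (Gamma a)" using im re n by (intro norm_Gamma_mono) auto
  finally show ?thesis .
qed

section \<open>The functional equation at large height\<close>

lemma completed_L_eq:
  assumes L: "L holomorphic_on -{1}" and Q: "Q > 0" and s: "s \<noteq> 1"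
    and im: "\<And>j. j \<in> {1..K} \<Longrightarrow> Im (of_real (lam j) * s + \<nu> j) \<noteq> 0"
  shows "completed_L L Q K lam \<nu> s = L s * of_real Q powr s * (\<Prod>j=1..K. Gamma (of_real (lam j) * s + \<nu> j))"
  unfolding completed_L_def
proof (rule remove_sings_at_analytic)
  have "L analytic_on {s}" using L s by (auto simp: analytic_at)
  moreover have "complex_of_real Q \<notin> \<real>\<^sub>\<le>\<^sub>0" using Q by simp
  moreover have "of_real (lam j) * s + \<nu> j \<notin> \<int>\<^sub>\<le>\<^sub>0" if "j \<in> {1..K}" for j
    using im[OF that] by (rule not_nonpos_Ints_if_Im)
  ultimately show "(\<lambda>s. L s * of_real Q powr s * (\<Prod>j=1..K. Gamma (of_real (lam j) * s + \<nu> j))) analytic_on {s}"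
    using Q by (intro analytic_intros) auto
qed

text \<open>The two conjugations keep this holomorphic in \<open>z\<close> and let \<open>z\<close>
  move to the upper right while \<open>L\<close> is evaluated far to the left.\<close>

definition reflected :: "(complex \<Rightarrow> complex) \<Rightarrow> complex \<Rightarrow> complex" where
  "reflected L z = cnj (L (1 - cnj z))"

lemma Im_linear_pos_eventually:
  fixes lam :: "nat \<Rightarrow> real"
  assumes "\<forall>j\<in>{1..K}. lam j > 0"
  obtains Y where "Y > 0" "\<And>j z. j \<in> {1..K} \<Longrightarrow> Im z > Y \<Longrightarrow> lam j * Im z + Im (\<nu> j) > B"
proof -
  define Y where "Y = Max (insert 1 ((\<lambda>j. (B - Im (\<nu> j)) / lam j) ` {1..K}))"
  have "lam j * Im z + Im (\<nu> j) > B" if "j \<in> {1..K}" "Im z > Y" for j z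
  proof -
    have "(B - Im (\<nu> j)) / lam j \<le> Y" unfolding Y_def using that(1) by (intro Max_ge) auto
    then have "(B - Im (\<nu> j)) / lam j < Im z" using that by simp
    moreover have "lam j > 0" using assms that by auto
    ultimately show ?thesis by (simp add: field_simps)
  qed
  moreover have "Y \<ge> 1" unfolding Y_def by (intro Max_ge) auto
  ultimately show ?thesis using that[of Y] by force
qed

text \<open>Above height \<open>Y\<close> every Gamma argument has non-zero imaginary part. So
  \<open>remove_sings\<close> changes nothing there, no Gamma factor vanishes, and the equation can
  be solved for the value on the left.\<close>

lemma functional_equation_reflected:
  assumes L: "L holomorphic_on -{1}"
    and fe: "functional_equation L Q K lam \<nu> \<omega>"
  obtains Y where "\<And>z. Im z > Y \<Longrightarrow> reflected L z = inverse \<omega> * of_real Q powr (2 * z - 1) * L z *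
    (\<Prod>j=1..K. Gamma (of_real (lam j) * z + \<nu> j) / Gamma (of_real (lam j) * (1 - z) + cnj (\<nu> j)))"
proof -
  have Q: "Q > 0" and lam: "\<forall>j\<in>{1..K}. lam j > 0" and \<omega>: "norm \<omega> = 1"
    and eq: "\<And>s. completed_L L Q K lam \<nu> s = \<omega> * cnj (completed_L L Q K lam \<nu> (1 - cnj s))"
    using fe unfolding functional_equation_def by blast+
  obtain Y where Y: "Y > 0" "\<And>j z. j \<in> {1..K} \<Longrightarrow> Im z > Y \<Longrightarrow> lam j * Im z + Im (\<nu> j) > 0"
    using Im_linear_pos_eventually[OF lam, where \<nu> = \<nu> and B = 0] by blast
  show ?thesis
  proof (rule that[of Y])
    fix z assume z: "Im z > Y"
    define w where "w = 1 - cnj z"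
    have w: "Im w = Im z" by (simp add: w_def)
    have ne: "z \<noteq> 1" "w \<noteq> 1" using z w Y(1) by auto
    define G where "G = (\<Prod>j=1..K. Gamma (of_real (lam j) * z + \<nu> j))"
    define G' where "G' = (\<Prod>j=1..K. Gamma (of_real (lam j) * (1 - z) + cnj (\<nu> j)))"
    have cz: "completed_L L Q K lam \<nu> z = L z * of_real Q powr z * G"
      unfolding G_def using Y(2) z by (intro completed_L_eq L Q ne) fastforce
    have cw: "completed_L L Q K lam \<nu> w = L w * of_real Q powr w * (\<Prod>j=1..K. Gamma (of_real (lam j) * w + \<nu> j))"
      using Y(2) z w by (intro completed_L_eq L Q ne) fastforce
    have "cnj (completed_L L Q K lam \<nu> w) = reflected L z * of_real Q powr (1 - z) * G'"
    proof -
      have "cnj (of_real Q powr w) = of_real Q powr (1 - z)"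
        using Q by (simp add: w_def powr_def Ln_of_real exp_cnj)
      moreover have "cnj (\<Prod>j=1..K. Gamma (of_real (lam j) * w + \<nu> j)) = G'"
        by (simp add: G'_def w_def cnj_Gamma)
      ultimately show ?thesis unfolding cw by (simp add: reflected_def w_def)
    qed
    then have main: "L z * of_real Q powr z * G = \<omega> * (reflected L z * of_real Q powr (1 - z) * G')"
      using eq[of z] cz by (simp add: w_def)
    have nz: "\<omega> \<noteq> 0" "of_real Q powr (1 - z) \<noteq> 0" using \<omega> Q by auto
    have "G' \<noteq> 0"
    proof -
      have "of_real (lam j) * (1 - z) + cnj (\<nu> j) \<notin> \<int>\<^sub>\<le>\<^sub>0" if "j \<in> {1..K}" for j
        using Y(2)[OF that z] by (intro not_nonpos_Ints_if_Im) auto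
      then show ?thesis by (simp add: G'_def Gamma_eq_zero_iff)
    qed
    have "of_real Q powr (2 * z - 1) = of_real Q powr z / of_real Q powr (1 - z)"
      by (simp flip: powr_diff)
    then have "inverse \<omega> * of_real Q powr (2 * z - 1) * L z * (G / G')
        = (L z * of_real Q powr z * G) / (\<omega> * of_real Q powr (1 - z) * G')"
      by (simp add: divide_inverse mult_ac)
    also have "\<dots> = reflected L z"
      unfolding main using nz \<open>G' \<noteq> 0\<close> by simp
    finally have "inverse \<omega> * of_real Q powr (2 * z - 1) * L z * (G / G') = reflected L z" .
    then show "reflected L z = inverse \<omega> * of_real Q powr (2 * z - 1) * L z *
        (\<Prod>j=1..K. Gamma (of_real (lam j) * z + \<nu> j) / Gamma (of_real (lam j) * (1 - z) + cnj (\<nu> j)))"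
      by (simp add: G_def G'_def prod_dividef)
  qed
qed

lemma eventually_Re_ge_Im_ray_filter:
  assumes "\<epsilon> > 0"
  shows "eventually (\<lambda>s. Re s \<ge> (\<epsilon> / 2) * Im s) (ray_filter \<epsilon>)"
  unfolding eventually_ray_filter
proof
  fix \<rho>
  have "(\<epsilon> / 2) * Im s \<le> Re s" if s: "2 * \<rho> / \<epsilon> \<le> Im s" "\<bar>Re s - \<epsilon> * Im s\<bar> \<le> \<rho>" for s
  proof -
    have "\<rho> \<le> (\<epsilon> / 2) * Im s" using s(1) assms by (simp add: field_simps)
    then show ?thesis using s(2) by (simp add: abs_le_iff)
  qed
  then show "\<exists>Y. \<forall>s. Y \<le> Im s \<longrightarrow> \<bar>Re s - \<epsilon> * Im s\<bar> \<le> \<rho> \<longrightarrow> (\<epsilon> / 2) * Im s \<le> Re s" by blast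
qed

text \<open>By \<open>norm_Gamma_quotient_ge\<close> every Gamma quotient is at least
  \<open>Im a\<close> to the power \<open>lam j * Re z\<close>, and the base tends to infinity; so,
  as soon as there is one factor, any rate \<open>c\<close> is exceeded.\<close>

lemma reflected_growth:
  assumes L: "L holomorphic_on -{1}"
    and fe: "functional_equation L Q K lam \<nu> \<omega>" and K: "K \<ge> 1"
    and lim: "(L \<longlongrightarrow> 1) (ray_filter \<epsilon>)" and \<epsilon>: "\<epsilon> > 0"
  shows "eventually (\<lambda>z. norm (reflected L z) \<ge> exp (c * Im z)) (ray_filter \<epsilon>)"
proof -
  have Q: "Q > 0" and lam: "\<forall>j\<in>{1..K}. lam j > 0" and \<omega>: "norm \<omega> = 1"
    using fe unfolding functional_equation_def by blast+
  obtain Y0 where Y0: "\<And>z. Im z > Y0 \<Longrightarrow> reflected L z = inverse \<omega> * of_real Q powr (2 * z - 1) * L z *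
    (\<Prod>j=1..K. Gamma (of_real (lam j) * z + \<nu> j) / Gamma (of_real (lam j) * (1 - z) + cnj (\<nu> j)))"
    using functional_equation_reflected[OF L fe] by blast
  define q where "q = \<bar>ln Q\<bar>"
  define \<kappa> where "\<kappa> = 2 * \<bar>c\<bar> / \<epsilon>"
  define l where "l = lam 1"
  have l: "l > 0" using lam K by (simp add: l_def)
  \<comment> \<open>In \<open>m * l = \<kappa> + 1 + 2 * q\<close> the term \<open>\<kappa>\<close>
    dominates \<open>c * Im z\<close> by means of \<open>Re z \<ge> (\<epsilon> / 2) * Im z\<close>,
    the 1 makes up for \<open>L z\<close>, of which only \<open>norm (L z) \<ge> 1 / 2\<close> is
    known, and \<open>2 * q\<close> for the factor \<open>Q powr (2 * z - 1)\<close>.\<close>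
  define m where "m = (\<kappa> + 1 + 2 * q) / l"
  have m: "m \<ge> 0" using l \<epsilon> by (simp add: m_def \<kappa>_def q_def)
  obtain Y where "Y > 0" and Y: "\<And>j z. j \<in> {1..K} \<Longrightarrow> Im z > Y \<Longrightarrow> lam j * Im z + Im (\<nu> j) > exp m"
    using Im_linear_pos_eventually[OF lam, where \<nu> = \<nu> and B = "exp m"] by blast
  \<comment> \<open>Chosen so that \<open>lam j * Re z\<close> is at least
    \<open>lam j + 1 + (5 / 2 + \<bar>Re (\<nu> j)\<bar>)\<close>: this yields both
    \<open>D - 1 \<ge> lam j * Re z\<close> and \<open>Re a \<ge> 5 / 2\<close>.\<close>
  define X where "X = Max (insert (1 + 1 / l) ((\<lambda>j. (1 + 1 / lam j) + (5 / 2 + \<bar>Re (\<nu> j)\<bar>) / lam j) ` {1..K}))"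
  have X1: "1 + 1 / l \<le> X" unfolding X_def by (intro Max_ge) auto
  have X: "(1 + 1 / lam j) + (5 / 2 + \<bar>Re (\<nu> j)\<bar>) / lam j \<le> X" if "j \<in> {1..K}" for j
    unfolding X_def using that by (intro Max_ge) auto
  have evL: "\<forall>\<^sub>F z in ray_filter \<epsilon>. dist (L z) 1 < 1 / 2" using lim by (rule tendstoD) simp
  show ?thesis
    using evL eventually_Re_gt_ray_filter[OF \<epsilon>, of "max X 1"] eventually_Im_gt_ray_filter[of "max (max Y0 Y) 0"]
      eventually_Re_ge_Im_ray_filter[OF \<epsilon>]
  proof eventually_elim
    case (elim z)
    have z: "Im z > Y0" "Im z > Y" "Im z > 0" "Re z > X" "Re z > 1" using elim by auto
    have fac: "norm (Gamma (of_real (lam j) * z + \<nu> j) / Gamma (of_real (lam j) * (1 - z) + cnj (\<nu> j)))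
        \<ge> exp m powr (lam j * Re z)" if j: "j \<in> {1..K}" for j
    proof -
      define a where "a = of_real (lam j) * z + \<nu> j"
      define b where "b = cnj (of_real (lam j) * (1 - z) + cnj (\<nu> j))"
      define D where "D = lam j * (2 * Re z - 1)"
      have lj: "lam j > 0" using lam j by auto
      have ima: "Im a > exp m" using Y[OF j z(2)] by (simp add: a_def)
      have im1: "Im a \<ge> 1" using ima m one_le_exp_iff[of m] by linarith
      have imb: "Im a = Im b" by (simp add: a_def b_def algebra_simps)
      have reb: "Re a = Re b + D" by (simp add: a_def b_def D_def algebra_simps)
      have zj: "(1 + 1 / lam j) + (5 / 2 + \<bar>Re (\<nu> j)\<bar>) / lam j \<le> Re z" using X[OF j] z by simp
      have "lam j * ((1 + 1 / lam j) + (5 / 2 + \<bar>Re (\<nu> j)\<bar>) / lam j) \<le> lam j * Re z"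
        using zj lj by (intro mult_left_mono) auto
      moreover have "lam j * ((1 + 1 / lam j) + (5 / 2 + \<bar>Re (\<nu> j)\<bar>) / lam j) = lam j + 1 + (5 / 2 + \<bar>Re (\<nu> j)\<bar>)"
        using lj by (simp add: field_simps)
      ultimately have big: "lam j + 1 + (5 / 2 + \<bar>Re (\<nu> j)\<bar>) \<le> lam j * Re z" by simp
      have "D = lam j * Re z + lam j * Re z - lam j" by (simp add: D_def algebra_simps)
      then have D0: "D - 1 \<ge> lam j * Re z" "D \<ge> 0"
        using big lj abs_ge_zero[of "Re (\<nu> j)"] by linarith+
      have "Re a = lam j * Re z + Re (\<nu> j)" by (simp add: a_def)
      then have rea: "Re a \<ge> 5 / 2" using big lj by linarith
      have "b \<notin> \<int>\<^sub>\<le>\<^sub>0" using im1 imb by (intro not_nonpos_Ints_if_Im) auto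
      then have Gb: "norm (Gamma b) > 0" by (simp add: Gamma_eq_zero_iff)
      have "exp m powr (lam j * Re z) \<le> Im a powr (lam j * Re z)"
        using ima lj z by (intro powr_mono2) auto
      also have "\<dots> \<le> Im a powr (D - 1)" using im1 D0 by (intro powr_mono) auto
      also have "\<dots> \<le> norm (Gamma a) / norm (Gamma b)"
        using norm_Gamma_quotient_ge[OF imb im1 reb D0(2) rea] Gb by (simp add: field_simps)
      also have "norm (Gamma b) = norm (Gamma (of_real (lam j) * (1 - z) + cnj (\<nu> j)))"
        unfolding b_def cnj_Gamma[symmetric] by simp
      finally show ?thesis by (simp add: norm_divide a_def)
    qed
    have "exp m powr (l * Re z) \<le> (\<Prod>j\<in>{1..K}. exp m powr (lam j * Re z))"
    proof -
      have "1 \<le> (\<Prod>j\<in>{1..K}-{1}. exp m powr (lam j * Re z))"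
        using m lam z by (intro prod_ge_1) (auto intro!: ge_one_powr_ge_zero mult_nonneg_nonneg simp: less_imp_le)
      then show ?thesis
        using K by (subst prod.remove[of _ 1]) (auto simp: l_def)
    qed
    also have "\<dots> \<le> (\<Prod>j\<in>{1..K}. norm (Gamma (of_real (lam j) * z + \<nu> j) / Gamma (of_real (lam j) * (1 - z) + cnj (\<nu> j))))"
      using fac by (intro prod_mono) auto
    finally have G: "exp (m * (l * Re z)) \<le> norm (\<Prod>j=1..K. Gamma (of_real (lam j) * z + \<nu> j) / Gamma (of_real (lam j) * (1 - z) + cnj (\<nu> j)))"
      unfolding prod_norm by (simp add: powr_def mult_ac)
    have Qn: "exp (- (2 * q * Re z)) \<le> norm (of_real Q powr (2 * z - 1))"
    proof -
      have "- (2 * q * Re z) \<le> (2 * Re z - 1) * ln Q"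
      proof -
        have "- q * (2 * Re z) \<le> - q * (2 * Re z - 1)" by (simp add: q_def algebra_simps)
        also have "\<dots> \<le> ln Q * (2 * Re z - 1)" using z by (intro mult_right_mono) (auto simp: q_def)
        finally show ?thesis by (simp add: mult_ac)
      qed
      moreover have "norm (of_real Q powr (2 * z - 1)) = exp ((2 * Re z - 1) * ln Q)"
        using Q by (subst norm_powr_real) auto
      ultimately show ?thesis by simp
    qed
    have Ln: "1 / 2 \<le> norm (L z)"
      using elim(1) norm_triangle_ineq2[of 1 "1 - L z"] by (simp add: dist_norm norm_minus_commute)
    have "c * Im z \<le> \<kappa> * Re z"
    proof -
      have "c * Im z \<le> \<bar>c\<bar> * Im z" using z by (intro mult_right_mono) auto
      also have "\<dots> = \<kappa> * ((\<epsilon> / 2) * Im z)" using \<epsilon> by (simp add: \<kappa>_def)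
      also have "\<dots> \<le> \<kappa> * Re z" using elim(4) \<epsilon> by (intro mult_left_mono) (auto simp: \<kappa>_def)
      finally show ?thesis .
    qed
    moreover have "m * (l * Re z) = \<kappa> * Re z + Re z + 2 * q * Re z"
      using l by (simp add: m_def field_simps)
    ultimately have "exp (c * Im z) \<le> exp (- (2 * q * Re z)) * exp (- Re z) * exp (m * (l * Re z))"
      by (simp flip: exp_add)
    also have "exp (- Re z) \<le> 1 / 2"
    proof -
      have "2 \<le> exp (1::real)" using exp_ge_add_one_self[of "1::real"] by simp
      also have "\<dots> \<le> exp (Re z)" using z by simp
      finally show ?thesis by (simp add: exp_minus field_simps)
    qed
    also have "exp (- (2 * q * Re z)) * (1 / 2) * exp (m * (l * Re z))
      \<le> norm (of_real Q powr (2 * z - 1)) * norm (L z) *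
        norm (\<Prod>j=1..K. Gamma (of_real (lam j) * z + \<nu> j) / Gamma (of_real (lam j) * (1 - z) + cnj (\<nu> j)))"
      using Qn Ln G by (intro mult_mono) auto
    also have "\<dots> = norm (reflected L z)"
      unfolding Y0[OF z(1)] using \<omega> by (simp add: norm_mult norm_inverse)
    finally show ?case by simp
  qed
qed

lemma log_Gamma_product_append:
  "log_Gamma_product A B xs z + log_Gamma_product A' B' ys z = log_Gamma_product (A + A') (B + B') (xs @ ys) z"
  by (simp add: log_Gamma_product_def algebra_simps)

lemma log_Gamma_product_scale:
  "k * log_Gamma_product A B xs z = log_Gamma_product (k * A) (k * B) (map (\<lambda>(c, l, \<mu>). (k * c, l, \<mu>)) xs) z"
proof -
  have "k * (\<Sum>(c, l, \<mu>)\<leftarrow>xs. c * ln_Gamma (of_real l * z + \<mu>)) =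
      (\<Sum>(c, l, \<mu>)\<leftarrow>map (\<lambda>(c, l, \<mu>). (k * c, l, \<mu>)) xs. c * ln_Gamma (of_real l * z + \<mu>))"
    by (induction xs) (auto simp: algebra_simps)
  then show ?thesis by (simp only: log_Gamma_product_def distrib_left mult.assoc)
qed

definition oscillation :: "real \<Rightarrow> complex \<Rightarrow> complex \<Rightarrow> complex" where
  "oscillation l \<nu> z = 1 - exp (- (2 * of_real pi * \<i> * (of_real l * (1 - z) + cnj \<nu>)))"

text \<open>
  The reflection formula turns \<open>1 / Gamma u\<close> with \<open>u = l * (1 - z) + cnj \<nu>\<close> into
  \<open>Gamma (1 - u) * sin (pi * u) / pi\<close>, and in the upper half plane the sine is
  \<open>exp (\<i> * pi * u) / (2 * \<i>)\<close> up to the factor \<open>oscillation\<close>.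
\<close>

lemma Gamma_quotient_eq_exp:
  assumes re: "Re (of_real l * z + \<nu>) > 0" "Re (of_real l * z + (1 - of_real l - cnj \<nu>)) > 0"
    and im: "l * Im z + Im \<nu> > 0"
  shows "Gamma (of_real l * z + \<nu>) / Gamma (of_real l * (1 - z) + cnj \<nu>) =
    exp (log_Gamma_product (\<i> * of_real pi * (of_real l + cnj \<nu>) + Ln (1 / (2 * of_real pi * \<i>))) (- (\<i> * of_real pi * of_real l))
      [(1, l, \<nu>), (1, l, 1 - of_real l - cnj \<nu>)] z) * oscillation l \<nu> z"
proof -
  define u where "u = of_real l * (1 - z) + cnj \<nu>"
  define a where "a = of_real l * z + \<nu>"
  have u1: "of_real l * z + (1 - of_real l - cnj \<nu>) = 1 - u" by (simp add: u_def algebra_simps)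
  have "Im u < 0" using im by (simp add: u_def algebra_simps)
  then have unz: "u \<notin> \<int>\<^sub>\<le>\<^sub>0" by (intro not_nonpos_Ints_if_Im) auto
  have pos: "a \<notin> \<int>\<^sub>\<le>\<^sub>0" "1 - u \<notin> \<int>\<^sub>\<le>\<^sub>0"
    using re not_nonpos_if_Re_pos unfolding u1 a_def by auto
  have G: "Gamma a = exp (ln_Gamma a)" "Gamma (1 - u) = exp (ln_Gamma (1 - u))"
    using pos by (auto simp: Gamma_complex_altdef)
  have Gu: "Gamma u \<noteq> 0" "Gamma (1 - u) \<noteq> 0" using unz pos by (auto simp: Gamma_eq_zero_iff)
  have refl: "Gamma u * Gamma (1 - u) = of_real pi / sin (of_real pi * u)" by (rule Gamma_reflection_complex)
  then have "sin (of_real pi * u) \<noteq> 0" using Gu by auto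
  then have inv: "1 / Gamma u = Gamma (1 - u) * sin (of_real pi * u) / of_real pi"
    using refl Gu by (simp add: field_simps)
  have osc: "exp (\<i> * of_real pi * u) * oscillation l \<nu> z = exp (\<i> * of_real pi * u) - exp (- (\<i> * of_real pi * u))"
  proof -
    have "oscillation l \<nu> z = 1 - exp (- (2 * of_real pi * \<i> * u))" by (simp only: oscillation_def u_def)
    moreover have "\<i> * of_real pi * u + - (2 * of_real pi * \<i> * u) = - (\<i> * of_real pi * u)" by simp
    ultimately show ?thesis by (simp only: right_diff_distrib exp_add[symmetric] mult_1_right)
  qed
  have "sin (of_real pi * u) / of_real pi = (1 / (2 * of_real pi * \<i>)) * (exp (\<i> * of_real pi * u) * oscillation l \<nu> z)"
    unfolding osc by (simp add: sin_exp_eq mult.assoc field_simps)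
  then have "Gamma (1 - u) * sin (of_real pi * u) / of_real pi =
      Gamma (1 - u) * ((1 / (2 * of_real pi * \<i>)) * (exp (\<i> * of_real pi * u) * oscillation l \<nu> z))"
    by (metis times_divide_eq_right)
  then have "Gamma a * (1 / Gamma u) = Gamma a * (Gamma (1 - u) *
      ((1 / (2 * of_real pi * \<i>)) * (exp (\<i> * of_real pi * u) * oscillation l \<nu> z)))"
    unfolding inv by simp
  then have "Gamma a / Gamma u = (1 / (2 * of_real pi * \<i>)) * exp (\<i> * of_real pi * u) * Gamma a * Gamma (1 - u) * oscillation l \<nu> z"
    unfolding times_divide_eq_right mult_1_right by (simp only: mult_ac)
  also have "1 / (2 * of_real pi * \<i>) = exp (Ln (1 / (2 * of_real pi * \<i>)))" by (simp add: exp_Ln)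
  finally have "Gamma a / Gamma u = exp ((Ln (1 / (2 * of_real pi * \<i>)) + \<i> * of_real pi * u)
      + (ln_Gamma a + ln_Gamma (1 - u))) * oscillation l \<nu> z"
    unfolding G exp_add by (simp only: mult.assoc)
  also have "Ln (1 / (2 * of_real pi * \<i>)) + \<i> * of_real pi * u
      = \<i> * of_real pi * (of_real l + cnj \<nu>) + Ln (1 / (2 * of_real pi * \<i>)) + (- (\<i> * of_real pi * of_real l)) * z"
    by (simp add: u_def algebra_simps)
  also have "ln_Gamma a + ln_Gamma (1 - u)
      = (\<Sum>(c, k, \<mu>)\<leftarrow>[(1, l, \<nu>), (1, l, 1 - of_real l - cnj \<nu>)]. c * ln_Gamma (of_real k * z + \<mu>))"
    by (simp add: a_def flip: u1)
  finally show ?thesis unfolding a_def u_def log_Gamma_product_def .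
qed

lemma Gamma_quotient_product_eq_exp:
  fixes lam :: "nat \<Rightarrow> real"
  assumes "\<forall>j\<in>{1..K}. lam j > 0"
  shows "\<exists>A B xs R Y. (\<forall>(c, l, \<mu>)\<in>set xs. l > 0) \<and> (\<forall>z. Re z > R \<longrightarrow> Im z > Y \<longrightarrow>
    (\<Prod>j=1..K. Gamma (of_real (lam j) * z + \<nu> j) / Gamma (of_real (lam j) * (1 - z) + cnj (\<nu> j)))
      = exp (log_Gamma_product A B xs z) * (\<Prod>j=1..K. oscillation (lam j) (\<nu> j) z))"
  using assms
proof (induction K)
  case 0
  show ?case
    by (rule exI[of _ 0], rule exI[of _ 0], rule exI[of _ "[]"]) (simp add: log_Gamma_product_def)
next
  case (Suc K)
  have "\<forall>j\<in>{1..K}. lam j > 0" using Suc.prems by auto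
  from Suc.IH[OF this] obtain A B xs R Y where IH: "\<forall>(c, l, \<mu>)\<in>set xs. l > 0"
    "\<And>z. Re z > R \<Longrightarrow> Im z > Y \<Longrightarrow>
    (\<Prod>j=1..K. Gamma (of_real (lam j) * z + \<nu> j) / Gamma (of_real (lam j) * (1 - z) + cnj (\<nu> j)))
      = exp (log_Gamma_product A B xs z) * (\<Prod>j=1..K. oscillation (lam j) (\<nu> j) z)"
    by blast
  define l m where "l = lam (Suc K)" and "m = \<nu> (Suc K)"
  have l: "l > 0" using Suc.prems by (simp add: l_def)
  define ys :: "(complex \<times> real \<times> complex) list" where "ys = [(1, l, m), (1, l, 1 - of_real l - cnj m)]"
  define A' where "A' = \<i> * of_real pi * (of_real l + cnj m) + Ln (1 / (2 * of_real pi * \<i>))"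
  define B' where "B' = - (\<i> * of_real pi * of_real l)"
  obtain R' where R': "\<And>c l \<mu> z. (c, l, \<mu>) \<in> set ys \<Longrightarrow> Re z > R' \<Longrightarrow> Re (complex_of_real l * z + \<mu>) > 0"
    using Re_linear_pos_eventually[of ys] l by (auto simp: ys_def)
  show ?case
  proof (rule exI[of _ "A + A'"], rule exI[of _ "B + B'"], rule exI[of _ "xs @ ys"],
      rule exI[of _ "max R R'"], rule exI[of _ "max Y (- Im m / l)"], intro conjI allI impI)
    show "\<forall>(c, l, \<mu>)\<in>set (xs @ ys). l > 0" using IH(1) l by (auto simp: ys_def)
    fix z assume z: "Re z > max R R'" "Im z > max Y (- Im m / l)"
    have "l * Im z + Im m > 0" using z l by (simp add: field_simps)
    moreover have "Re (of_real l * z + m) > 0" "Re (of_real l * z + (1 - of_real l - cnj m)) > 0"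
      using R'[of 1 l m z] R'[of 1 l "1 - of_real l - cnj m" z] z by (auto simp: ys_def)
    ultimately have "Gamma (of_real l * z + m) / Gamma (of_real l * (1 - z) + cnj m) =
        exp (log_Gamma_product A' B' ys z) * oscillation l m z"
      unfolding A'_def B'_def ys_def by (intro Gamma_quotient_eq_exp)
    then show "(\<Prod>j=1..Suc K. Gamma (of_real (lam j) * z + \<nu> j) / Gamma (of_real (lam j) * (1 - z) + cnj (\<nu> j)))
      = exp (log_Gamma_product (A + A') (B + B') (xs @ ys) z) * (\<Prod>j=1..Suc K. oscillation (lam j) (\<nu> j) z)"
      using IH(2)[of z] z
      by (simp add: exp_add l_def m_def flip: log_Gamma_product_append)
  qed
qed

lemma reflected_eq_exp:
  assumes L: "L holomorphic_on -{1}"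
    and fe: "functional_equation L Q K lam \<nu> \<omega>" and \<epsilon>: "\<epsilon> > 0"
  obtains A B xs where "\<forall>(c, l, \<mu>)\<in>set xs. l > 0"
    "eventually (\<lambda>z. reflected L z = L z * exp (log_Gamma_product A B xs z) * (\<Prod>j=1..K. oscillation (lam j) (\<nu> j) z))
      (ray_filter \<epsilon>)"
proof -
  have Q: "Q > 0" and lam: "\<forall>j\<in>{1..K}. lam j > 0" and \<omega>: "norm \<omega> = 1"
    using fe unfolding functional_equation_def by blast+
  obtain Y0 where Y0: "\<And>z. Im z > Y0 \<Longrightarrow> reflected L z = inverse \<omega> * of_real Q powr (2 * z - 1) * L z *
    (\<Prod>j=1..K. Gamma (of_real (lam j) * z + \<nu> j) / Gamma (of_real (lam j) * (1 - z) + cnj (\<nu> j)))"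
    using functional_equation_reflected[OF L fe] by blast
  obtain A B xs R Y where AB: "\<forall>(c, l, \<mu>)\<in>set xs. l > 0" "\<And>z. Re z > R \<Longrightarrow> Im z > Y \<Longrightarrow>
    (\<Prod>j=1..K. Gamma (of_real (lam j) * z + \<nu> j) / Gamma (of_real (lam j) * (1 - z) + cnj (\<nu> j)))
      = exp (log_Gamma_product A B xs z) * (\<Prod>j=1..K. oscillation (lam j) (\<nu> j) z)"
    using Gamma_quotient_product_eq_exp[OF lam] by meson
  \<comment> \<open>The factor \<open>inverse \<omega> * Q powr (2 * z - 1)\<close> is itself the
    exponential of a linear function and is absorbed into \<open>A\<close> and
    \<open>B\<close>.\<close>
  define lq where "lq = complex_of_real (ln Q)"
  have \<omega>0: "\<omega> \<noteq> 0" using \<omega> by auto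
  show ?thesis
  proof (rule that[OF AB(1), of "Ln (inverse \<omega>) - lq + A" "2 * lq + B"])
    show "eventually (\<lambda>z. reflected L z = L z * exp (log_Gamma_product (Ln (inverse \<omega>) - lq + A) (2 * lq + B) xs z)
        * (\<Prod>j=1..K. oscillation (lam j) (\<nu> j) z)) (ray_filter \<epsilon>)"
      using eventually_Re_gt_ray_filter[OF \<epsilon>, of R] eventually_Im_gt_ray_filter[of "max Y0 Y"]
    proof eventually_elim
      case (elim z)
      have "log_Gamma_product (Ln (inverse \<omega>) - lq + A) (2 * lq + B) xs z
          = (Ln (inverse \<omega>) + (2 * z - 1) * lq) + log_Gamma_product A B xs z"
        by (simp add: log_Gamma_product_def algebra_simps)
      then have "exp (log_Gamma_product (Ln (inverse \<omega>) - lq + A) (2 * lq + B) xs z)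
          = inverse \<omega> * of_real Q powr (2 * z - 1) * exp (log_Gamma_product A B xs z)"
        using Q \<omega>0 by (simp add: exp_add exp_Ln powr_def lq_def Ln_of_real)
      then show ?case using Y0[of z] AB(2)[of z] elim by (simp add: mult_ac)
    qed
  qed
qed

section \<open>Functions equal to 1 up to an exponentially small error\<close>

abbreviation near_one :: "real \<Rightarrow> real \<Rightarrow> (complex \<Rightarrow> complex) \<Rightarrow> bool" where
  "near_one \<epsilon> c f \<equiv> (\<lambda>z. f z - 1) \<in> O[ray_filter \<epsilon>](exp_decay c)"

lemma exp_decay_mono:
  assumes "c \<le> c'"
  shows "exp_decay c' \<in> O[ray_filter \<epsilon>](exp_decay c)"
proof (rule bigoI[of _ 1])
  show "\<forall>\<^sub>F z in ray_filter \<epsilon>. norm (exp_decay c' z) \<le> 1 * norm (exp_decay c z)"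
    using eventually_Im_gt_ray_filter[of 0]
    by eventually_elim (use assms in \<open>simp add: mult_right_mono\<close>)
qed

lemma near_one_mono: "near_one \<epsilon> c' f \<Longrightarrow> c \<le> c' \<Longrightarrow> near_one \<epsilon> c f"
  by (rule landau_o.big_trans[OF _ exp_decay_mono])

lemma near_one_cong:
  assumes "near_one \<epsilon> c f" "\<forall>\<^sub>F z in ray_filter \<epsilon>. f z = g z"
  shows "near_one \<epsilon> c g"
proof -
  have "\<forall>\<^sub>F z in ray_filter \<epsilon>. f z - 1 = g z - 1"
    using assms(2) by eventually_elim simp
  from landau_o.big.in_cong[OF this] assms(1) show ?thesis by (rule iffD1)
qed

lemma near_one_tendsto: "near_one \<epsilon> c f \<Longrightarrow> c > 0 \<Longrightarrow> (f \<longlongrightarrow> 1) (ray_filter \<epsilon>)"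
  using bigo_exp_decay_tendsto_0[of "\<lambda>z. f z - 1" \<epsilon> c] by (simp add: LIM_zero_iff)

lemma tendsto_imp_bigo_1:
  fixes f :: "complex \<Rightarrow> complex"
  assumes "(f \<longlongrightarrow> l) F"
  shows "f \<in> O[F](\<lambda>_. 1)"
  by (rule bigoI_tendsto[of _ _ l]) (use assms in auto)

lemma near_one_mult:
  assumes "near_one \<epsilon> c f" "near_one \<epsilon> c g" "c > 0"
  shows "near_one \<epsilon> c (\<lambda>z. f z * g z)"
proof -
  have "(\<lambda>z. (f z - 1) * g z) \<in> O[ray_filter \<epsilon>](\<lambda>z. exp_decay c z * 1)"
    by (intro landau_o.big.mult assms tendsto_imp_bigo_1[OF near_one_tendsto[OF assms(2,3)]])
  then have "(\<lambda>z. (f z - 1) * g z) \<in> O[ray_filter \<epsilon>](exp_decay c)" by simp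
  from sum_in_bigo(1)[OF this assms(2)]
  show ?thesis by (simp add: algebra_simps)
qed

lemma near_one_prod:
  assumes "\<And>i. i \<in> I \<Longrightarrow> near_one \<epsilon> c (f i)" "c > 0"
  shows "near_one \<epsilon> c (\<lambda>z. \<Prod>i\<in>I. f i z)"
  using assms(1)
  by (induction I rule: infinite_finite_induct) (simp_all add: near_one_mult assms(2))

lemma near_one_power: "near_one \<epsilon> c f \<Longrightarrow> c > 0 \<Longrightarrow> near_one \<epsilon> c (\<lambda>z. f z ^ n)"
  by (induction n) (simp_all add: near_one_mult)

lemma near_one_divide:
  assumes "near_one \<epsilon> c f" "near_one \<epsilon> c g" "c > 0"
  shows "near_one \<epsilon> c (\<lambda>z. f z / g z)"
proof -
  have lim: "(g \<longlongrightarrow> 1) (ray_filter \<epsilon>)" by (rule near_one_tendsto[OF assms(2,3)])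
  then have "((\<lambda>z. inverse (g z)) \<longlongrightarrow> inverse 1) (ray_filter \<epsilon>)" by (intro tendsto_inverse) auto
  then have "(\<lambda>z. ((f z - 1) - (g z - 1)) * inverse (g z)) \<in> O[ray_filter \<epsilon>](\<lambda>z. exp_decay c z * 1)"
    using landau_o.big.mult[OF sum_in_bigo(2)[OF assms(1,2)] tendsto_imp_bigo_1] by blast
  then have *: "(\<lambda>z. ((f z - 1) - (g z - 1)) * inverse (g z)) \<in> O[ray_filter \<epsilon>](exp_decay c)"
    by (simp only: mult_1_right)
  have "\<forall>\<^sub>F z in ray_filter \<epsilon>. ((f z - 1) - (g z - 1)) * inverse (g z) = f z / g z - 1"
    using tendsto_imp_eventually_ne[OF lim, of 0] by (auto elim!: eventually_mono simp: field_simps)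
  from landau_o.big.in_cong[OF this] * show ?thesis by (rule iffD1)
qed

text \<open>The exponential in \<open>oscillation\<close> has modulus
  \<open>exp (- 2 * pi * (l * Im z + Im \<nu>))\<close>, whatever \<open>Re z\<close> is. This is
  the source of a rate that does not depend on \<open>\<epsilon>\<close>.\<close>

lemma near_one_oscillation:
  assumes "c \<le> 2 * pi * l"
  shows "near_one \<epsilon> c (oscillation l \<nu>)"
proof (rule bigoI[of _ "exp (- (2 * pi * Im \<nu>))"])
  show "\<forall>\<^sub>F z in ray_filter \<epsilon>. norm (oscillation l \<nu> z - 1) \<le> exp (- (2 * pi * Im \<nu>)) * norm (exp_decay c z)"
    using eventually_Im_gt_ray_filter[of 0]
  proof eventually_elim
    case (elim z)
    have "norm (oscillation l \<nu> z - 1) = exp (- (2 * pi * Im \<nu>) - (2 * pi * l) * Im z)"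
      by (simp add: oscillation_def algebra_simps)
    also have "\<dots> \<le> exp (- (2 * pi * Im \<nu>) - c * Im z)"
      using assms elim by (simp add: mult_right_mono)
    also have "\<dots> = exp (- (2 * pi * Im \<nu>)) * exp (- (c * Im z))" by (simp flip: exp_add)
    finally show ?case by simp
  qed
qed

text \<open>\<open>f ^ n - 1\<close> is \<open>f - 1\<close> times a sum of powers that tends to
  \<open>n\<close>. The limit of \<open>f\<close> has to be known beforehand, to exclude other roots
  of unity.\<close>

lemma near_one_root:
  assumes "near_one \<epsilon> c (\<lambda>z. f z ^ n)" "(f \<longlongrightarrow> 1) (ray_filter \<epsilon>)" "n \<ge> 1"
  shows "near_one \<epsilon> c f"
proof -
  define g where "g z = (\<Sum>i<n. f z ^ i)" for z
  have "(g \<longlongrightarrow> (\<Sum>i<n. 1 ^ i)) (ray_filter \<epsilon>)" unfolding g_def by (intro tendsto_intros assms)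
  then have lim: "(g \<longlongrightarrow> of_nat n) (ray_filter \<epsilon>)" by simp
  then have "((\<lambda>z. inverse (g z)) \<longlongrightarrow> inverse (of_nat n)) (ray_filter \<epsilon>)"
    using assms(3) by (intro tendsto_inverse) auto
  then have "(\<lambda>z. (f z ^ n - 1) * inverse (g z)) \<in> O[ray_filter \<epsilon>](\<lambda>z. exp_decay c z * 1)"
    using assms by (intro landau_o.big.mult tendsto_imp_bigo_1) auto
  then have *: "(\<lambda>z. (f z ^ n - 1) * inverse (g z)) \<in> O[ray_filter \<epsilon>](exp_decay c)"
    by (simp only: mult_1_right)
  have "\<forall>\<^sub>F z in ray_filter \<epsilon>. (f z ^ n - 1) * inverse (g z) = f z - 1"
  proof -
    have "\<forall>\<^sub>F z in ray_filter \<epsilon>. g z \<noteq> 0" using assms(3) by (intro tendsto_imp_eventually_ne[OF lim]) auto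
    then show ?thesis
      by eventually_elim (simp add: power_diff_1_eq g_def field_simps)
  qed
  from landau_o.big.in_cong[OF this] * show ?thesis by (rule iffD1)
qed

text \<open>By the choice operator, \<open>selberg_degree\<close> is the value of some actual
  functional equation; for that equation a positive value excludes an empty Gamma product.\<close>

lemma positive_degree_functional_equation:
  assumes "L \<in> extended_selberg_class" "selberg_degree L > 0"
  obtains Q K lam \<nu> \<omega> where "functional_equation L Q K lam \<nu> \<omega>" "K \<ge> 1"
proof -
  let ?P = "\<lambda>d. \<exists>Q K lam \<nu> \<omega>. functional_equation L Q K lam \<nu> \<omega> \<and> d = 2 * (\<Sum>j=1..K. lam j)"
  obtain Q0 K0 lam0 \<nu>0 \<omega>0 where "functional_equation L Q0 K0 lam0 \<nu>0 \<omega>0"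
    using assms(1) unfolding extended_selberg_class_def by blast
  then have "\<exists>d. ?P d" by blast
  then have "?P (SOME d. ?P d)" by (rule someI_ex)
  then have "?P (selberg_degree L)" unfolding selberg_degree_def .
  then obtain Q K lam \<nu> \<omega> where fe: "functional_equation L Q K lam \<nu> \<omega>"
    and d: "selberg_degree L = 2 * (\<Sum>j=1..K. lam j)" by blast
  have "K \<ge> 1" using d assms(2) by (cases K) auto
  with fe show ?thesis using that by blast
qed

text \<open>The error of order \<open>2 powr (- Re z)\<close> is converted by
  \<open>Re z \<ge> (\<epsilon> / 2) * Im z\<close>; the rate obtained in this way tends to 0 with
  \<open>\<epsilon>\<close>.\<close>

lemma near_one_dirichlet_series:
  assumes L: "has_dirichlet_series L a" "a 1 = 1" and \<epsilon>: "\<epsilon> > 0" and c: "c \<le> ln 2 * (\<epsilon> / 2)"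
  shows "near_one \<epsilon> c L"
proof -
  obtain M where M: "\<And>s. Re s \<ge> 2 \<Longrightarrow> norm (L s * of_nat 1 powr s - a 1) \<le> M * (real 1 / (real 1 + 1)) powr Re s"
    using dirichlet_series_leading_term[OF L(1), of 1] by auto
  show ?thesis
  proof (rule bigoI[of _ "\<bar>M\<bar>"])
    show "\<forall>\<^sub>F z in ray_filter \<epsilon>. norm (L z - 1) \<le> \<bar>M\<bar> * norm (exp_decay c z)"
      using eventually_Re_gt_ray_filter[OF \<epsilon>, of 2] eventually_Im_gt_ray_filter[of 0]
        eventually_Re_ge_Im_ray_filter[OF \<epsilon>]
    proof eventually_elim
      case (elim z)
      have "norm (L z - 1) \<le> M * (1 / 2) powr Re z" using M[of z] elim L(2) by simp
      also have "\<dots> \<le> \<bar>M\<bar> * (1 / 2) powr Re z" by (intro mult_right_mono) auto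
      also have "(1 / 2) powr Re z \<le> exp (- (c * Im z))"
      proof -
        have "c * Im z \<le> ln 2 * ((\<epsilon> / 2) * Im z)"
          using mult_right_mono[OF c, of "Im z"] elim by simp
        also have "\<dots> \<le> ln 2 * Re z" using elim by (intro mult_left_mono) auto
        finally show ?thesis by (simp add: powr_def ln_div mult.commute)
      qed
      finally show ?case by (simp add: mult_left_mono)
    qed
  qed
qed

lemma near_one_one_minus_small:
  assumes "eventually (\<lambda>z. norm (X z) \<ge> exp (c * Im z)) (ray_filter \<epsilon>)"
  shows "near_one \<epsilon> c (\<lambda>z. 1 - b / X z)"
proof (rule bigoI[of _ "norm b"])
  show "\<forall>\<^sub>F z in ray_filter \<epsilon>. norm (1 - b / X z - 1) \<le> norm b * norm (exp_decay c z)"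
    using assms
  proof eventually_elim
    case (elim z)
    have "norm b / norm (X z) \<le> norm b / exp (c * Im z)"
      using elim by (intro divide_left_mono mult_pos_pos) (auto intro: less_le_trans[OF exp_gt_zero])
    moreover have "norm (exp_decay c z) = inverse (exp (c * Im z))"
      unfolding norm_of_real by (simp flip: exp_minus)
    ultimately show ?case by (simp only: norm_divide divide_inverse) (simp add: norm_mult norm_inverse)
  qed
qed

text \<open>The order of quantifiers matters: \<open>d\<close> is fixed before
  \<open>\<epsilon>\<close>. It stems from the oscillation factors alone, since the terms
  \<open>cnj \<alpha> / reflected L z\<close> decay at every exponential rate. For the same reason
  \<open>L z\<close> stays explicit instead of joining \<open>N\<close>: the rate known for its
  distance from 1 depends on \<open>\<epsilon>\<close>.\<close>

lemma reflected_prod_asymptotics: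
  assumes L: "L \<in> extended_selberg_class" "selberg_degree L > 0" "has_dirichlet_series L a" "a 1 = 1"
    and S: "finite S"
  shows "\<exists>d>0. \<forall>\<epsilon>>0. \<exists>A B xs N W. (\<forall>(c, l, \<mu>)\<in>set xs. l > 0) \<and> near_one \<epsilon> d N \<and> near_one \<epsilon> d W \<and>
    (\<forall>\<^sub>F z in ray_filter \<epsilon>. (\<Prod>\<alpha>\<in>S. reflected L z - cnj \<alpha>)
      = (L z * exp (log_Gamma_product A B xs z) * N z) ^ card S * W z)"
proof -
  have hol: "L holomorphic_on -{1}" by (rule selberg_class_holomorphic[OF L(1)])
  obtain Q K lam \<nu> \<omega> where fe: "functional_equation L Q K lam \<nu> \<omega>" and K: "K \<ge> 1"
    using positive_degree_functional_equation[OF L(1,2)] by blast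
  have lam: "\<forall>j\<in>{1..K}. lam j > 0" using fe unfolding functional_equation_def by blast
  define d where "d = 2 * pi * Min (lam ` {1..K})"
  have "Min (lam ` {1..K}) > 0" using lam K by (subst Min_gr_iff) auto
  then have d: "d > 0" by (simp add: d_def)
  have d_le: "d \<le> 2 * pi * lam j" if "j \<in> {1..K}" for j
    using that by (simp add: d_def)
  have "\<exists>A B xs N W. (\<forall>(c, l, \<mu>)\<in>set xs. l > 0) \<and> near_one \<epsilon> d N \<and> near_one \<epsilon> d W \<and>
    (\<forall>\<^sub>F z in ray_filter \<epsilon>. (\<Prod>\<alpha>\<in>S. reflected L z - cnj \<alpha>)
      = (L z * exp (log_Gamma_product A B xs z) * N z) ^ card S * W z)" if \<epsilon>: "\<epsilon> > 0" for \<epsilon>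
  proof -
    define N where "N z = (\<Prod>j=1..K. oscillation (lam j) (\<nu> j) z)" for z
    define W where "W z = (\<Prod>\<alpha>\<in>S. 1 - cnj \<alpha> / reflected L z)" for z
    have lim: "(L \<longlongrightarrow> 1) (ray_filter \<epsilon>)"
      using near_one_tendsto[OF near_one_dirichlet_series[OF L(3,4) \<epsilon> order_refl]] \<epsilon> by simp
    note grow = reflected_growth[OF hol fe K lim \<epsilon>]
    obtain A B xs where xs: "\<forall>(c, l, \<mu>)\<in>set xs. l > 0"
      and eq: "\<forall>\<^sub>F z in ray_filter \<epsilon>. reflected L z = L z * exp (log_Gamma_product A B xs z) * N z"
      by (rule reflected_eq_exp[OF hol fe \<epsilon>, folded N_def]) blast
    have "near_one \<epsilon> d N" unfolding N_def
      by (intro near_one_prod near_one_oscillation d_le d)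
    moreover have "near_one \<epsilon> d W" unfolding W_def
      by (intro near_one_prod near_one_one_minus_small grow d)
    moreover have "\<forall>\<^sub>F z in ray_filter \<epsilon>. (\<Prod>\<alpha>\<in>S. reflected L z - cnj \<alpha>)
        = (L z * exp (log_Gamma_product A B xs z) * N z) ^ card S * W z"
      using grow[of 0] eq
    proof eventually_elim
      case (elim z)
      then have nz: "reflected L z \<noteq> 0" by auto
      have "(\<Prod>\<alpha>\<in>S. reflected L z - cnj \<alpha>) = (\<Prod>\<alpha>\<in>S. reflected L z * (1 - cnj \<alpha> / reflected L z))"
        using nz by (intro prod.cong) (auto simp: field_simps)
      also have "\<dots> = reflected L z ^ card S * W z" by (simp add: prod.distrib W_def)
      finally show ?case by (simp only: elim(2))
    qed
    ultimately show ?thesis using xs by blast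
  qed
  with d show ?thesis by blast
qed

section \<open>Equality of normalised meromorphic functions and the final contradiction\<close>

lemma nicely_meromorphic_eqI_puncture:
  assumes f: "f nicely_meromorphic_on UNIV" and g: "g nicely_meromorphic_on UNIV"
    and eq: "\<And>z. z \<noteq> a \<Longrightarrow> f z = g z"
  shows "f = g"
proof
  fix z
  show "f z = g z"
  proof (cases "z = a")
    case True
    have ev: "\<forall>\<^sub>F w in at a. f w = g w"
      using eventually_neq_at_within[of a a UNIV] by eventually_elim (rule eq)
    \<comment> \<open>The normalisation determines the value at \<open>a\<close> from nearby values:
      0 at a pole, the limit elsewhere.\<close>
    have fa: "(is_pole f a \<and> f a = 0) \<or> f \<midarrow>a\<rightarrow> f a" and ga: "(is_pole g a \<and> g a = 0) \<or> g \<midarrow>a\<rightarrow> g a"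
      using f g by (auto simp: nicely_meromorphic_on_def)
    have pole: "is_pole f a \<longleftrightarrow> is_pole g a" by (rule is_pole_cong[OF ev refl])
    have lim: "f \<midarrow>a\<rightarrow> g a \<longleftrightarrow> g \<midarrow>a\<rightarrow> g a" by (rule tendsto_cong[OF ev])
    show ?thesis
    proof (cases "is_pole f a")
      case True
      then have "\<not> f \<midarrow>a\<rightarrow> f a" "\<not> g \<midarrow>a\<rightarrow> g a"
        using pole not_tendsto_and_filterlim_at_infinity[of "at a"] unfolding is_pole_def by auto
      then show ?thesis using fa ga \<open>z = a\<close> by simp
    next
      case False
      then have "f \<midarrow>a\<rightarrow> f a" "f \<midarrow>a\<rightarrow> g a" using fa ga pole lim by auto
      then show ?thesis using tendsto_unique[of "at a"] \<open>z = a\<close> by (simp add: LIM_unique)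
    qed
  qed (rule eq)
qed

lemma selberg_class_eqI:
  assumes L: "L1 \<in> extended_selberg_class" "L2 \<in> extended_selberg_class"
    and eq: "\<And>s. Re s > 1 \<Longrightarrow> L1 s = L2 s"
  shows "L1 = L2"
proof (rule nicely_meromorphic_eqI_puncture[of _ _ 1])
  show "L1 nicely_meromorphic_on UNIV" "L2 nicely_meromorphic_on UNIV"
    using L by (auto simp: extended_selberg_class_def)
  fix z :: complex assume z: "z \<noteq> 1"
  show "L1 z = L2 z"
  proof (rule analytic_continuation_open[of "{s. Re s > 1}" "-{1}" L1 L2])
    show "{s. Re s > 1} \<noteq> {}" by (auto intro!: exI[of _ 2])
    show "connected (- {1 :: complex})" by (rule connected_punctured_universe) simp
  qed (use L z eq in \<open>auto simp: open_halfspace_Re_gt selberg_class_holomorphic\<close>)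
qed

theorem theorem1p1:
  fixes L1 L2 :: "complex \<Rightarrow> complex" and a1 a2 :: "nat \<Rightarrow> complex"
    and t :: nat and \<alpha> :: "nat \<Rightarrow> complex" and S :: "complex set"
  assumes "L1 \<in> extended_selberg_class" and "L2 \<in> extended_selberg_class"
    and "\<not> L1 constant_on UNIV" and "\<not> L2 constant_on UNIV"
    and "selberg_degree L1 > 0" and "selberg_degree L2 > 0"
    and "has_dirichlet_series L1 a1" and "a1 1 = 1"
    and "has_dirichlet_series L2 a2" and "a2 1 = 1"
    and "t \<ge> 1" and "inj_on \<alpha> {1..t}" and "S = \<alpha> ` {1..t}"
    and "share_set_CM L1 L2 S"
  shows "L1 = L2"
proof (rule ccontr)
  assume ne: "L1 \<noteq> L2"
  define n where "n = card S"
  have S: "finite S" and n: "n \<ge> 1"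
    using assms(11-13) by (auto simp: n_def card_image)
  obtain C b where C: "C \<noteq> 0"
    and quot: "\<And>s. s \<noteq> 1 \<Longrightarrow> (\<Prod>\<alpha>\<in>S. L1 s - \<alpha>) = C * exp (of_real b * s) * (\<Prod>\<alpha>\<in>S. L2 s - \<alpha>)"
    using share_set_CM_imp_exponential_quotient[OF assms(1,3,7,8) assms(2,4,9,10) S assms(14)] by blast
  have D: "has_dirichlet_series (\<lambda>s. L1 s - L2 s) (\<lambda>n. a1 n - a2 n)"
    by (rule dirichlet_series_diff[OF assms(7,9)])
  have "\<exists>m\<ge>1. a1 m - a2 m \<noteq> 0"
  proof (rule ccontr)
    assume "\<not> ?thesis"
    then have "L1 s - L2 s = 0" if "Re s > 1" for s
      by (intro dirichlet_series_zero[OF D _ that]) auto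
    then have "L1 = L2" by (intro selberg_class_eqI assms(1,2)) auto
    with ne show False by simp
  qed
  then obtain m where m: "m \<ge> 1" "a1 m - a2 m \<noteq> 0" and least: "\<And>k. 1 \<le> k \<Longrightarrow> k < m \<Longrightarrow> a1 k - a2 k = 0"
    using exists_least_iff[of "\<lambda>m. m \<ge> 1 \<and> a1 m - a2 m \<noteq> 0"] by metis
  obtain d1 where d1: "d1 > 0" and asym1: "\<And>\<epsilon>. \<epsilon> > 0 \<Longrightarrow> \<exists>A B xs N W. (\<forall>(c, l, \<mu>)\<in>set xs. l > 0) \<and>
    near_one \<epsilon> d1 N \<and> near_one \<epsilon> d1 W \<and> (\<forall>\<^sub>F z in ray_filter \<epsilon>. (\<Prod>\<alpha>\<in>S. reflected L1 z - cnj \<alpha>)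
      = (L1 z * exp (log_Gamma_product A B xs z) * N z) ^ card S * W z)"
    using reflected_prod_asymptotics[OF assms(1,5,7,8) S] by blast
  obtain d2 where d2: "d2 > 0" and asym2: "\<And>\<epsilon>. \<epsilon> > 0 \<Longrightarrow> \<exists>A B xs N W. (\<forall>(c, l, \<mu>)\<in>set xs. l > 0) \<and>
    near_one \<epsilon> d2 N \<and> near_one \<epsilon> d2 W \<and> (\<forall>\<^sub>F z in ray_filter \<epsilon>. (\<Prod>\<alpha>\<in>S. reflected L2 z - cnj \<alpha>)
      = (L2 z * exp (log_Gamma_product A B xs z) * N z) ^ card S * W z)"
    using reflected_prod_asymptotics[OF assms(2,6,9,10) S] by blast
  define d where "d = min d1 d2"
  have d: "d > 0" using d1 d2 by (simp add: d_def)
  \<comment> \<open>Along the ray the modulus of \<open>m powr z\<close> grows like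
    \<open>exp (\<epsilon> * ln m * Im z)\<close>; the choice keeps this rate at most
    \<open>d / 2\<close>. The summand 1 keeps the denominator positive even if
    \<open>ln m = 0\<close>.\<close>
  define \<epsilon> where "\<epsilon> = d / (2 * (1 + ln (real m)))"
  have lnm: "ln (real m) \<ge> 0" using m by simp
  then have \<epsilon>: "\<epsilon> > 0" using d by (simp add: \<epsilon>_def add_pos_nonneg)
  have \<epsilon>_less: "\<epsilon> * ln (real m) < d"
  proof -
    have "\<epsilon> * ln (real m) \<le> \<epsilon> * (1 + ln (real m))" using \<epsilon> by simp
    also have "\<dots> = d / 2"
    proof -
      define k where "k = 1 + ln (real m)"
      have "k > 0" using lnm by (simp add: k_def)
      then show ?thesis unfolding \<epsilon>_def k_def[symmetric] by simp
    qed
    also have "\<dots> < d" using d by simp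
    finally show ?thesis .
  qed
  obtain A1 B1 xs1 N1 W1 where xs1: "\<forall>(c, l, \<mu>)\<in>set xs1. l > 0" and NW1': "near_one \<epsilon> d1 N1" "near_one \<epsilon> d1 W1"
    and ev1: "\<forall>\<^sub>F z in ray_filter \<epsilon>. (\<Prod>\<alpha>\<in>S. reflected L1 z - cnj \<alpha>)
      = (L1 z * exp (log_Gamma_product A1 B1 xs1 z) * N1 z) ^ n * W1 z"
    using asym1[OF \<epsilon>] unfolding n_def by blast
  obtain A2 B2 xs2 N2 W2 where xs2: "\<forall>(c, l, \<mu>)\<in>set xs2. l > 0" and NW2': "near_one \<epsilon> d2 N2" "near_one \<epsilon> d2 W2"
    and ev2: "\<forall>\<^sub>F z in ray_filter \<epsilon>. (\<Prod>\<alpha>\<in>S. reflected L2 z - cnj \<alpha>)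
      = (L2 z * exp (log_Gamma_product A2 B2 xs2 z) * N2 z) ^ n * W2 z"
    using asym2[OF \<epsilon>] unfolding n_def by blast
  have NW1: "near_one \<epsilon> d N1" "near_one \<epsilon> d W1" by (rule near_one_mono[OF NW1'(1)] near_one_mono[OF NW1'(2)]; simp add: d_def)+
  have NW2: "near_one \<epsilon> d N2" "near_one \<epsilon> d W2" by (rule near_one_mono[OF NW2'(1)] near_one_mono[OF NW2'(2)]; simp add: d_def)+
  \<comment> \<open>The rate for the first comparison: there the quotient \<open>L2 / L1\<close>
    counts as error, so the rate of the Dirichlet series limits it.\<close>
  define e where "e = min d (ln 2 * (\<epsilon> / 2))"
  have e: "e > 0" "e \<le> d" "e \<le> ln 2 * (\<epsilon> / 2)" using d \<epsilon> by (auto simp: e_def)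
  have L1n: "near_one \<epsilon> e L1" and L2n: "near_one \<epsilon> e L2"
    using near_one_dirichlet_series[OF assms(7,8) \<epsilon> e(3)] near_one_dirichlet_series[OF assms(9,10) \<epsilon> e(3)] by auto
  have nz: "\<forall>\<^sub>F z in ray_filter \<epsilon>. f z \<noteq> 0" if "near_one \<epsilon> c f" "c > 0" for c f
    by (rule tendsto_imp_eventually_ne[OF near_one_tendsto[OF that]]) simp
  note nzs = nz[OF L1n e(1)] nz[OF L2n e(1)] nz[OF NW1(1) d] nz[OF NW1(2) d] nz[OF NW2(1) d] nz[OF NW2(2) d]
  define c where "c = Ln (cnj C)"
  have expc: "exp c = cnj C" using C by (simp add: c_def exp_Ln)
  define p1 where "p1 = log_Gamma_product A1 B1 xs1"
  define p2 where "p2 = log_Gamma_product A2 B2 xs2"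
  \<comment> \<open>The exponents of both sides, with the exponential factor of the quotient taken
    at \<open>1 - cnj z\<close> and conjugated; this turns \<open>C\<close> into
    \<open>cnj C\<close> and \<open>b * s\<close> into \<open>b * (1 - z)\<close>.\<close>
  define v where "v z = of_nat n * p1 z - of_nat n * p2 z - (c + of_real b * (1 - z))" for z
  define xs where "xs = map (\<lambda>(c, l, \<mu>). (of_nat n * c, l, \<mu>)) xs1 @ map (\<lambda>(c, l, \<mu>). (- of_nat n * c, l, \<mu>)) xs2"
  \<comment> \<open>The linear part enters as a product over the empty list, hence
    \<open>xs @ []\<close>.\<close>
  have v_eq: "v z = log_Gamma_product (of_nat n * A1 + - of_nat n * A2 + (- c - of_real b))
      (of_nat n * B1 + - of_nat n * B2 + of_real b) (xs @ []) z" for z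
  proof -
    have "v z = (of_nat n * p1 z + - of_nat n * p2 z) + log_Gamma_product (- c - of_real b) (of_real b) [] z"
      by (simp add: v_def log_Gamma_product_def algebra_simps)
    then show ?thesis
      by (simp only: p1_def p2_def xs_def log_Gamma_product_scale log_Gamma_product_append)
  qed
  have main: "\<forall>\<^sub>F z in ray_filter \<epsilon>. exp (v z) * (L1 z ^ n * (N1 z ^ n * W1 z)) = L2 z ^ n * (N2 z ^ n * W2 z)"
    using ev1 ev2 eventually_Im_gt_ray_filter[of 0]
  proof eventually_elim
    case (elim z)
    then have "1 - cnj z \<noteq> 1" by auto
    from arg_cong[OF quot[OF this], of cnj]
    have "(\<Prod>\<alpha>\<in>S. reflected L1 z - cnj \<alpha>) = cnj C * exp (of_real b * (1 - z)) * (\<Prod>\<alpha>\<in>S. reflected L2 z - cnj \<alpha>)"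
      by (simp add: reflected_def exp_cnj)
    then have "(L1 z * exp (p1 z) * N1 z) ^ n * W1 z = exp (c + of_real b * (1 - z)) * ((L2 z * exp (p2 z) * N2 z) ^ n * W2 z)"
      using elim by (simp add: exp_add expc p1_def p2_def)
    then have eq: "exp (of_nat n * p1 z) * (L1 z ^ n * (N1 z ^ n * W1 z))
        = (exp (c + of_real b * (1 - z)) * exp (of_nat n * p2 z)) * (L2 z ^ n * (N2 z ^ n * W2 z))"
      by (simp add: power_mult_distrib exp_of_nat_mult mult_ac)
    have "exp (v z) * (exp (c + of_real b * (1 - z)) * exp (of_nat n * p2 z)) = exp (of_nat n * p1 z)"
      unfolding exp_add[symmetric] by (simp add: v_def)
    then have "(exp (c + of_real b * (1 - z)) * exp (of_nat n * p2 z)) * (exp (v z) * (L1 z ^ n * (N1 z ^ n * W1 z)))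
        = (exp (c + of_real b * (1 - z)) * exp (of_nat n * p2 z)) * (L2 z ^ n * (N2 z ^ n * W2 z))"
      using eq by (metis mult.assoc mult.commute)
    then show ?case by simp
  qed
  have "near_one \<epsilon> e (\<lambda>z. (L2 z / L1 z) ^ n * ((N2 z / N1 z) ^ n * (W2 z / W1 z)))"
    by (intro near_one_mult near_one_power near_one_divide L1n L2n e near_one_mono[OF NW1(1) e(2)]
        near_one_mono[OF NW1(2) e(2)] near_one_mono[OF NW2(1) e(2)] near_one_mono[OF NW2(2) e(2)])
  moreover have "\<forall>\<^sub>F z in ray_filter \<epsilon>. (L2 z / L1 z) ^ n * ((N2 z / N1 z) ^ n * (W2 z / W1 z)) = exp (v z)"
    using main nzs
  proof eventually_elim
    case (elim z)
    then show ?case by (simp add: power_divide field_simps)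
  qed
  ultimately have "near_one \<epsilon> e (\<lambda>z. exp (v z))"
    by (rule near_one_cong)
  moreover have "\<forall>(c, l, \<mu>)\<in>set (xs @ []). l > 0" using xs1 xs2 by (auto simp: xs_def)
  ultimately obtain R where R: "\<And>z. Re z > R \<Longrightarrow> exp (v z) = 1"
    unfolding v_eq using log_Gamma_product_rigidity[OF _ \<epsilon> e(1)] by blast
  \<comment> \<open>With \<open>exp v = 1\<close> exactly, the L-functions move to the other side of
    \<open>main\<close>, and the errors that remain have the rate \<open>d\<close>.\<close>
  have "near_one \<epsilon> d (\<lambda>z. (N2 z / N1 z) ^ n * (W2 z / W1 z))"
    by (intro near_one_mult near_one_power near_one_divide NW1 NW2 d)
  moreover have "\<forall>\<^sub>F z in ray_filter \<epsilon>. (N2 z / N1 z) ^ n * (W2 z / W1 z) = (L1 z / L2 z) ^ n"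
    using main nzs eventually_Re_gt_ray_filter[OF \<epsilon>, of R]
  proof eventually_elim
    case (elim z)
    then show ?case using R[of z] by (simp add: power_divide field_simps)
  qed
  ultimately have pow: "near_one \<epsilon> d (\<lambda>z. (L1 z / L2 z) ^ n)"
    by (rule near_one_cong)
  have quot_n: "near_one \<epsilon> d (\<lambda>z. L1 z / L2 z)"
    by (rule near_one_root[OF pow near_one_tendsto[OF near_one_divide[OF L1n L2n e(1)] e(1)] n])
  have "(\<lambda>z. (L1 z / L2 z - 1) * L2 z) \<in> O[ray_filter \<epsilon>](\<lambda>z. exp_decay d z * 1)"
    by (intro landau_o.big.mult quot_n tendsto_imp_bigo_1[OF near_one_tendsto[OF L2n e(1)]])
  then have small: "(\<lambda>z. (L1 z / L2 z - 1) * L2 z) \<in> O[ray_filter \<epsilon>](exp_decay d)" by simp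
  obtain M where M: "M > 0" "\<forall>\<^sub>F z in ray_filter \<epsilon>. norm ((L1 z / L2 z - 1) * L2 z) \<le> M * exp (- (d * Im z))"
    using landau_o.bigE[OF small] by (auto simp: norm_of_real)
  have diff: "\<forall>\<^sub>F z in ray_filter \<epsilon>. norm (L1 z - L2 z) \<le> M * exp (- (d * Im z))"
    using M(2) nzs(2) by eventually_elim (simp add: left_diff_distrib)
  define w where "w = Complex \<epsilon> 1"
  have "filterlim (\<lambda>z. z) right_end (ray_filter \<epsilon>)"
    using filterlim_Re_ray_filter[OF \<epsilon>] by (simp add: filterlim_filtercomap_iff o_def)
  then have path: "filterlim (\<lambda>r. w * of_real r) right_end at_top"
    using filterlim_compose[OF _ filterlim_ray[of \<epsilon>]] unfolding w_def by fastforce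
  \<comment> \<open>The difference, rescaled by its leading term, has the non-zero limit
    \<open>a1 m - a2 m\<close>; but the bound \<open>diff\<close> beats the growth of
    \<open>m powr (w * r)\<close>, since \<open>\<epsilon> * ln m < d\<close>.\<close>
  have lim: "((\<lambda>r. (L1 (w * of_real r) - L2 (w * of_real r)) * of_nat m powr (w * of_real r)) \<longlongrightarrow> a1 m - a2 m) at_top"
    by (rule filterlim_compose[OF dirichlet_series_limit[OF D m(1) least] path])
  have "\<forall>\<^sub>F r in at_top. norm ((L1 (w * of_real r) - L2 (w * of_real r)) * of_nat m powr (w * of_real r))
      \<le> M * exp (- ((d - \<epsilon> * ln (real m)) * r))"
    using eventually_compose_filterlim[OF diff filterlim_ray]
  proof eventually_elim
    case (elim r)
    have "norm ((L1 (w * of_real r) - L2 (w * of_real r)) * of_nat m powr (w * of_real r))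
        \<le> M * exp (- (d * r)) * real m powr (\<epsilon> * r)"
      using elim m by (simp add: norm_mult norm_of_nat_powr w_def mult_right_mono)
    also have "real m powr (\<epsilon> * r) = exp (\<epsilon> * r * ln (real m))" using m by (simp add: powr_def)
    also have "M * exp (- (d * r)) * exp (\<epsilon> * r * ln (real m)) = M * exp (- ((d - \<epsilon> * ln (real m)) * r))"
      by (simp add: algebra_simps flip: exp_add)
    finally show ?case .
  qed
  moreover have "((\<lambda>r. M * exp (- ((d - \<epsilon> * ln (real m)) * r))) \<longlongrightarrow> 0) at_top"
  proof -
    have "filterlim (\<lambda>r. (d - \<epsilon> * ln (real m)) * r) at_top at_top"
      using \<epsilon>_less by (intro filterlim_tendsto_pos_mult_at_top[OF tendsto_const] filterlim_ident) auto
    then have "filterlim (\<lambda>r. - ((d - \<epsilon> * ln (real m)) * r)) at_bot at_top"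
      by (simp add: filterlim_uminus_at_top)
    then show ?thesis by (intro tendsto_mult_right_zero filterlim_compose[OF exp_at_bot])
  qed
  ultimately have "((\<lambda>r. (L1 (w * of_real r) - L2 (w * of_real r)) * of_nat m powr (w * of_real r)) \<longlongrightarrow> 0) at_top"
    by (rule Lim_null_comparison)
  with lim have "a1 m - a2 m = 0" using tendsto_unique[OF trivial_limit_at_top_linorder] by blast
  with m(2) show False by simp
qed

end
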